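(* Two $p$-theta $q$-difference equations $v(qz)=A(z)v(z)$ and $v(qz)=A'(z)v(z)$ are isomonodromic if and only if there exists a nonsingular $p$-elliptic matrix $B(z)$ such that $$A'(z)B(z)=B(qz)A(z).$$
   Context: $p,q$ are fixed nonzero complex numbers with $|p|,|q|<1$ and $p^{\mathbb Z}\cap q^{\mathbb Z}=\{1\}$. $\mathbb C^*=\mathbb C\setminus\{0\}$. A nonsingular meromorphic matrix is a square matrix whose entries are meromorphic on $\mathbb C^*$ and whose determinant is not identically $0$; it is $p$-elliptic (resp. $q$-elliptic) if it is invariant under $z\mapsto pz$ (resp. $z\mapsto qz$). A $p$-theta $q$-difference equation of multiplier $\mu(z)=\alpha z^k$ ($\alpha\in\mathbb C^*$, $k\in\mathbb Z$) is an equation $v(qz)=A(z)v(z)$, where the shift matrix $A(z)$ is a nonsingular meromorphic matrix with $A(pz)=\mu(z)A(z)$. A meromorphic fundamental matrix for it is a nonsingular meromorphic matrix $M(z)$ with $M(qz)=A(z)M(z)$ (one always exists, by a theorem of Praagman). A $q$-theta $p$-difference equation and its fundamental matrices are defined by exchanging $p$ and $q$. For each meromorphic fundamental matrix $M$ of a $p$-theta $q$-difference equation of multiplier $\mu$, $M^t$ is a fundamental matrix of the unique $q$-theta $p$-difference equation $w(pz)=C(z)w(z)$ with $C(z)=M(pz)^tM(z)^{-t}$ (again of multiplier $\mu$); such equations are said to be associated to the given $p$-theta $q$-difference equation. Call two $q$-theta $p$-difference equations with shift matrices $C,C'$ equivalent if there is a nonsingular $q$-elliptic matrix $D(z)$ with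 $C'(z)D(z)=D(pz)C(z)$. The $q$-theta $p$-difference equations associated to a given $p$-theta $q$-difference equation form an equivalence class, called its weak monodromy. Two $p$-theta $q$-difference equations are isomonodromic if they have the same weak monodromy. *)

theory Defs
  imports "HOL-Complex_Analysis.Complex_Analysis" "Jordan_Normal_Form.Determinant"
begin

(* A meromorphic matrix is represented by a function into complex mat.  Its entries are
   meromorphic_on - {0}, a notion that ignores the values at 0 and on any sparse subset of
   - {0}.  Hence identities between meromorphic matrices are always stated off a sparse set. *)

definition meromorphic_matrix :: "nat \<Rightarrow> (complex \<Rightarrow> complex mat) \<Rightarrow> bool" where
  "meromorphic_matrix n M \<longleftrightarrow>
     (\<forall>z. M z \<in> carrier_mat n n) \<and>
     (\<forall>i<n. \<forall>j<n. (\<lambda>z. M z $$ (i, j)) meromorphic_on - {0})"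

definition nonsingular_meromorphic :: "(complex \<Rightarrow> complex mat) \<Rightarrow> bool" where
  "nonsingular_meromorphic M \<longleftrightarrow>
     (\<exists>n>0. meromorphic_matrix n M) \<and>
     \<not> (\<forall>\<^sub>\<approx>z\<in>- {0}. Determinant.det (M z) = 0)"

definition nonsingular_elliptic :: "complex \<Rightarrow> (complex \<Rightarrow> complex mat) \<Rightarrow> bool" where
  "nonsingular_elliptic r B \<longleftrightarrow>
     nonsingular_meromorphic B \<and> (\<forall>\<^sub>\<approx>z\<in>- {0}. B (r * z) = B z)"

(* An equation v(s z) = A(z) v(z) is identified with its shift matrix A.  The condition that it
   is an r-theta s-difference equation of multiplier \<alpha> z^k does not involve s. *)

definition theta_multiplier ::
    "complex \<Rightarrow> complex \<Rightarrow> int \<Rightarrow> (complex \<Rightarrow> complex mat) \<Rightarrow> bool" where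
  "theta_multiplier r \<alpha> k A \<longleftrightarrow>
     \<alpha> \<noteq> 0 \<and> nonsingular_meromorphic A \<and>
     (\<forall>\<^sub>\<approx>z\<in>- {0}. A (r * z) = (\<alpha> * z powi k) \<cdot>\<^sub>m A z)"

definition theta_shift :: "complex \<Rightarrow> (complex \<Rightarrow> complex mat) \<Rightarrow> bool" where
  "theta_shift r A \<longleftrightarrow> (\<exists>\<alpha> k. theta_multiplier r \<alpha> k A)"

definition fundamental_matrix ::
    "complex \<Rightarrow> (complex \<Rightarrow> complex mat) \<Rightarrow> (complex \<Rightarrow> complex mat) \<Rightarrow> bool" where
  "fundamental_matrix s A M \<longleftrightarrow>
     nonsingular_meromorphic M \<and> (\<forall>\<^sub>\<approx>z\<in>- {0}. M (s * z) = A z * M z)"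

definition associated ::
    "complex \<Rightarrow> complex \<Rightarrow> (complex \<Rightarrow> complex mat) \<Rightarrow> (complex \<Rightarrow> complex mat) \<Rightarrow> bool" where
  "associated p q A C \<longleftrightarrow>
     theta_shift q C \<and>
     (\<exists>M. fundamental_matrix q A M \<and>
          fundamental_matrix p C (\<lambda>z. transpose_mat (M z)))"

definition equivalent ::
    "complex \<Rightarrow> complex \<Rightarrow> (complex \<Rightarrow> complex mat) \<Rightarrow> (complex \<Rightarrow> complex mat) \<Rightarrow> bool" where
  "equivalent p q C C' \<longleftrightarrow>
     (\<exists>D. nonsingular_elliptic q D \<and> (\<forall>\<^sub>\<approx>z\<in>- {0}. C' z * D z = D (p * z) * C z))"

(* weak_monodromy_eq_class below shows that this is a class of the relation equivalent. *)

definition weak_monodromy ::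
    "complex \<Rightarrow> complex \<Rightarrow> (complex \<Rightarrow> complex mat) \<Rightarrow> (complex \<Rightarrow> complex mat) set" where
  "weak_monodromy p q A = {C. associated p q A C}"

definition isomonodromic ::
    "complex \<Rightarrow> complex \<Rightarrow> (complex \<Rightarrow> complex mat) \<Rightarrow> (complex \<Rightarrow> complex mat) \<Rightarrow> bool" where
  "isomonodromic p q A A' \<longleftrightarrow> weak_monodromy p q A = weak_monodromy p q A'"


lemma cosparse_punctured:
  "(\<forall>\<^sub>\<approx>z\<in>- {0::complex}. P z) \<longleftrightarrow> (\<forall>x. x \<noteq> 0 \<longrightarrow> eventually P (at x))"
  by (subst eventually_cosparse_open_eq) (auto intro: open_Compl)

lemma cosparse_ex:
  assumes "\<forall>\<^sub>\<approx>z\<in>- {0::complex}. P z"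
  shows "\<exists>z. P z"
proof -
  have "eventually P (at 1)" using assms by (auto simp: cosparse_punctured)
  thus ?thesis using eventually_happens by force
qed

lemma eventually_cosparse_scale:
  fixes a :: complex
  assumes "a \<noteq> 0" "\<forall>\<^sub>\<approx>z\<in>- {0}. P z"
  shows "\<forall>\<^sub>\<approx>z\<in>- {0}. P (a * z)"
proof -
  have "eventually (\<lambda>z. P (a * z)) (at x)" if "x \<noteq> 0" for x
  proof -
    have "eventually P (at (a * x))"
      using assms that by (auto simp: cosparse_punctured)
    moreover have "filterlim (\<lambda>z. a * z) (at (a * x)) (at x)"
      using assms(1) by (intro filterlim_atI tendsto_intros) (auto simp: eventually_at_filter)
    ultimately show ?thesis
      by (simp add: filterlim_iff)
  qed
  thus ?thesis by (auto simp: cosparse_punctured)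
qed

lemma meromorphic_matrix_det:
  assumes "meromorphic_matrix n M"
  shows "(\<lambda>z. Determinant.det (M z)) meromorphic_on - {0}"
proof -
  have "(\<lambda>z. Determinant.det (M z)) = (\<lambda>z. \<Sum> p \<in> {p. p permutes {0 ..< n}}.
     signof p * (\<Prod> i = 0 ..< n. M z $$ (i, p i)))"
    using assms det_def' unfolding meromorphic_matrix_def by blast
  moreover have "\<dots> meromorphic_on - {0}"
    using assms unfolding meromorphic_matrix_def
    by (intro meromorphic_intros) (auto simp: permutes_in_image)
  ultimately show ?thesis by simp
qed

lemma meromorphic_matrix_mult:
  assumes "meromorphic_matrix n M" "meromorphic_matrix n N"
  shows "meromorphic_matrix n (\<lambda>z. M z * N z)"
proof -
  have c: "M z \<in> carrier_mat n n" "N z \<in> carrier_mat n n" for z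
    using assms by (auto simp: meromorphic_matrix_def)
  have "(\<lambda>z. (M z * N z) $$ (i,j)) = (\<lambda>z. \<Sum>k = 0..<n. M z $$ (i,k) * N z $$ (k,j))"
    if "i < n" "j < n" for i j
    using that c[THEN carrier_matD(1)] c[THEN carrier_matD(2)] by (simp add: scalar_prod_def)
  moreover have "(\<lambda>z. \<Sum>k = 0..<n. M z $$ (i,k) * N z $$ (k,j)) meromorphic_on - {0}"
    if "i < n" "j < n" for i j
    using that assms unfolding meromorphic_matrix_def by (intro meromorphic_intros) auto
  ultimately show ?thesis using c unfolding meromorphic_matrix_def by (auto intro!: mult_carrier_mat)
qed

lemma meromorphic_matrix_transpose:
  assumes "meromorphic_matrix n M"
  shows "meromorphic_matrix n (\<lambda>z. transpose_mat (M z))"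
proof -
  have c: "M z \<in> carrier_mat n n" for z
    using assms by (auto simp: meromorphic_matrix_def)
  have "(\<lambda>z. transpose_mat (M z) $$ (i,j)) = (\<lambda>z. M z $$ (j,i))" if "i < n" "j < n" for i j
    using that c[THEN carrier_matD(1)] c[THEN carrier_matD(2)] by simp
  thus ?thesis using assms unfolding meromorphic_matrix_def by auto
qed

lemma meromorphic_matrix_adj:
  assumes "meromorphic_matrix n M"
  shows "meromorphic_matrix n (\<lambda>z. adj_mat (M z))"
proof -
  have c: "M z \<in> carrier_mat n n" for z
    using assms by (auto simp: meromorphic_matrix_def)
  note d = c[THEN carrier_matD(1)] c[THEN carrier_matD(2)]
  have "(\<lambda>z. adj_mat (M z) $$ (i,j)) meromorphic_on - {0}" if ij: "i < n" "j < n" for i j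
  proof -
    have "meromorphic_matrix (n-1) (\<lambda>z. mat_delete (M z) j i)"
      unfolding meromorphic_matrix_def
    proof (intro conjI allI impI)
      show "mat_delete (M z) j i \<in> carrier_mat (n-1) (n-1)" for z
        using c by (rule mat_delete_carrier)
      fix k l assume "k < n - 1" "l < n - 1"
      thus "(\<lambda>z. mat_delete (M z) j i $$ (k, l)) meromorphic_on - {0}"
        using assms ij unfolding mat_delete_def meromorphic_matrix_def by (auto simp: d)
    qed
    hence "(\<lambda>z. cofactor (M z) j i) meromorphic_on - {0}"
      unfolding cofactor_def by (intro meromorphic_intros meromorphic_matrix_det)
    thus ?thesis using ij by (simp add: adj_mat_def d)
  qed
  thus ?thesis using adj_mat(1)[OF c] by (auto simp: meromorphic_matrix_def)
qed

lemma nonsingular_meromorphic_iff: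
  "nonsingular_meromorphic M \<longleftrightarrow>
    (\<exists>n>0. meromorphic_matrix n M \<and> (\<forall>\<^sub>\<approx>z\<in>- {0}. Determinant.det (M z) \<noteq> 0))" (is "?l \<longleftrightarrow> ?r")
proof
  assume ?l
  then obtain n where n: "n > 0" "meromorphic_matrix n M" "\<not> (\<forall>\<^sub>\<approx>z\<in>- {0}. Determinant.det (M z) = 0)"
    by (auto simp: nonsingular_meromorphic_def meromorphic_matrix_def)
  have "connected (- {0::complex})"
    by (rule connected_punctured_universe) simp
  with meromorphic_imp_constant_or_avoid[OF meromorphic_matrix_det[OF n(2)], of 0] n(3)
  have "\<forall>\<^sub>\<approx>z\<in>- {0}. Determinant.det (M z) \<noteq> 0"
    by auto
  thus ?r using n by auto
next
  assume ?r
  then obtain n where n: "n > 0" "meromorphic_matrix n M" "\<forall>\<^sub>\<approx>z\<in>- {0}. Determinant.det (M z) \<noteq> 0"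
    by auto
  have "\<not> (\<forall>\<^sub>\<approx>z\<in>- {0}. Determinant.det (M z) = 0)"
  proof
    assume "\<forall>\<^sub>\<approx>z\<in>- {0}. Determinant.det (M z) = 0"
    with n(3) have "\<forall>\<^sub>\<approx>z\<in>- {0::complex}. False" by eventually_elim auto
    thus False using cosparse_ex by blast
  qed
  thus ?l using n by (auto simp: nonsingular_meromorphic_def meromorphic_matrix_def)
qed

lemma meromorphic_matrix_inverse:
  assumes "meromorphic_matrix n M" "\<forall>\<^sub>\<approx>z\<in>- {0}. Determinant.det (M z) \<noteq> 0"
  obtains N where "meromorphic_matrix n N" "\<forall>\<^sub>\<approx>z\<in>- {0}. Determinant.det (N z) \<noteq> 0"
    "\<forall>\<^sub>\<approx>z\<in>- {0}. N z * M z = 1\<^sub>m n \<and> M z * N z = 1\<^sub>m n"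
proof -
  define N where "N = (\<lambda>z. inverse (Determinant.det (M z)) \<cdot>\<^sub>m adj_mat (M z))"
  have c: "M z \<in> carrier_mat n n" for z
    using assms by (auto simp: meromorphic_matrix_def)
  note a = adj_mat[OF c]
  have cN: "N z \<in> carrier_mat n n" for z using a(1) by (simp add: N_def)
  have "(\<lambda>z. N z $$ (i,j)) meromorphic_on - {0}" if "i < n" "j < n" for i j
  proof -
    have "(\<lambda>z. N z $$ (i,j)) = (\<lambda>z. inverse (Determinant.det (M z)) * adj_mat (M z) $$ (i,j))"
      using that a(1)[THEN carrier_matD(1)] a(1)[THEN carrier_matD(2)] by (simp add: N_def)
    thus ?thesis using that meromorphic_matrix_adj[OF assms(1)]
      by (auto simp: meromorphic_matrix_def intro!: meromorphic_intros meromorphic_matrix_det[OF assms(1)])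
  qed
  hence 1: "meromorphic_matrix n N" using cN by (auto simp: meromorphic_matrix_def)
  have 2: "\<forall>\<^sub>\<approx>z\<in>- {0}. N z * M z = 1\<^sub>m n \<and> M z * N z = 1\<^sub>m n"
    using assms(2)
  proof eventually_elim
    case (elim z)
    have "N z * M z = inverse (Determinant.det (M z)) \<cdot>\<^sub>m (Determinant.det (M z) \<cdot>\<^sub>m 1\<^sub>m n)"
      unfolding N_def a(3)[symmetric] by (rule mult_smult_assoc_mat[OF a(1) c])
    moreover have "M z * N z = inverse (Determinant.det (M z)) \<cdot>\<^sub>m (Determinant.det (M z) \<cdot>\<^sub>m 1\<^sub>m n)"
      unfolding N_def a(2)[symmetric] by (rule mult_smult_distrib[OF c a(1)])
    ultimately show ?case using elim by (auto intro!: eq_matI)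
  qed
  have 3: "\<forall>\<^sub>\<approx>z\<in>- {0}. Determinant.det (N z) \<noteq> 0"
    using 2
  proof eventually_elim
    case (elim z)
    thus ?case using det_mult[OF cN[of z] c[of z]] by auto
  qed
  show ?thesis by (rule that[OF 1 3 2])
qed

lemma meromorphic_matrix_dims: "meromorphic_matrix n M \<Longrightarrow> dim_row (M z) = n" "meromorphic_matrix n M \<Longrightarrow> dim_col (M z) = n"
  "meromorphic_matrix n M \<Longrightarrow> M z \<in> carrier_mat n n"
  by (auto simp: meromorphic_matrix_def)

lemma nonsingular_meromorphic_mult:
  assumes "nonsingular_meromorphic M" "nonsingular_meromorphic N"
  and "meromorphic_matrix n M" "meromorphic_matrix n N"
  shows "nonsingular_meromorphic (\<lambda>z. M z * N z)"
proof -
  have uniq: "m = n'" if "meromorphic_matrix m X" "meromorphic_matrix n' X" for m n' and X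
    using meromorphic_matrix_dims(1)[OF that(1), of 0] meromorphic_matrix_dims(1)[OF that(2), of 0] by simp
  have n: "n > 0" "\<forall>\<^sub>\<approx>z\<in>- {0}. Determinant.det (M z) \<noteq> 0" "\<forall>\<^sub>\<approx>z\<in>- {0}. Determinant.det (N z) \<noteq> 0"
    using assms uniq by (auto simp: nonsingular_meromorphic_iff)
  have "\<forall>\<^sub>\<approx>z\<in>- {0}. Determinant.det (M z * N z) \<noteq> 0"
    using n(2,3) by eventually_elim
      (simp add: det_mult[OF meromorphic_matrix_dims(3)[OF assms(3)] meromorphic_matrix_dims(3)[OF assms(4)]])
  thus ?thesis using meromorphic_matrix_mult[OF assms(3,4)] n(1) by (auto simp: nonsingular_meromorphic_iff)
qed

lemma nonsingular_meromorphic_transpose: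
  assumes "nonsingular_meromorphic M"
  shows "nonsingular_meromorphic (\<lambda>z. transpose_mat (M z))"
proof -
  obtain n where n: "n > 0" "meromorphic_matrix n M" "\<forall>\<^sub>\<approx>z\<in>- {0}. Determinant.det (M z) \<noteq> 0"
    using assms by (auto simp: nonsingular_meromorphic_iff)
  have "\<forall>\<^sub>\<approx>z\<in>- {0}. Determinant.det (transpose_mat (M z)) \<noteq> 0"
    using n(3) by eventually_elim (simp add: Determinant.det_transpose[OF meromorphic_matrix_dims(3)[OF n(2)]])
  thus ?thesis using meromorphic_matrix_transpose[OF n(2)] n(1) by (auto simp: nonsingular_meromorphic_iff)
qed

lemma fundamental_dims:
  assumes "fundamental_matrix s A M" "meromorphic_matrix n A" "meromorphic_matrix m M"
  shows "m = n"
proof -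
  obtain z where "M (s * z) = A z * M z"
    using assms cosparse_ex by (auto simp: fundamental_matrix_def)
  hence "dim_row (M (s * z)) = dim_row (A z)" by simp
  thus ?thesis using meromorphic_matrix_dims assms by simp
qed

lemma weak_monodromy_eq_class:
  assumes pq: "p \<noteq> 0" "q \<noteq> 0"
    and A: "theta_shift p A" and C: "C \<in> weak_monodromy p q A"
  shows "weak_monodromy p q A = {C'. theta_shift q C' \<and> equivalent p q C C'}"
proof (intro equalityI subsetI)
  obtain n where nA: "meromorphic_matrix n A" "n > 0" "\<forall>\<^sub>\<approx>z\<in>- {0}. Determinant.det (A z) \<noteq> 0"
    using A by (auto simp: theta_shift_def theta_multiplier_def nonsingular_meromorphic_iff)
  obtain M where M: "fundamental_matrix q A M" "fundamental_matrix p C (\<lambda>z. transpose_mat (M z))"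
    using C by (auto simp: weak_monodromy_def associated_def)
  have nM: "meromorphic_matrix n M" and dM: "\<forall>\<^sub>\<approx>z\<in>- {0}. Determinant.det (M z) \<noteq> 0"
    using M(1) fundamental_dims[OF M(1) nA(1)] by (auto simp: fundamental_matrix_def nonsingular_meromorphic_iff)
  have nC: "meromorphic_matrix n C"
    using C fundamental_dims[OF M(2) _ meromorphic_matrix_transpose[OF nM]]
    by (auto simp: weak_monodromy_def associated_def theta_shift_def theta_multiplier_def nonsingular_meromorphic_iff)
  {
    fix C' assume C': "C' \<in> weak_monodromy p q A"
    obtain M' where M': "fundamental_matrix q A M'" "fundamental_matrix p C' (\<lambda>z. transpose_mat (M' z))"
      using C' by (auto simp: weak_monodromy_def associated_def)
    have nM': "meromorphic_matrix n M'" and dM': "\<forall>\<^sub>\<approx>z\<in>- {0}. Determinant.det (M' z) \<noteq> 0"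
      using M'(1) fundamental_dims[OF M'(1) nA(1)] by (auto simp: fundamental_matrix_def nonsingular_meromorphic_iff)
    have nC': "meromorphic_matrix n C'"
      using C' fundamental_dims[OF M'(2) _ meromorphic_matrix_transpose[OF nM']]
      by (auto simp: weak_monodromy_def associated_def theta_shift_def theta_multiplier_def nonsingular_meromorphic_iff)
    obtain N where N: "meromorphic_matrix n N" "\<forall>\<^sub>\<approx>z\<in>- {0}. Determinant.det (N z) \<noteq> 0"
      "\<forall>\<^sub>\<approx>z\<in>- {0}. N z * M z = 1\<^sub>m n \<and> M z * N z = 1\<^sub>m n"
      by (rule meromorphic_matrix_inverse[OF nM dM])
    note cc = meromorphic_matrix_dims(3)[OF nA(1)] meromorphic_matrix_dims(3)[OF nM] meromorphic_matrix_dims(3)[OF nM']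
      meromorphic_matrix_dims(3)[OF N(1)] meromorphic_matrix_dims(3)[OF nC] meromorphic_matrix_dims(3)[OF nC']
    note as = assoc_mult_mat[where ?n\<^sub>1.0 = n and ?n\<^sub>2.0 = n and ?n\<^sub>3.0 = n and ?n\<^sub>4.0 = n]
    define D where "D = (\<lambda>z. transpose_mat (N z * M' z))"
    have "nonsingular_meromorphic D"
      unfolding D_def using N nM' dM' nA(2)
      by (intro nonsingular_meromorphic_transpose nonsingular_meromorphic_mult[of _ _ n]) (auto simp: nonsingular_meromorphic_iff)
    moreover have "\<forall>\<^sub>\<approx>z\<in>- {0}. D (q * z) = D z"
    proof -
      have "\<forall>\<^sub>\<approx>z\<in>- {0}. M (q * z) = A z * M z" "\<forall>\<^sub>\<approx>z\<in>- {0}. M' (q * z) = A z * M' z"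
        using M M' by (auto simp: fundamental_matrix_def)
      from this N(3) eventually_cosparse_scale[OF pq(2) N(3)] show ?thesis
      proof eventually_elim
        case (elim z)
        have "N (q * z) * M' (q * z) = N (q * z) * (A z * M' z)" using elim by simp
        also have "\<dots> = N (q * z) * (A z * ((M z * N z) * M' z))" using elim left_mult_one_mat[OF cc(3)] by simp
        also have "\<dots> = (N (q * z) * (A z * M z)) * (N z * M' z)"
          by (simp add: as cc mult_carrier_mat[where n = n])
        also have "\<dots> = N z * M' z" using elim left_mult_one_mat[OF mult_carrier_mat[OF cc(4) cc(3)]] by simp
        finally show ?case by (simp add: D_def)
      qed
    qed
    moreover have "\<forall>\<^sub>\<approx>z\<in>- {0}. C' z * D z = D (p * z) * C z"
    proof -
      have "\<forall>\<^sub>\<approx>z\<in>- {0}. transpose_mat (M (p * z)) = C z * transpose_mat (M z)"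
        "\<forall>\<^sub>\<approx>z\<in>- {0}. transpose_mat (M' (p * z)) = C' z * transpose_mat (M' z)"
        using M M' by (auto simp: fundamental_matrix_def)
      from this N(3) eventually_cosparse_scale[OF pq(1) N(3)] show ?thesis
      proof eventually_elim
        case (elim z)
        have T: "transpose_mat (M w) * transpose_mat (N w) = 1\<^sub>m n"
          "transpose_mat (N w) * transpose_mat (M w) = 1\<^sub>m n"
          if "N w * M w = 1\<^sub>m n \<and> M w * N w = 1\<^sub>m n" for w
          using that transpose_mult[OF cc(4)[of w] cc(2)[of w]] transpose_mult[OF cc(2)[of w] cc(4)[of w]]
          by (metis transpose_one)+
        have D: "D w = transpose_mat (M' w) * transpose_mat (N w)" for w
          unfolding D_def by (rule transpose_mult[OF cc(4) cc(3)])
        have "D (p * z) * C z = D (p * z) * (C z * (transpose_mat (M z) * transpose_mat (N z)))"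
          using T[of z] elim right_mult_one_mat[OF cc(5)] by simp
        also have "\<dots> = transpose_mat (M' (p * z)) * ((transpose_mat (N (p * z)) *
            (C z * transpose_mat (M z))) * transpose_mat (N z))"
          by (simp add: D as cc mult_carrier_mat[where n = n])
        also have "\<dots> = C' z * transpose_mat (M' z) * transpose_mat (N z)"
          using T[of "p * z"] elim cc(6)[of z]
          by (metis as cc(3,4) left_mult_one_mat mult_carrier_mat transpose_carrier_mat)
        also have "\<dots> = C' z * D z" by (simp add: D as cc mult_carrier_mat[where n = n])
        finally show ?case ..
      qed
    qed
    ultimately have "equivalent p q C C'"
      by (auto simp: equivalent_def nonsingular_elliptic_def)
    with C' show "C' \<in> {C'. theta_shift q C' \<and> equivalent p q C C'}"
      by (auto simp: weak_monodromy_def associated_def)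
  next
    fix C' assume "C' \<in> {C'. theta_shift q C' \<and> equivalent p q C C'}"
    then obtain D where C': "theta_shift q C'" and D: "nonsingular_meromorphic D"
      "\<forall>\<^sub>\<approx>z\<in>- {0}. D (q * z) = D z" "\<forall>\<^sub>\<approx>z\<in>- {0}. C' z * D z = D (p * z) * C z"
      by (auto simp: equivalent_def nonsingular_elliptic_def)
    obtain m where m: "meromorphic_matrix m D" using D by (auto simp: nonsingular_meromorphic_iff)
    obtain k where k: "meromorphic_matrix k C'"
      using C' by (auto simp: theta_shift_def theta_multiplier_def nonsingular_meromorphic_iff)
    obtain z where z: "C' z * D z = D (p * z) * C z" using cosparse_ex[OF D(3)] by auto
    have "m = n" using arg_cong[OF z, of dim_col] meromorphic_matrix_dims[OF m] meromorphic_matrix_dims[OF nC] by simp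
    moreover have "k = m" using arg_cong[OF z, of dim_row] meromorphic_matrix_dims[OF m] meromorphic_matrix_dims[OF k] by simp
    ultimately have nD: "meromorphic_matrix n D" and nC': "meromorphic_matrix n C'" using m k by auto
    note cc = meromorphic_matrix_dims(3)[OF nA(1)] meromorphic_matrix_dims(3)[OF nM] meromorphic_matrix_dims(3)[OF nD]
      meromorphic_matrix_dims(3)[OF nC] meromorphic_matrix_dims(3)[OF nC']
    note as = assoc_mult_mat[where ?n\<^sub>1.0 = n and ?n\<^sub>2.0 = n and ?n\<^sub>3.0 = n and ?n\<^sub>4.0 = n]
    define M' where "M' = (\<lambda>z. M z * transpose_mat (D z))"
    have nsM': "nonsingular_meromorphic M'"
      unfolding M'_def using D M nM meromorphic_matrix_transpose[OF nD]
      by (intro nonsingular_meromorphic_mult[of _ _ n] nonsingular_meromorphic_transpose) (auto simp: fundamental_matrix_def)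
    have "\<forall>\<^sub>\<approx>z\<in>- {0}. M (q * z) = A z * M z"
      using M by (auto simp: fundamental_matrix_def)
    with D(2) have "\<forall>\<^sub>\<approx>z\<in>- {0}. M' (q * z) = A z * M' z"
      by eventually_elim (simp add: M'_def as cc mult_carrier_mat[where n = n])
    hence "fundamental_matrix q A M'" using nsM' by (auto simp: fundamental_matrix_def)
    moreover have "\<forall>\<^sub>\<approx>z\<in>- {0}. transpose_mat (M (p * z)) = C z * transpose_mat (M z)"
      using M by (auto simp: fundamental_matrix_def)
    with D(3) have "\<forall>\<^sub>\<approx>z\<in>- {0}. transpose_mat (M' (p * z)) = C' z * transpose_mat (M' z)"
    proof eventually_elim
      case (elim z)
      have T: "transpose_mat (M' w) = D w * transpose_mat (M w)" for w
        unfolding M'_def using transpose_mult[OF cc(2), of "transpose_mat (D w)" n w] cc(3)[of w] by simp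
      have "transpose_mat (M' (p * z)) = (D (p * z) * C z) * transpose_mat (M z)"
        using elim by (simp add: T as cc mult_carrier_mat[where n = n])
      also have "\<dots> = (C' z * D z) * transpose_mat (M z)" using elim by simp
      also have "\<dots> = C' z * transpose_mat (M' z)" by (simp add: T as cc mult_carrier_mat[where n = n])
      finally show ?case .
    qed
    hence "fundamental_matrix p C' (\<lambda>z. transpose_mat (M' z))"
      using nonsingular_meromorphic_transpose[OF nsM'] by (auto simp: fundamental_matrix_def)
    ultimately show "C' \<in> weak_monodromy p q A" using C'
      by (auto simp: weak_monodromy_def associated_def)
  }
qed

end

theory Submission
  imports Defs
begin

text \<open>
  Given a common associated equation with fundamental matrices M and M', the gauge transformation is
  B = M' M^(-1), and conversely M' = B M. The point is that a weak monodromy is never empty, that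
  is, that v(qz) = A(z) v(z) has a meromorphic fundamental matrix (Praagman).

  To construct one, choose a circle, after rescaling the unit circle, near which A and A^(-1) are
  holomorphic. For large l the operator T v = v(qz) - z^(-l) A(z) v(z) from functions near
  |q| \<le> |z| \<le> 1 to functions near |z| = 1 is surjective: in weighted \<open>\<ell>\<^sup>1\<close>-spaces of Laurent coefficients
  it has a right inverse up to an error of norm at most 1/2, built from a Laurent polynomial
  approximation of A^(-1). Solving T w = -T(e/(z - a)) for the basis vectors e yields solutions with
  independent simple poles at a. Multiplying by the (-l)-th power of a theta function removes the
  twist z^(-l), and the functional equation extends the solution to the punctured plane.
\<close>


section \<open>Laurent expansions on annuli\<close>


text \<open>Two difficulties shape the existence proof. First, A^(-1) is controlled only near the
  chosen circle, while an approximate solution must be holomorphic on all of |q|/r < |z| < r. A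
  Laurent polynomial close to A^(-1) near the circle is holomorphic on the whole punctured plane,
  and this is why the right inverse is only approximate. Second, neither term of T dominates on all
  monomials. The term v(qz) multiplies z^m by q^m, which is large for very negative m and small for
  large m; the twist z^(-l) shifts the exponents in the other term and leaves room between the two
  regimes, at the price of a factor r^l in the weighted norms. With l about 2s this costs r^(2s)
  against a gain of |q|^s, which is affordable once |q| r^2 < 1. Weighted l1-norms are chosen
  because an operator bound there follows from bounds on the images of single monomials. The poles
  exclude the zero solution: near a the determinant behaves like (z - a)^(-n).\<close>

definition annulus :: "real \<Rightarrow> real \<Rightarrow> complex set" where
  "annulus a b = {z. a < norm z \<and> norm z < b}"

lemma open_annulus [simp, intro]: "open (annulus a b)"
proof -
  have "annulus a b = {z. a < norm z} \<inter> {z. norm z < b}" by (auto simp: annulus_def)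
  thus ?thesis by (auto intro!: open_Int open_Collect_less continuous_intros)
qed

lemma annulus_mono: "a' \<le> a \<Longrightarrow> b \<le> b' \<Longrightarrow> annulus a b \<subseteq> annulus a' b'"
  by (auto simp: annulus_def)

text \<open>The linear homotopy moves each point along its ray, and the norm of an intermediate
  point is a convex combination of the two radii, so the homotopy stays in the annulus.\<close>

lemma contour_integral_circlepath_annulus:
  assumes f: "f holomorphic_on annulus a b" and "0 \<le> a" "a < \<rho>" "\<rho> < b" "a < \<sigma>" "\<sigma> < b"
  shows "contour_integral (circlepath 0 \<rho>) f = contour_integral (circlepath 0 \<sigma>) f"
proof (rule Cauchy_theorem_homotopic_loops[OF _ open_annulus f])
  show "homotopic_loops (annulus a b) (circlepath 0 \<rho>) (circlepath 0 \<sigma>)"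
  proof (rule homotopic_loops_linear)
    fix t x :: real
    show "closed_segment (circlepath 0 \<rho> t) (circlepath 0 \<sigma> t) \<subseteq> annulus a b"
    proof
      fix z assume "z \<in> closed_segment (circlepath 0 \<rho> t) (circlepath 0 \<sigma> t)"
      then obtain u where u: "0 \<le> u" "u \<le> 1"
        "z = (1 - u) *\<^sub>R circlepath 0 \<rho> t + u *\<^sub>R circlepath 0 \<sigma> t"
        by (auto simp: closed_segment_def)
      have "z = complex_of_real ((1 - u) * \<rho> + u * \<sigma>) * exp (2 * of_real pi * \<i> * of_real t)"
        using u(3) by (simp add: circlepath scaleR_conv_of_real algebra_simps)
      hence "norm z = \<bar>(1 - u) * \<rho> + u * \<sigma>\<bar>"
        by (simp add: norm_mult flip: of_real_mult of_real_add)
      moreover have "a < (1 - u) * \<rho> + u * \<sigma>" "(1 - u) * \<rho> + u * \<sigma> < b"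
        using convex_bound_lt[of "-\<rho>" "-a" "-\<sigma>" "1 - u" u] convex_bound_lt[of \<rho> b \<sigma> "1 - u" u] u assms
        by (auto simp: algebra_simps)
      ultimately show "z \<in> annulus a b" using assms by (auto simp: annulus_def)
    qed
  qed auto
qed auto

lemma circle_in_annulus: "0 \<le> a \<Longrightarrow> a < \<rho> \<Longrightarrow> \<rho> < b \<Longrightarrow> path_image (circlepath 0 \<rho>) \<subseteq> annulus a b"
  by (auto simp: annulus_def path_image_circlepath)

text \<open>The difference quotient of \<open>f\<close> at \<open>z\<close> extends holomorphically
  over \<open>z\<close>, so its integrals over both circles agree. What remains is
  \<open>f z\<close> times the integral of 1/(w - z), which is 2 pi i over the outer circle and 0
  over the inner one.\<close>

lemma Cauchy_integral_annulus:
  assumes f: "f holomorphic_on annulus a b" and "0 \<le> a" "a < \<rho>" "\<rho> < norm z" "norm z < \<sigma>" "\<sigma> < b"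
  shows "contour_integral (circlepath 0 \<sigma>) (\<lambda>w. f w / (w - z)) -
         contour_integral (circlepath 0 \<rho>) (\<lambda>w. f w / (w - z)) = 2 * pi * \<i> * f z"
proof -
  have z: "z \<in> annulus a b" using assms by (auto simp: annulus_def)
  define g where "g = (\<lambda>w. if w = z then deriv f z else (f w - f z) / (w - z))"
  have g: "g holomorphic_on annulus a b"
    unfolding g_def using pole_lemma_open[OF f open_annulus] .
  have eq: "contour_integral (circlepath 0 s) g =
            contour_integral (circlepath 0 s) (\<lambda>w. f w / (w - z)) - f z * contour_integral (circlepath 0 s) (\<lambda>w. 1 / (w - z))"
    if s: "a < s" "s < b" "s \<noteq> norm z" for s
  proof -
    have sub: "path_image (circlepath 0 s) \<subseteq> annulus a b - {z}"
      using circle_in_annulus[of a s b] s assms by (auto simp: path_image_circlepath)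
    have "contour_integral (circlepath 0 s) g = contour_integral (circlepath 0 s) (\<lambda>w. f w / (w - z) - f z * (1 / (w - z)))"
      using sub by (intro contour_integral_cong) (auto simp: g_def diff_divide_distrib)
    also have "\<dots> = contour_integral (circlepath 0 s) (\<lambda>w. f w / (w - z)) - contour_integral (circlepath 0 s) (\<lambda>w. f z * (1 / (w - z)))"
      using sub by (intro contour_integral_diff contour_integrable_continuous_circlepath continuous_intros
          continuous_on_subset[OF holomorphic_on_imp_continuous_on[OF f]]) auto
    also have "contour_integral (circlepath 0 s) (\<lambda>w. f z * (1 / (w - z))) = f z * contour_integral (circlepath 0 s) (\<lambda>w. 1 / (w - z))"
      using sub by (intro contour_integral_lmul contour_integrable_continuous_circlepath continuous_intros) auto
    finally show ?thesis .
  qed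
  have 1: "contour_integral (circlepath 0 \<sigma>) (\<lambda>w. 1 / (w - z)) = 2 * pi * \<i>"
    using Cauchy_integral_circlepath_simple[of "\<lambda>_. 1" 0 \<sigma> z] assms
    by (intro contour_integral_unique) auto
  have "((\<lambda>w. 1 / (w - z)) has_contour_integral 0) (circlepath 0 \<rho>)"
    using assms by (intro Cauchy_theorem_disc_simple[of _ 0 "norm z"] holomorphic_intros)
       (auto simp: path_image_circlepath)
  hence 2: "contour_integral (circlepath 0 \<rho>) (\<lambda>w. 1 / (w - z)) = 0"
    by (rule contour_integral_unique)
  have "contour_integral (circlepath 0 \<sigma>) g = contour_integral (circlepath 0 \<rho>) g"
    using assms by (intro contour_integral_circlepath_annulus[OF g]) auto
  thus ?thesis using eq[of \<sigma>] eq[of \<rho>] 1 2 assms by (auto simp: algebra_simps)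
qed

text \<open>The offset -1 keeps 0 out of the second range, so the two halves are disjoint and sums
  over them add up.\<close>

lemma UNIV_int_split: "(UNIV :: int set) = range int \<union> range (\<lambda>n. - int n - 1)"
proof -
  have "x \<in> range int \<union> range (\<lambda>n. - int n - 1)" for x :: int
  proof (cases "x \<ge> 0")
    case True thus ?thesis using int_eq_iff by (intro UnI1 image_eqI[of _ _ "nat x"]) auto
  next
    case False thus ?thesis by (intro UnI2 image_eqI[of _ _ "nat (- x - 1)"]) auto
  qed
  thus ?thesis by auto
qed

lemma has_sum_int_split:
  fixes f :: "int \<Rightarrow> 'a :: topological_comm_monoid_add"
  assumes "((\<lambda>n. f (int n)) has_sum a) UNIV" "((\<lambda>n. f (- int n - 1)) has_sum b) UNIV"
  shows "(f has_sum (a + b)) UNIV"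
proof -
  have "(f has_sum a) (range int)"
    using assms(1) by (subst has_sum_reindex) (auto simp: o_def)
  moreover have "(f has_sum b) (range (\<lambda>n. - int n - 1))"
    using assms(2) by (subst has_sum_reindex) (auto simp: o_def inj_on_def)
  ultimately show ?thesis unfolding UNIV_int_split by (rule has_sum_Un_disjoint) auto
qed

lemma summable_on_int_geometric:
  fixes x :: real
  assumes "0 \<le> x" "x < 1"
  shows "(\<lambda>t::int. x ^ nat \<bar>t\<bar>) summable_on UNIV"
proof -
  have "(\<lambda>n::nat. x ^ n) summable_on UNIV" "(\<lambda>n::nat. x ^ Suc n) summable_on UNIV"
    using assms by (intro norm_summable_imp_summable_on; simp add: power_abs summable_mult)+
  thus ?thesis using has_sum_int_split[of "\<lambda>t::int. x ^ nat \<bar>t\<bar>"]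
    by (fastforce simp: summable_on_def nat_add_distrib algebra_simps)
qed

text \<open>The radius \<open>s\<close> is left free. Since the integral does not depend on it, a
  radius above 1 is used for t >= 0 and its inverse for t <= 0, which gives decay in both
  directions.\<close>

lemma laurent_coeff_bound:
  assumes f: "f holomorphic_on annulus (1/R) R" and r: "1/R < s" "s < R" "1 < R"
    and bd: "\<And>z. z \<in> annulus (1/R) R \<Longrightarrow> norm (f z) \<le> \<delta>"
  shows "norm (contour_integral (circlepath 0 s) (\<lambda>w. f w * w powi (- t - 1)) / (2 * pi * \<i>)) \<le> \<delta> * s powi (- t)"
proof -
  have s: "s > 0" using r by (smt (verit) divide_pos_pos)
  have sub: "path_image (circlepath 0 s) \<subseteq> annulus (1/R) R"
    using r by (intro circle_in_annulus) auto
  have "continuous_on (path_image (circlepath 0 s)) (\<lambda>w. f w * w powi (- t - 1))"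
    using s by (intro continuous_intros continuous_on_subset[OF holomorphic_on_imp_continuous_on[OF f] sub])
       (auto simp: path_image_circlepath)
  hence h: "((\<lambda>w. f w * w powi (- t - 1)) has_contour_integral
         contour_integral (circlepath 0 s) (\<lambda>w. f w * w powi (- t - 1))) (circlepath 0 s)"
    by (intro has_contour_integral_integral contour_integrable_continuous_circlepath)
  have d: "\<delta> \<ge> 0" using bd[of 1] r norm_ge_zero[of "f 1"] by (auto simp: annulus_def simp del: norm_ge_zero)
  from h have "norm (contour_integral (circlepath 0 s) (\<lambda>w. f w * w powi (- t - 1))) \<le> (\<delta> * s powi (- t - 1)) * (2 * pi * s)"
  proof (rule has_contour_integral_bound_circlepath)
    fix x :: complex assume "norm (x - 0) = s"
    thus "norm (f x * x powi (- t - 1)) \<le> \<delta> * s powi (- t - 1)"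
      using bd[of x] s d r by (auto simp: norm_mult norm_power_int annulus_def intro!: mult_right_mono)
  qed (use s d in auto)
  also have "\<dots> = (\<delta> * s powi (- t)) * (2 * pi)"
    using s by (simp add: power_int_diff)
  finally show ?thesis by (simp add: norm_mult norm_divide field_simps)
qed

text \<open>Cauchy's formula on the circles of radius \<open>r\<close> and \<open>1/r\<close>, with
  1/(w - z) expanded in powers of z/w on the outer circle and of w/z on the inner one. The
  coefficient bound is exported because the later estimates are made on coefficients.\<close>

lemma laurent_expansion_annulus:
  assumes f: "f holomorphic_on annulus (1/R) R" and r: "1 < r" "r < R"
    and bd: "\<And>z. z \<in> annulus (1/R) R \<Longrightarrow> norm (f z) \<le> \<delta>"
  obtains c :: "int \<Rightarrow> complex" where
    "\<And>t. norm (c t) \<le> \<delta> / r ^ nat \<bar>t\<bar>"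
    "\<And>z. z \<in> annulus (1/r) r \<Longrightarrow> ((\<lambda>t. c t * z powi t) has_sum f z) UNIV"
proof -
  define I where "I = (\<lambda>s t. contour_integral (circlepath 0 s) (\<lambda>w. f w * w powi (- t - 1)))"
  define c where "c = (\<lambda>t. I 1 t / (2 * pi * \<i>))"
  have rr: "1 / R < 1 / r" "1 / r < 1" "0 < 1 / R" "0 < 1 / r" "1 / R < r" "1 / r < R"
    using r by (auto simp: divide_simps intro: less_1_mult)
  have I: "I s t = I 1 t" if "1/R < s" "s < R" for s t
    unfolding I_def using that r rr
    by (intro contour_integral_circlepath_annulus[of _ "1/R" R] holomorphic_intros f)
       (auto simp: annulus_def)
  have cbd: "norm (c t) \<le> \<delta> / r ^ nat \<bar>t\<bar>" for t
  proof (cases t rule: int_cases2)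
    case (nonneg n)
    have "norm (c t) \<le> \<delta> * r powi (- t)"
      using laurent_coeff_bound[OF f _ _ _ bd, of r t] r rr I[of r t] by (simp add: c_def I_def)
    thus ?thesis using r by (simp add: nonneg power_int_minus divide_inverse)
  next
    case (nonpos n)
    have "norm (c t) \<le> \<delta> * (1/r) powi (- t)"
      using laurent_coeff_bound[OF f _ _ _ bd, of "1/r" t] r rr I[of "1/r" t] by (simp add: c_def I_def)
    thus ?thesis using r by (simp add: nonpos power_divide)
  qed
  have d: "\<delta> \<ge> 0" using bd[of 1] r rr norm_ge_zero[of "f 1"] by (auto simp: annulus_def simp del: norm_ge_zero)
  have ps: "((\<lambda>t. c t * z powi t) has_sum f z) UNIV" if z: "z \<in> annulus (1/r) r" for z
  proof -
    have z: "1/r < norm z" "norm z < r" "z \<noteq> 0" using z rr by (auto simp: annulus_def)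
    have cs: "continuous_on (path_image (circlepath 0 s)) f" if "1/R < s" "s < R" for s
      using that r rr by (intro continuous_on_subset[OF holomorphic_on_imp_continuous_on[OF f]] circle_in_annulus) auto
    \<comment> \<open>Absolute convergence of both halves turns the ordered sums below into an
      unordered \<open>has_sum\<close> over the integers.\<close>
    have summ: "summable (\<lambda>n. norm (c (int n) * z powi int n))"
      "summable (\<lambda>n. norm (c (- int n - 1) * z powi (- int n - 1)))"
    proof -
      show "summable (\<lambda>n. norm (c (int n) * z powi int n))"
      proof (rule summable_comparison_test')
        show "summable (\<lambda>n. \<delta> * (norm z / r) ^ n)"
          using z r by (intro summable_mult summable_geometric) auto
        show "norm (norm (c (int n) * z powi int n)) \<le> \<delta> * (norm z / r) ^ n" for n
          using mult_right_mono[OF cbd[of "int n"], of "norm z ^ n"]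
          by (simp add: norm_mult norm_power power_divide)
      qed
      show "summable (\<lambda>n. norm (c (- int n - 1) * z powi (- int n - 1)))"
      proof (rule summable_comparison_test')
        show "summable (\<lambda>n. \<delta> * (1 / (norm z * r)) ^ Suc n)"
          using z r rr by (subst summable_Suc_iff, intro summable_mult summable_geometric) (auto simp: divide_simps mult.commute)
        show "norm (norm (c (- int n - 1) * z powi (- int n - 1))) \<le> \<delta> * (1 / (norm z * r)) ^ Suc n" for n
        proof -
          have e: "nat \<bar>- int n - 1\<bar> = Suc n" by auto
          have z1: "z powi (- int n - 1) = inverse (z ^ Suc n)"
            using z by (simp add: power_int_def nat_add_distrib power_inverse field_simps)
          show ?thesis
            using mult_right_mono[OF cbd[of "- int n - 1"], of "1 / norm z ^ Suc n"] unfolding e z1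
            by (simp add: norm_mult norm_power norm_inverse power_divide power_mult_distrib divide_inverse power_inverse mult_ac)
        qed
      qed
    qed
    have lim: "(\<lambda>N. K * x ^ N) \<longlonglongrightarrow> 0" if "0 \<le> x" "x < 1" for x K :: real
      using tendsto_mult_right_zero[OF LIMSEQ_power_zero[of x]] that by simp
    have "(\<lambda>n. c (int n) * z powi int n) sums (contour_integral (circlepath 0 r) (\<lambda>w. f w / (w - z)) / (2 * pi * \<i>))"
      unfolding sums_def
    proof (rule LIM_zero_cancel, rule tendsto_0_le[where K = 1])
      show "(\<lambda>N. (\<delta> / (r - norm z) * r) * (norm z / r) ^ N) \<longlonglongrightarrow> 0"
        using z r by (intro lim) auto
      show "\<forall>\<^sub>F N in sequentially.
         norm ((\<Sum>n<N. c (int n) * z powi int n) - contour_integral (circlepath 0 r) (\<lambda>w. f w / (w - z)) / (2 * pi * \<i>))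
         \<le> norm ((\<delta> / (r - norm z) * r) * (norm z / r) ^ N) * 1"
      proof (rule always_eventually, rule allI)
        fix N
        have ne: "w \<noteq> 0" "w \<noteq> z" if "w \<in> path_image (circlepath 0 r)" for w
          using that z r by (auto simp: path_image_circlepath)
        have nz: "0 \<notin> path_image (circlepath 0 r)" "z \<notin> path_image (circlepath 0 r)" using ne by auto
        \<comment> \<open>The remainder of the geometric series after \<open>N\<close> terms carries
          the factor (z/w)^N, of norm (|z|/r)^N on this circle.\<close>
        have geo: "f w / (w - z) - (\<Sum>n<N. z ^ n * (f w * w powi (- int n - 1))) = f w / (w - z) * (z / w) ^ N"
          if "w \<in> path_image (circlepath 0 r)" for w
        proof -
          have w: "w powi (- int n - 1) = inverse w * inverse w ^ n" for n
            using ne[OF that] by (simp add: power_int_diff power_int_minus divide_inverse power_inverse)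
          have "(\<Sum>n<N. z ^ n * (f w * w powi (- int n - 1))) = f w / w * (\<Sum>n<N. (z / w) ^ n)"
            unfolding w by (simp add: sum_distrib_left divide_inverse power_mult_distrib mult_ac)
          also have "\<dots> = f w / w * ((1 - (z/w)^N) / (1 - z / w))"
            using ne[OF that] by (subst sum_gp_strict) auto
          also have "\<dots> = f w / (w - z) * (1 - (z/w)^N)"
            using ne[OF that] by (simp add: divide_simps)
          finally show ?thesis by (simp add: algebra_simps)
        qed
        define E where "E = (\<lambda>w. f w / (w - z) * (z / w) ^ N)"
        have "(\<Sum>n<N. c (int n) * z powi int n) = (\<Sum>n<N. z ^ n * I r (int n)) / (2 * pi * \<i>)"
          using r rr by (simp add: c_def I[of r] sum_divide_distrib mult_ac)
        also have "(\<Sum>n<N. z ^ n * I r (int n)) =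
          (\<Sum>n<N. contour_integral (circlepath 0 r) (\<lambda>w. z ^ n * (f w * w powi (- int n - 1))))"
          unfolding I_def using r rr z nz
          by (subst contour_integral_lmul) (auto intro!: contour_integrable_continuous_circlepath continuous_intros cs)
        also have "\<dots> = contour_integral (circlepath 0 r) (\<lambda>w. \<Sum>n<N. z ^ n * (f w * w powi (- int n - 1)))"
          using r rr z nz
          by (intro contour_integral_sum[symmetric] contour_integrable_continuous_circlepath continuous_intros cs) auto
        finally have "(contour_integral (circlepath 0 r) (\<lambda>w. f w / (w - z)) / (2 * pi * \<i>)) - (\<Sum>n<N. c (int n) * z powi int n) =
          (contour_integral (circlepath 0 r) (\<lambda>w. f w / (w - z)) - contour_integral (circlepath 0 r) (\<lambda>w. \<Sum>n<N. z ^ n * (f w * w powi (- int n - 1)))) / (2 * pi * \<i>)"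
          by (simp add: diff_divide_distrib)
        also have "contour_integral (circlepath 0 r) (\<lambda>w. f w / (w - z)) - contour_integral (circlepath 0 r) (\<lambda>w. \<Sum>n<N. z ^ n * (f w * w powi (- int n - 1)))
           = contour_integral (circlepath 0 r) (\<lambda>w. f w / (w - z) - (\<Sum>n<N. z ^ n * (f w * w powi (- int n - 1))))"
          using r rr z nz
          by (intro contour_integral_diff[symmetric] contour_integrable_continuous_circlepath continuous_intros cs) auto
        also have "\<dots> = contour_integral (circlepath 0 r) E"
          unfolding E_def by (intro contour_integral_cong refl geo)
        finally have eq: "(contour_integral (circlepath 0 r) (\<lambda>w. f w / (w - z)) / (2 * pi * \<i>)) - (\<Sum>n<N. c (int n) * z powi int n) =
           contour_integral (circlepath 0 r) E / (2 * pi * \<i>)" .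
        have "norm (contour_integral (circlepath 0 r) E) \<le> (\<delta> / (r - norm z) * (norm z / r) ^ N) * (2 * pi * r)"
        proof (rule has_contour_integral_bound_circlepath[OF has_contour_integral_integral])
          show "E contour_integrable_on circlepath 0 r"
            unfolding E_def using r rr z nz by (intro contour_integrable_continuous_circlepath continuous_intros cs) auto
          fix w :: complex assume w: "norm (w - 0) = r"
          have "norm (f w) \<le> \<delta>" using w r rr by (intro bd) (auto simp: annulus_def)
          moreover have "r - norm z \<le> norm (w - z)" using w norm_triangle_ineq2[of w z] by simp
          ultimately have "norm (f w) / norm (w - z) \<le> \<delta> / (r - norm z)"
            using z d by (intro frac_le) auto
          moreover have "norm w = r" using w by simp
          ultimately show "norm (E w) \<le> \<delta> / (r - norm z) * (norm z / r) ^ N"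
            unfolding E_def norm_mult norm_divide norm_power using r d z by (intro mult_mono) auto
        qed (use d r z in auto)
        hence "norm (contour_integral (circlepath 0 r) E / (2 * pi * \<i>)) \<le> (\<delta> / (r - norm z) * r) * (norm z / r) ^ N"
          by (simp add: norm_divide norm_mult field_simps)
        also have "\<dots> \<le> norm ((\<delta> / (r - norm z) * r) * (norm z / r) ^ N) * 1" by (simp only: mult_1_right real_norm_def abs_ge_self)
        finally show "norm ((\<Sum>n<N. c (int n) * z powi int n) - contour_integral (circlepath 0 r) (\<lambda>w. f w / (w - z)) / (2 * pi * \<i>))
         \<le> norm ((\<delta> / (r - norm z) * r) * (norm z / r) ^ N) * 1"
          unfolding eq[symmetric] by (subst norm_minus_commute)
      qed
    qed
    moreover have "(\<lambda>n. c (- int n - 1) * z powi (- int n - 1)) sums (- contour_integral (circlepath 0 (1/r)) (\<lambda>w. f w / (w - z)) / (2 * pi * \<i>))"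
      unfolding sums_def
    proof (rule LIM_zero_cancel, rule tendsto_0_le[where K = 1])
      show "(\<lambda>N. (\<delta> / (norm z - 1/r) / r) * (1 / r / norm z) ^ N) \<longlonglongrightarrow> 0"
        using z r by (intro lim) (auto simp: divide_simps mult_ac)
      show "\<forall>\<^sub>F N in sequentially.
         norm ((\<Sum>n<N. c (- int n - 1) * z powi (- int n - 1)) - (- contour_integral (circlepath 0 (1/r)) (\<lambda>w. f w / (w - z)) / (2 * pi * \<i>)))
         \<le> norm ((\<delta> / (norm z - 1/r) / r) * (1 / r / norm z) ^ N) * 1"
      proof (rule always_eventually, rule allI)
        fix N
        have ne: "w \<noteq> 0" "w \<noteq> z" if "w \<in> path_image (circlepath 0 (1/r))" for w
          using that z r by (auto simp: path_image_circlepath)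
        have nz: "0 \<notin> path_image (circlepath 0 (1/r))" "z \<notin> path_image (circlepath 0 (1/r))" using ne by auto
        \<comment> \<open>Here |w| < |z|, so the expansion is in w/z; its sign is opposite to that
          of the outer one and cancels the minus sign in front of the inner integral.\<close>
        have geo: "f w / (w - z) + (\<Sum>n<N. z powi (- int n - 1) * (f w * w powi int n)) = f w / (w - z) * (w / z) ^ N"
          if "w \<in> path_image (circlepath 0 (1/r))" for w
        proof -
          have w: "z powi (- int n - 1) = inverse z * inverse z ^ n" for n
            using z by (simp add: power_int_diff power_int_minus divide_inverse power_inverse)
          have "(\<Sum>n<N. z powi (- int n - 1) * (f w * w powi int n)) = f w / z * (\<Sum>n<N. (w / z) ^ n)"
            unfolding w by (simp add: sum_distrib_left divide_inverse power_mult_distrib mult_ac)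
          also have "\<dots> = f w / z * ((1 - (w/z)^N) / (1 - w / z))"
            using ne[OF that] z by (subst sum_gp_strict) auto
          also have "\<dots> = - (f w / (w - z) * (1 - (w/z)^N))"
            using ne[OF that] z by (simp add: divide_simps) (simp add: algebra_simps)
          finally show ?thesis by (simp add: algebra_simps)
        qed
        define E where "E = (\<lambda>w. f w / (w - z) * (w / z) ^ N)"
        have "(\<Sum>n<N. c (- int n - 1) * z powi (- int n - 1)) = (\<Sum>n<N. z powi (- int n - 1) * I (1/r) (- int n - 1)) / (2 * pi * \<i>)"
          using r rr by (simp add: c_def I[of "1/r"] sum_divide_distrib mult_ac)
        also have "(\<Sum>n<N. z powi (- int n - 1) * I (1/r) (- int n - 1)) =
          (\<Sum>n<N. contour_integral (circlepath 0 (1/r)) (\<lambda>w. z powi (- int n - 1) * (f w * w powi int n)))"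
          unfolding I_def using r rr z nz
          by (subst contour_integral_lmul) (auto intro!: contour_integrable_continuous_circlepath continuous_intros cs)
        also have "\<dots> = contour_integral (circlepath 0 (1/r)) (\<lambda>w. \<Sum>n<N. z powi (- int n - 1) * (f w * w powi int n))"
          using r rr z nz
          by (intro contour_integral_sum[symmetric] contour_integrable_continuous_circlepath continuous_intros cs) auto
        finally have "(contour_integral (circlepath 0 (1/r)) (\<lambda>w. f w / (w - z)) / (2 * pi * \<i>)) + (\<Sum>n<N. c (- int n - 1) * z powi (- int n - 1)) =
          (contour_integral (circlepath 0 (1/r)) (\<lambda>w. f w / (w - z)) + contour_integral (circlepath 0 (1/r)) (\<lambda>w. \<Sum>n<N. z powi (- int n - 1) * (f w * w powi int n))) / (2 * pi * \<i>)"
          by (simp add: add_divide_distrib)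
        also have "contour_integral (circlepath 0 (1/r)) (\<lambda>w. f w / (w - z)) + contour_integral (circlepath 0 (1/r)) (\<lambda>w. \<Sum>n<N. z powi (- int n - 1) * (f w * w powi int n))
           = contour_integral (circlepath 0 (1/r)) (\<lambda>w. f w / (w - z) + (\<Sum>n<N. z powi (- int n - 1) * (f w * w powi int n)))"
          using r rr z nz
          by (intro contour_integral_add[symmetric] contour_integrable_continuous_circlepath continuous_intros cs) auto
        also have "\<dots> = contour_integral (circlepath 0 (1/r)) E"
          unfolding E_def by (intro contour_integral_cong refl geo)
        finally have eq: "(contour_integral (circlepath 0 (1/r)) (\<lambda>w. f w / (w - z)) / (2 * pi * \<i>)) + (\<Sum>n<N. c (- int n - 1) * z powi (- int n - 1)) =
           contour_integral (circlepath 0 (1/r)) E / (2 * pi * \<i>)" .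
        have "norm (contour_integral (circlepath 0 (1/r)) E) \<le> (\<delta> / (norm z - 1/r) * (1 / r / norm z) ^ N) * (2 * pi * (1/r))"
        proof (rule has_contour_integral_bound_circlepath[OF has_contour_integral_integral])
          show "E contour_integrable_on circlepath 0 (1/r)"
            unfolding E_def using r rr z nz by (intro contour_integrable_continuous_circlepath continuous_intros cs) auto
          fix w :: complex assume w: "norm (w - 0) = 1/r"
          have "norm (f w) \<le> \<delta>" using w r rr by (intro bd) (auto simp: annulus_def)
          moreover have "norm z - 1/r \<le> norm (w - z)" using w norm_triangle_ineq2[of z w] by (simp add: norm_minus_commute)
          ultimately have "norm (f w) / norm (w - z) \<le> \<delta> / (norm z - 1/r)"
            using z d by (intro frac_le) auto
          moreover have "norm w = 1/r" using w by simp
          ultimately show "norm (E w) \<le> \<delta> / (norm z - 1/r) * (1 / r / norm z) ^ N"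
            unfolding E_def norm_mult norm_divide norm_power using r d z by (intro mult_mono) auto
        qed (use d r z in auto)
        hence "norm (contour_integral (circlepath 0 (1/r)) E / (2 * pi * \<i>)) \<le> (\<delta> / (norm z - 1/r) / r) * (1 / r / norm z) ^ N"
          by (simp add: norm_divide norm_mult pos_divide_le_eq mult_ac)
        also have "\<dots> \<le> norm ((\<delta> / (norm z - 1/r) / r) * (1 / r / norm z) ^ N) * 1" by (simp only: mult_1_right real_norm_def abs_ge_self)
        finally show "norm ((\<Sum>n<N. c (- int n - 1) * z powi (- int n - 1)) - (- contour_integral (circlepath 0 (1/r)) (\<lambda>w. f w / (w - z)) / (2 * pi * \<i>)))
         \<le> norm ((\<delta> / (norm z - 1/r) / r) * (1 / r / norm z) ^ N) * 1"
          unfolding eq[symmetric] by (simp add: add.commute)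
      qed
    qed
    ultimately have "((\<lambda>t. c t * z powi t) has_sum (contour_integral (circlepath 0 r) (\<lambda>w. f w / (w - z)) / (2 * pi * \<i>) +
        (- contour_integral (circlepath 0 (1/r)) (\<lambda>w. f w / (w - z)) / (2 * pi * \<i>)))) UNIV"
      using summ by (intro has_sum_int_split norm_summable_imp_has_sum)
    also have "contour_integral (circlepath 0 r) (\<lambda>w. f w / (w - z)) / (2 * pi * \<i>) +
        (- contour_integral (circlepath 0 (1/r)) (\<lambda>w. f w / (w - z)) / (2 * pi * \<i>)) =
        (contour_integral (circlepath 0 r) (\<lambda>w. f w / (w - z)) - contour_integral (circlepath 0 (1/r)) (\<lambda>w. f w / (w - z))) / (2 * pi * \<i>)"
      by (simp add: diff_divide_distrib)
    also have "\<dots> = f z"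
      by (subst Cauchy_integral_annulus[OF f]) (use z r rr in auto)
    finally show ?thesis .
  qed
  show ?thesis using that cbd ps by blast
qed


section \<open>Weighted summable families\<close>


text \<open>Tonelli for a kernel whose row at \<open>x\<close> has weighted norm at most
  \<open>B * w x\<close>. Bounding the rows, that is, the images of the basis vectors, bounds the
  whole operator from weighted l1 over \<open>X\<close> to weighted l1 over
  \<open>Y\<close>.\<close>

lemma l1_kernel:
  fixes c :: "'x \<Rightarrow> complex" and k :: "'x \<Rightarrow> 'y \<Rightarrow> complex" and v :: "'y \<Rightarrow> real"
  assumes c: "(\<lambda>x. norm (c x) * w x) summable_on X"
    and k: "\<And>x. x \<in> X \<Longrightarrow> (\<lambda>y. norm (k x y) * v y) summable_on Y"
    and B: "\<And>x. x \<in> X \<Longrightarrow> (\<Sum>\<^sub>\<infinity>y\<in>Y. norm (k x y) * v y) \<le> B * w x"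
    and v: "\<And>y. y \<in> Y \<Longrightarrow> 0 \<le> v y"
  shows "(\<lambda>(x,y). norm (c x * k x y) * v y) summable_on X \<times> Y" (is ?thesis1)
    and "(\<Sum>\<^sub>\<infinity>(x,y)\<in>X \<times> Y. norm (c x * k x y) * v y) \<le> B * (\<Sum>\<^sub>\<infinity>x\<in>X. norm (c x) * w x)" (is ?thesis2)
proof -
  let ?g = "\<lambda>x y. norm (c x * k x y) * v y"
  have inner: "(\<Sum>\<^sub>\<infinity>y\<in>Y. ?g x y) = norm (c x) * (\<Sum>\<^sub>\<infinity>y\<in>Y. norm (k x y) * v y)" if "x \<in> X" for x
    using k[OF that] by (simp add: norm_mult mult.assoc infsum_cmult_right)
  have nn: "0 \<le> (\<Sum>\<^sub>\<infinity>y\<in>Y. norm (k x y) * v y)" if "x \<in> X" for x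
    using v by (intro infsum_nonneg) auto
  have bound: "(\<Sum>\<^sub>\<infinity>y\<in>Y. ?g x y) \<le> B * (norm (c x) * w x)" if "x \<in> X" for x
    using mult_left_mono[OF B[OF that], of "norm (c x)"] unfolding inner[OF that] by (simp add: mult_ac)
  have summ: "(\<lambda>x. \<Sum>\<^sub>\<infinity>y\<in>Y. ?g x y) summable_on X"
  proof (rule summable_on_comparison_test)
    show "(\<lambda>x. B * (norm (c x) * w x)) summable_on X"
      using c by (rule summable_on_cmult_right)
  qed (use bound nn in \<open>auto simp: inner\<close>)
  show th1: ?thesis1
  proof -
    have "(\<lambda>z. norm ((\<lambda>(x,y). ?g x y) z)) summable_on X \<times> Y"
      unfolding Infinite_Sum.abs_summable_on_Sigma_iff
    proof (intro conjI ballI)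
      fix x assume x: "x \<in> X"
      have "(\<lambda>y. norm (c x) * (norm (k x y) * v y)) summable_on Y"
        using k[OF x] by (rule summable_on_cmult_right)
      thus "(\<lambda>y. norm (case (x, y) of (x, y) \<Rightarrow> ?g x y)) summable_on Y"
        using v by (subst summable_on_cong[of _ _ "\<lambda>y. norm (c x) * (norm (k x y) * v y)"]) (auto simp: norm_mult abs_mult)
    next
      have "(\<Sum>\<^sub>\<infinity>y\<in>Y. norm (case (x, y) of (x, y) \<Rightarrow> ?g x y)) = (\<Sum>\<^sub>\<infinity>y\<in>Y. ?g x y)" for x
        using v by (intro infsum_cong) (auto simp: abs_mult)
      thus "(\<lambda>x. norm (\<Sum>\<^sub>\<infinity>y\<in>Y. norm (case (x, y) of (x, y) \<Rightarrow> ?g x y))) summable_on X"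
        using summ nn by (subst summable_on_cong[of _ _ "\<lambda>x. \<Sum>\<^sub>\<infinity>y\<in>Y. ?g x y"]) (auto simp: inner abs_mult)
    qed
    thus ?thesis by (rule abs_summable_summable)
  qed
  have "(\<Sum>\<^sub>\<infinity>(x,y)\<in>X \<times> Y. ?g x y) = (\<Sum>\<^sub>\<infinity>x\<in>X. \<Sum>\<^sub>\<infinity>y\<in>Y. ?g x y)"
    using infsum_Sigma'_banach[OF th1] by simp
  also have "\<dots> \<le> (\<Sum>\<^sub>\<infinity>x\<in>X. B * (norm (c x) * w x))"
    using c by (intro infsum_mono summ summable_on_cmult_right bound)
  also have "\<dots> = B * (\<Sum>\<^sub>\<infinity>x\<in>X. norm (c x) * w x)"
    using c by (intro infsum_cmult_right) auto
  finally show ?thesis2 .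
qed

text \<open>The operator itself, whose value at \<open>y\<close> exists by absolute convergence.
  Positivity of \<open>v\<close> is strict here because convergence at a single \<open>y\<close> is
  recovered from the weighted double sum by dividing by \<open>v y\<close>.\<close>

lemma l1_kernel_image:
  fixes c :: "'x \<Rightarrow> complex" and k :: "'x \<Rightarrow> 'y \<Rightarrow> complex" and v :: "'y \<Rightarrow> real"
  assumes c: "(\<lambda>x. norm (c x) * w x) summable_on X"
    and k: "\<And>x. x \<in> X \<Longrightarrow> (\<lambda>y. norm (k x y) * v y) summable_on Y"
    and B: "\<And>x. x \<in> X \<Longrightarrow> (\<Sum>\<^sub>\<infinity>y\<in>Y. norm (k x y) * v y) \<le> B * w x"
    and v: "\<And>y. y \<in> Y \<Longrightarrow> 0 < v y"
  shows "\<And>y. y \<in> Y \<Longrightarrow> (\<lambda>x. norm (c x * k x y)) summable_on X" (is "\<And>y. _ \<Longrightarrow> ?thesis1 y")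
    and "(\<lambda>y. norm (\<Sum>\<^sub>\<infinity>x\<in>X. c x * k x y) * v y) summable_on Y" (is ?thesis2)
    and "(\<Sum>\<^sub>\<infinity>y\<in>Y. norm (\<Sum>\<^sub>\<infinity>x\<in>X. c x * k x y) * v y) \<le> B * (\<Sum>\<^sub>\<infinity>x\<in>X. norm (c x) * w x)" (is ?thesis3)
proof -
  let ?g = "\<lambda>x y. norm (c x * k x y) * v y"
  have l: "(\<lambda>(x,y). ?g x y) summable_on X \<times> Y"
    "(\<Sum>\<^sub>\<infinity>(x,y)\<in>X \<times> Y. ?g x y) \<le> B * (\<Sum>\<^sub>\<infinity>x\<in>X. norm (c x) * w x)"
    by (rule l1_kernel[OF c]; use k B v less_imp_le in blast)+
  have sw: "(\<lambda>(y,x). ?g x y) summable_on Y \<times> X"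
    using l(1) by (subst (asm) summable_on_swap) (simp add: case_prod_unfold)
  have 1: "?thesis1 y" if y: "y \<in> Y" for y
  proof -
    have "(\<lambda>x. ?g x y) summable_on X"
      using summable_on_SigmaD1[OF sw y] .
    hence "(\<lambda>x. ?g x y * (1 / v y)) summable_on X" by (rule summable_on_cmult_left)
    thus ?thesis using v[OF y] by simp
  qed
  show "?thesis1 y" if "y \<in> Y" for y using 1 that .
  have le: "norm (\<Sum>\<^sub>\<infinity>x\<in>X. c x * k x y) * v y \<le> (\<Sum>\<^sub>\<infinity>x\<in>X. ?g x y)" if y: "y \<in> Y" for y
  proof -
    have "norm (\<Sum>\<^sub>\<infinity>x\<in>X. c x * k x y) * v y \<le> (\<Sum>\<^sub>\<infinity>x\<in>X. norm (c x * k x y)) * v y"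
      using norm_infsum_bound[OF 1[OF y]] v[OF y] by (intro mult_right_mono) auto
    also have "\<dots> = (\<Sum>\<^sub>\<infinity>x\<in>X. ?g x y)"
      using 1[OF y] by (intro infsum_cmult_left[symmetric]) auto
    finally show ?thesis .
  qed
  have s2: "(\<lambda>y. \<Sum>\<^sub>\<infinity>x\<in>X. ?g x y) summable_on Y"
    using summable_on_Sigma_banach[OF sw] .
  show 2: ?thesis2
    by (rule summable_on_comparison_test[OF s2 le]) (auto intro!: mult_nonneg_nonneg less_imp_le[OF v])
  have "(\<Sum>\<^sub>\<infinity>y\<in>Y. norm (\<Sum>\<^sub>\<infinity>x\<in>X. c x * k x y) * v y) \<le> (\<Sum>\<^sub>\<infinity>y\<in>Y. \<Sum>\<^sub>\<infinity>x\<in>X. ?g x y)"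
    by (intro infsum_mono 2 s2 le)
  also have "\<dots> = (\<Sum>\<^sub>\<infinity>x\<in>X. \<Sum>\<^sub>\<infinity>y\<in>Y. ?g x y)"
    using infsum_swap_banach[OF sw] by simp
  also have "\<dots> = (\<Sum>\<^sub>\<infinity>(x,y)\<in>X \<times> Y. ?g x y)"
    using infsum_Sigma'_banach[OF l(1)] .
  also note l(2)
  finally show ?thesis3 .
qed

text \<open>Neumann series for c (1 - e)^(-1), with \<open>e\<close> acting on row vectors. Its m-th
  term \<open>cs m\<close> has norm at most \<theta>^m times that of \<open>c\<close>.\<close>

lemma l1_neumann:
  fixes c :: "'x \<Rightarrow> complex" and e :: "'x \<Rightarrow> 'x \<Rightarrow> complex" and w :: "'x \<Rightarrow> real"
  assumes c: "(\<lambda>x. norm (c x) * w x) summable_on X"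
    and e: "\<And>x. x \<in> X \<Longrightarrow> (\<lambda>y. norm (e x y) * w y) summable_on X"
    and \<theta>: "\<And>x. x \<in> X \<Longrightarrow> (\<Sum>\<^sub>\<infinity>y\<in>X. norm (e x y) * w y) \<le> \<theta> * w x"
    and \<theta>1: "0 \<le> \<theta>" "\<theta> < 1" and w: "\<And>x. x \<in> X \<Longrightarrow> 0 < w x"
  obtains C where "(\<lambda>x. norm (C x) * w x) summable_on X"
    "\<And>y. y \<in> X \<Longrightarrow> C y = c y + (\<Sum>\<^sub>\<infinity>x\<in>X. C x * e x y)"
proof -
  define cs where "cs = rec_nat c (\<lambda>_ f y. \<Sum>\<^sub>\<infinity>x\<in>X. f x * e x y)"
  have cs0: "cs 0 = c" and csS: "cs (Suc m) = (\<lambda>y. \<Sum>\<^sub>\<infinity>x\<in>X. cs m x * e x y)" for m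
    by (auto simp: cs_def)
  define N where "N = (\<lambda>m. \<Sum>\<^sub>\<infinity>x\<in>X. norm (cs m x) * w x)"
  have csum: "(\<lambda>x. norm (cs m x) * w x) summable_on X" for m
  proof (induction m)
    case (Suc m) thus ?case unfolding csS by (intro l1_kernel_image(2)[OF _ e \<theta> w])
  qed (use c in \<open>simp add: cs0\<close>)
  have N: "N m \<le> \<theta> ^ m * N 0" for m
  proof (induction m)
    case (Suc m)
    have "N (Suc m) \<le> \<theta> * N m"
      unfolding N_def csS by (intro l1_kernel_image(3)[OF csum e \<theta> w])
    also have "\<dots> \<le> \<theta> * (\<theta> ^ m * N 0)" using Suc \<theta>1 by (intro mult_left_mono)
    finally show ?case by simp
  qed auto
  have Npos: "0 \<le> N m" for m unfolding N_def by (intro infsum_nonneg mult_nonneg_nonneg norm_ge_zero less_imp_le[OF w])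
  have "summable (\<lambda>m. norm (N m))"
  proof (rule summable_comparison_test')
    show "summable (\<lambda>m. \<theta> ^ m * N 0)" using \<theta>1 by (intro summable_mult2 summable_geometric) auto
    show "norm (norm (N m)) \<le> \<theta> ^ m * N 0" for m using N[of m] Npos[of m] by simp
  qed
  hence Nsum: "N summable_on UNIV" by (rule norm_summable_imp_summable_on)
  \<comment> \<open>The series over \<open>m\<close> is treated as a kernel operator as well:
    coefficients 1 over the naturals, row \<open>m\<close> equal to \<open>cs m\<close>, and
    \<open>N m\<close> as the weight of \<open>m\<close>.\<close>
  have "(\<lambda>m. norm (1::complex) * N m) summable_on UNIV" using Nsum by simp
  hence one: "(\<lambda>m::nat. norm ((\<lambda>_. 1::complex) m) * N m) summable_on UNIV" .
  have Bp: "(\<Sum>\<^sub>\<infinity>y\<in>X. norm (cs m y) * w y) \<le> 1 * N m" for m by (simp add: N_def)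
  define C where "C = (\<lambda>y. \<Sum>\<^sub>\<infinity>m. cs m y)"
  have Cabs: "(\<lambda>m. norm (cs m y)) summable_on UNIV" if "y \<in> X" for y
    using l1_kernel_image(1)[OF one csum Bp w that] by simp
  have Csum: "(\<lambda>x. norm (C x) * w x) summable_on X"
    using l1_kernel_image(2)[OF one csum Bp w] by (simp add: C_def)
  show ?thesis
  proof (rule that[OF Csum])
    fix y assume y: "y \<in> X"
    have "(\<lambda>(m, x). norm (1 * cs m x) * w x) summable_on UNIV \<times> X"
      by (rule l1_kernel(1)[OF one csum Bp less_imp_le[OF w]])
    hence dbl: "(\<lambda>(m, x). norm (cs m x) * w x) summable_on UNIV \<times> X" by simp
    \<comment> \<open>A single entry is at most the weighted sum of its row, divided by its own
      weight; this makes the double family \<open>cs m x * e x y\<close> absolutely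
      summable.\<close>
    have ebd: "norm (e x y) \<le> \<theta> / w y * w x" if x: "x \<in> X" for x
    proof -
      have "norm (e x y) * w y = (\<Sum>\<^sub>\<infinity>y\<in>{y}. norm (e x y) * w y)" by simp
      also have "\<dots> \<le> (\<Sum>\<^sub>\<infinity>y\<in>X. norm (e x y) * w y)"
        using y e[OF x] by (intro infsum_mono2) (auto intro!: mult_nonneg_nonneg less_imp_le[OF w])
      also note \<theta>[OF x]
      finally show ?thesis using w[OF y] by (simp add: field_simps)
    qed
    have "(\<lambda>(m, x). cs m x * e x y) summable_on UNIV \<times> X"
    proof (rule abs_summable_summable, rule summable_on_comparison_test)
      show "(\<lambda>z. (case z of (m, x) \<Rightarrow> norm (cs m x) * w x) * (\<theta> / w y)) summable_on UNIV \<times> X"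
        using dbl by (rule summable_on_cmult_left)
      fix z assume "z \<in> (UNIV :: nat set) \<times> X"
      then obtain m x where z: "z = (m, x)" "x \<in> X" by auto
      show "norm (case z of (m, x) \<Rightarrow> cs m x * e x y) \<le> (case z of (m, x) \<Rightarrow> norm (cs m x) * w x) * (\<theta> / w y)"
        using mult_left_mono[OF ebd[OF z(2)], of "norm (cs m x)"] z(1) by (simp add: norm_mult mult_ac)
    qed auto
    hence "(\<Sum>\<^sub>\<infinity>m. \<Sum>\<^sub>\<infinity>x\<in>X. cs m x * e x y) = (\<Sum>\<^sub>\<infinity>x\<in>X. \<Sum>\<^sub>\<infinity>m. cs m x * e x y)"
      by (rule infsum_swap_banach)
    also have "\<dots> = (\<Sum>\<^sub>\<infinity>x\<in>X. C x * e x y)"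
      unfolding C_def by (intro infsum_cong infsum_cmult_left abs_summable_summable[OF Cabs])
    finally have 1: "(\<Sum>\<^sub>\<infinity>m. cs (Suc m) y) = (\<Sum>\<^sub>\<infinity>x\<in>X. C x * e x y)" by (simp add: csS)
    have U: "(UNIV :: nat set) = insert 0 (range Suc)" by (metis UNIV_nat_eq)
    have s: "(\<lambda>m. cs m y) summable_on range Suc"
      using abs_summable_summable[OF Cabs[OF y]] by (rule summable_on_subset_banach) auto
    have "C y = (\<Sum>\<^sub>\<infinity>m\<in>insert 0 (range Suc). cs m y)" by (simp add: C_def flip: U)
    also have "\<dots> = cs 0 y + (\<Sum>\<^sub>\<infinity>m\<in>range Suc. cs m y)"
      using s by (intro infsum_insert) auto
    also have "(\<Sum>\<^sub>\<infinity>m\<in>range Suc. cs m y) = (\<Sum>\<^sub>\<infinity>m. cs (Suc m) y)"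
      by (subst infsum_reindex) (auto simp: o_def)
    finally show "C y = c y + (\<Sum>\<^sub>\<infinity>x\<in>X. C x * e x y)" by (simp add: 1 cs0)
  qed
qed


section \<open>Bounds, uniform limits and families of Laurent expansions on annuli\<close>

lemma bounded_on_annulus:
  assumes f: "f holomorphic_on annulus a b" and "a < a'" "b' < b"
  obtains K :: real where "0 \<le> K" "\<And>z. z \<in> annulus a' b' \<Longrightarrow> norm (f z) \<le> K"
proof -
  define S where "S = {z::complex. a' \<le> norm z} \<inter> cball 0 b'"
  have "compact S"
    unfolding S_def by (intro closed_Int_compact closed_Collect_le continuous_intros compact_cball)
  moreover have "S \<subseteq> annulus a b" using assms by (auto simp: S_def annulus_def)
  ultimately have "compact (f ` S)"
    by (intro compact_continuous_image continuous_on_subset[OF holomorphic_on_imp_continuous_on[OF f]])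
  then obtain B where B: "\<And>z. z \<in> S \<Longrightarrow> norm (f z) \<le> B"
    using compact_imp_bounded[of "f ` S"] by (auto simp: bounded_iff)
  show ?thesis
  \<comment> \<open>The maximum with 0 covers an empty \<open>S\<close>, for which \<open>B\<close>
    could be negative.\<close>
  proof (rule that[of "max B 0"])
    fix z assume "z \<in> annulus a' b'"
    hence "z \<in> S" by (auto simp: S_def annulus_def)
    thus "norm (f z) \<le> max B 0" using B by fastforce
  qed auto
qed

lemma norm_powi_annulus:
  assumes "z \<in> annulus (1/r) r" "1 < r"
  shows "norm (z powi t) \<le> r ^ nat \<bar>t\<bar>"
proof (cases t rule: int_cases2)
  case (nonneg n)
  thus ?thesis using assms by (auto simp: annulus_def norm_power intro!: power_mono)
next
  case (nonpos n)
  have "0 < 1/r" "1/r < norm z" using assms by (auto simp: annulus_def)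
  hence z: "norm z > 0" by linarith
  hence "inverse (norm z) \<le> r" using assms by (auto simp: annulus_def field_simps)
  hence "inverse (norm z) ^ n \<le> r ^ n" using z by (intro power_mono) auto
  thus ?thesis by (simp add: nonpos norm_power norm_inverse power_int_minus power_inverse)
qed

lemma has_sum_int_shift: "((\<lambda>t::int. f (t + h)) has_sum S) UNIV \<longleftrightarrow> (f has_sum S) UNIV"
  by (rule has_sum_reindex_bij_witness[of _ "\<lambda>t. t - h" "\<lambda>t. t + h"]) auto

text \<open>The n copies of the integers index the components of a vector of Laurent series; one row
  of the error kernel is a family of this kind.\<close>

lemma summable_on_times_finite:
  fixes g :: "nat \<Rightarrow> int \<Rightarrow> real"
  assumes nonneg: "\<And>k t. k < n \<Longrightarrow> 0 \<le> g k t"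
    and h: "\<And>k t. k < n \<Longrightarrow> g k t \<le> h k t" "\<And>k. k < n \<Longrightarrow> (h k has_sum B) UNIV"
  shows "(\<lambda>(k,t). g k t) summable_on {..<n} \<times> UNIV"
    and "(\<Sum>\<^sub>\<infinity>(k,t)\<in>{..<n} \<times> UNIV. g k t) \<le> n * B"
proof -
  have s: "g k summable_on UNIV" if "k < n" for k
    by (rule summable_on_comparison_test[OF has_sum_imp_summable[OF h(2)[OF that]]]) (use h(1) nonneg that in auto)
  have b: "infsum (g k) UNIV \<le> B" if "k < n" for k
    using infsum_mono[OF s[OF that] has_sum_imp_summable[OF h(2)[OF that]] h(1)] infsumI[OF h(2)[OF that]] that by simp
  show 1: "(\<lambda>(k,t). g k t) summable_on {..<n} \<times> UNIV"
    using s nonneg by (intro summable_on_SigmaI[where g = "\<lambda>k. infsum (g k) UNIV"]) auto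
  have "(\<Sum>\<^sub>\<infinity>(k,t)\<in>{..<n} \<times> UNIV. g k t) = (\<Sum>k<n. infsum (g k) UNIV)"
    using infsum_Sigma'_banach[OF 1] by simp
  also have "\<dots> \<le> (\<Sum>k<n. B)" using b by (intro sum_mono) auto
  finally show "(\<Sum>\<^sub>\<infinity>(k,t)\<in>{..<n} \<times> UNIV. g k t) \<le> n * B" by simp
qed

text \<open>Weierstrass M-test over an arbitrary index set: the finite sums converge uniformly, and
  holomorphy passes to the limit on a small ball around each point.\<close>

lemma holomorphic_on_infsum:
  fixes g :: "'x \<Rightarrow> complex \<Rightarrow> complex"
  assumes hol: "\<And>x. x \<in> X \<Longrightarrow> g x holomorphic_on S" and S: "open S"
    and M: "\<And>x z. x \<in> X \<Longrightarrow> z \<in> S \<Longrightarrow> norm (g x z) \<le> M x" "M summable_on X"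
  shows "(\<lambda>z. \<Sum>\<^sub>\<infinity>x\<in>X. g x z) holomorphic_on S"
proof -
  have ul: "uniform_limit S (\<lambda>X y. \<Sum>x\<in>X. g x y) (\<lambda>y. \<Sum>\<^sub>\<infinity>x\<in>X. g x y) (finite_subsets_at_top X)"
    by (rule Weierstrass_m_test_general[OF M])
  have "\<exists>e>0. (\<lambda>z. \<Sum>\<^sub>\<infinity>x\<in>X. g x z) holomorphic_on ball z e" if z: "z \<in> S" for z
  proof -
    obtain e where e: "e > 0" "cball z e \<subseteq> S" using S z open_contains_cball by blast
    have "\<forall>\<^sub>F F in finite_subsets_at_top X. F \<subseteq> X"
      by (simp add: eventually_finite_subsets_at_top_weakI)
    hence "\<forall>\<^sub>F F in finite_subsets_at_top X. (\<lambda>z. \<Sum>x\<in>F. g x z) holomorphic_on S"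
      by eventually_elim (use hol in \<open>auto intro!: holomorphic_on_sum\<close>)
    hence "\<forall>\<^sub>F F in finite_subsets_at_top X. continuous_on (cball z e) (\<lambda>z. \<Sum>x\<in>F. g x z) \<and>
       (\<lambda>z. \<Sum>x\<in>F. g x z) holomorphic_on ball z e"
    proof eventually_elim
      case (elim F)
      have "(\<lambda>z. \<Sum>x\<in>F. g x z) holomorphic_on cball z e" using elim e(2) by (rule holomorphic_on_subset)
      thus ?case using holomorphic_on_imp_continuous_on holomorphic_on_subset ball_subset_cball by blast
    qed
    moreover have "uniform_limit (cball z e) (\<lambda>X y. \<Sum>x\<in>X. g x y) (\<lambda>y. \<Sum>\<^sub>\<infinity>x\<in>X. g x y) (finite_subsets_at_top X)"
      using ul e(2) by (rule uniform_limit_on_subset)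
    ultimately obtain "(\<lambda>z. \<Sum>\<^sub>\<infinity>x\<in>X. g x z) holomorphic_on ball z e"
      by (rule holomorphic_uniform_limit) auto
    thus ?thesis using e(1) by blast
  qed
  hence "(\<lambda>z. \<Sum>\<^sub>\<infinity>x\<in>X. g x z) analytic_on S" unfolding analytic_on_def by blast
  thus ?thesis by (rule analytic_imp_holomorphic)
qed

text \<open>The intervals from -d to d eventually contain every finite set of integers, so the
  uniform limit along all finite sets restricts to them. This provides the Laurent polynomials close
  to the inverse matrix.\<close>

lemma laurent_partial_sums_uniform:
  assumes c: "\<And>t. norm (c t) \<le> K / r' ^ nat \<bar>t\<bar>" and r: "1 < r" "r < r'"
    and f: "\<And>z. z \<in> annulus (1/r) r \<Longrightarrow> ((\<lambda>t. c t * z powi t) has_sum f z) UNIV"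
  shows "uniform_limit (annulus (1/r) r) (\<lambda>d z. \<Sum>t\<in>{-int d..int d}. c t * z powi t) f sequentially"
proof -
  have "uniform_limit (annulus (1/r) r) (\<lambda>X z. \<Sum>t\<in>X. c t * z powi t) f (finite_subsets_at_top UNIV)"
  proof (rule Weierstrass_m_test_general'[OF _ f])
    fix z t assume z: "z \<in> annulus (1/r) r"
    have "norm (c t * z powi t) \<le> K / r' ^ nat \<bar>t\<bar> * r ^ nat \<bar>t\<bar>"
      unfolding norm_mult using c[of t] norm_powi_annulus[OF z r(1), of t] r
      by (intro mult_mono) (auto intro: order.trans[OF norm_ge_zero])
    thus "norm (c t * z powi t) \<le> K * (r / r') ^ nat \<bar>t\<bar>" by (simp add: power_divide)
  next
    show "(\<lambda>t. K * (r / r') ^ nat \<bar>t\<bar>) summable_on UNIV"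
      using r by (intro summable_on_cmult_right summable_on_int_geometric) auto
  qed
  moreover have "filterlim (\<lambda>d. {-int d..int d}) (finite_subsets_at_top UNIV) sequentially"
    unfolding filterlim_finite_subsets_at_top
  proof safe
    fix X :: "int set" assume "finite X"
    then obtain B where B: "\<And>x. x \<in> X \<Longrightarrow> \<bar>x\<bar> \<le> B"
      by (metis bounded_iff finite_imp_bounded real_norm_def of_int_abs of_int_le_iff finite_imageI image_eqI
          Max_ge)
    show "\<forall>\<^sub>F d in sequentially. finite {- int d..int d} \<and> X \<subseteq> {- int d..int d} \<and> {- int d..int d} \<subseteq> UNIV"
      using eventually_ge_at_top[of "nat B"] by eventually_elim (use B in force)
  qed
  ultimately show ?thesis
    unfolding uniform_limit_iff filterlim_iff by blast
qed

text \<open>Finitely many bounds are merged into their sum. A vector of functions is covered as a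
  family constant in its second index.\<close>

lemma bounded_on_annulus_family:
  assumes f: "\<And>i j. i < (n::nat) \<Longrightarrow> j < n \<Longrightarrow> f i j holomorphic_on annulus a b" and "a < a'" "b' < b"
  obtains K :: real where "0 \<le> K" "\<And>i j z. i < n \<Longrightarrow> j < n \<Longrightarrow> z \<in> annulus a' b' \<Longrightarrow> norm (f i j z) \<le> K"
proof -
  have "\<exists>K\<ge>0. \<forall>z\<in>annulus a' b'. norm (f i j z) \<le> K" if "i < n" "j < n" for i j
    by (rule bounded_on_annulus[OF f[OF that] assms(2,3)]) auto
  hence "\<exists>K. \<forall>i j. i < n \<longrightarrow> j < n \<longrightarrow> 0 \<le> K i j \<and> (\<forall>z\<in>annulus a' b'. norm (f i j z) \<le> K i j)"
    by metis
  then obtain K where K: "\<And>i j. i < n \<Longrightarrow> j < n \<Longrightarrow> 0 \<le> K i j"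
    "\<And>i j z. i < n \<Longrightarrow> j < n \<Longrightarrow> z \<in> annulus a' b' \<Longrightarrow> norm (f i j z) \<le> K i j" by blast
  show ?thesis
  proof (rule that[of "\<Sum>i<n. \<Sum>j<n. K i j"])
    show "0 \<le> (\<Sum>i<n. \<Sum>j<n. K i j)" using K(1) by (intro sum_nonneg) auto
    fix i j z assume *: "i < n" "j < n" "z \<in> annulus a' b'"
    have "norm (f i j z) \<le> K i j" by (rule K(2)[OF *])
    also have "\<dots> \<le> (\<Sum>j<n. K i j)" using * K(1) by (intro member_le_sum) auto
    also have "\<dots> \<le> (\<Sum>i<n. \<Sum>j<n. K i j)"
      using * K(1) by (intro member_le_sum[where f = "\<lambda>i. \<Sum>j<n. K i j"] sum_nonneg) auto
    finally show "norm (f i j z) \<le> (\<Sum>i<n. \<Sum>j<n. K i j)" .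
  qed
qed

lemma laurent_expansion_annulus_family:
  assumes f: "\<And>i j. i < (n::nat) \<Longrightarrow> j < n \<Longrightarrow> f i j holomorphic_on annulus (1/R) R" and r: "1 < r" "r < R"
    and bd: "\<And>i j z. i < n \<Longrightarrow> j < n \<Longrightarrow> z \<in> annulus (1/R) R \<Longrightarrow> norm (f i j z) \<le> \<delta>"
  obtains c :: "nat \<Rightarrow> nat \<Rightarrow> int \<Rightarrow> complex" where
    "\<And>i j t. i < n \<Longrightarrow> j < n \<Longrightarrow> norm (c i j t) \<le> \<delta> / r ^ nat \<bar>t\<bar>"
    "\<And>i j z. i < n \<Longrightarrow> j < n \<Longrightarrow> z \<in> annulus (1/r) r \<Longrightarrow> ((\<lambda>t. c i j t * z powi t) has_sum f i j z) UNIV"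
proof -
  have "\<exists>c. (\<forall>t. norm (c t) \<le> \<delta> / r ^ nat \<bar>t\<bar>) \<and>
      (\<forall>z\<in>annulus (1/r) r. ((\<lambda>t. c t * z powi t) has_sum f i j z) UNIV)" if "i < n" "j < n" for i j
    by (rule laurent_expansion_annulus[OF f[OF that] r bd[OF that]]) auto
  hence "\<exists>c. \<forall>i j. i < n \<longrightarrow> j < n \<longrightarrow> (\<forall>t. norm (c i j t) \<le> \<delta> / r ^ nat \<bar>t\<bar>) \<and>
      (\<forall>z\<in>annulus (1/r) r. ((\<lambda>t. c i j t * z powi t) has_sum f i j z) UNIV)"
    by metis
  thus ?thesis using that by blast
qed

lemma geometric_shift_has_sum:
  fixes x :: real
  assumes "0 \<le> x" "x < 1"
  shows "((\<lambda>t. K * x ^ nat \<bar>t + h\<bar>) has_sum K * (\<Sum>\<^sub>\<infinity>t::int. x ^ nat \<bar>t\<bar>)) UNIV"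
  using has_sum_cmult_right[OF has_sum_infsum[OF summable_on_int_geometric[OF assms]], of K]
    has_sum_int_shift[of "\<lambda>t. K * x ^ nat \<bar>t\<bar>" h] by simp


section \<open>Surjectivity of the twisted difference operator\<close>


lemma has_sum_diff:
  fixes f g :: "'a \<Rightarrow> 'b :: real_normed_vector"
  assumes "(f has_sum a) A" "(g has_sum b) A"
  shows "((\<lambda>x. f x - g x) has_sum (a - b)) A"
  using has_sum_add[OF assms(1), of "\<lambda>x. - g x" "- b"] assms(2) by (simp add: has_sum_uminus)

lemma has_sum_sum:
  fixes f :: "'i \<Rightarrow> 'a \<Rightarrow> 'b :: real_normed_vector"
  assumes "\<And>i. i \<in> I \<Longrightarrow> (f i has_sum a i) A"
  shows "((\<lambda>x. \<Sum>i\<in>I. f i x) has_sum (\<Sum>i\<in>I. a i)) A"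
  using assms by (induction I rule: infinite_finite_induct) (auto intro!: has_sum_add)

text \<open>The exponent \<open>l\<close> is fixed before \<open>f\<close>, so that one twist serves
  all columns of a matrix solution. The solution lives on a larger annulus than the equation because
  the equation links the values at \<open>z\<close> and at \<open>q * z\<close>.\<close>

lemma twisted_solvable:
  fixes A N :: "nat \<Rightarrow> nat \<Rightarrow> complex \<Rightarrow> complex" and q :: complex
  assumes A: "\<And>i j. i < n \<Longrightarrow> j < n \<Longrightarrow> A i j holomorphic_on annulus (1/R) R"
    and N: "\<And>i j. i < n \<Longrightarrow> j < n \<Longrightarrow> N i j holomorphic_on annulus (1/R) R"
    and AN: "\<And>i j z. i < n \<Longrightarrow> j < n \<Longrightarrow> z \<in> annulus (1/R) R \<Longrightarrow>
               (\<Sum>k<n. A i k z * N k j z) = (if i = j then 1 else 0)"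
    and r: "1 < r" "r < R" and q: "q \<noteq> 0" "norm q * r\<^sup>2 < 1"
  obtains l :: nat where
    "\<And>f. (\<And>i. i < n \<Longrightarrow> f i holomorphic_on annulus (1/R) R) \<Longrightarrow>
       \<exists>w. (\<forall>i<n. w i holomorphic_on annulus (norm q / r) r) \<and>
           (\<forall>i<n. \<forall>z\<in>annulus (1/r) r. w i (q * z) - (\<Sum>k<n. A i k z * w k z) / z ^ l = f i z)"
proof -
  \<comment> \<open>Each passage between a function and its Laurent coefficients loses some radius.
    Bounds on functions hold at \<open>r4\<close>, the coefficients of \<open>N\<close> decay at
    rate \<open>r3\<close>, their partial sums are uniformly close at \<open>r2\<close>, all
    coefficients decay at rate \<open>r1\<close>, and the weights grow only at rate
    \<open>r\<close>. What remains is the ratio r/r1 < 1.\<close>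
  obtain r1 where r1: "r < r1" "r1 < R" using dense r(2) by blast
  obtain r2 where r2: "r1 < r2" "r2 < R" using dense r1(2) by blast
  obtain r3 where r3: "r2 < r3" "r3 < R" using dense r2(2) by blast
  obtain r4 where r4: "r3 < r4" "r4 < R" using dense r3(2) by blast
  note rs = r r1 r2 r3 r4
  have sub: "annulus (1/a) a \<subseteq> annulus (1/b) b" if "1 < a" "a \<le> b" for a b :: real
    using that by (intro annulus_mono divide_left_mono) auto
  have r4R: "1 / R < 1 / r4" using rs by (intro divide_strict_left_mono) auto
  have q1: "norm q < 1"
  proof -
    have "norm q * 1 \<le> norm q * r\<^sup>2" using r by (intro mult_left_mono) auto
    thus ?thesis using q(2) by simp
  qed
  obtain CA where CA: "0 \<le> CA" "\<And>i j z. i < n \<Longrightarrow> j < n \<Longrightarrow> z \<in> annulus (1/r4) r4 \<Longrightarrow> norm (A i j z) \<le> CA"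
    using bounded_on_annulus_family[of n A, OF A r4R r4(2)] by metis
  obtain CN where CN: "0 \<le> CN" "\<And>i j z. i < n \<Longrightarrow> j < n \<Longrightarrow> z \<in> annulus (1/r4) r4 \<Longrightarrow> norm (N i j z) \<le> CN"
    using bounded_on_annulus_family[of n N, OF N r4R r4(2)] by metis
  define \<sigma> where "\<sigma> = (\<Sum>\<^sub>\<infinity>t::int. (r / r1) ^ nat \<bar>t\<bar>)"
  have \<sigma>0: "0 \<le> \<sigma>" unfolding \<sigma>_def using rs by (intro infsum_nonneg) auto
  have geo: "((\<lambda>t. K * (r / r1) ^ nat \<bar>t + h\<bar>) has_sum K * \<sigma>) UNIV" for K h
    unfolding \<sigma>_def using rs by (intro geometric_shift_has_sum) auto
  \<comment> \<open>The constants are fixed backwards. Each of the n components receives at most two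
    errors of size \<beta> times the weight, and 2 n \<beta> <= 1/2. Then \<delta> is the bound on
    the defect 1 - A L that keeps its share below \<beta>, and \<eta> the accuracy of L that ensures
    it. The summands 1 avoid division by zero.\<close>
  define \<beta> where "\<beta> = 1 / (4 * (real n + 1))"
  define \<delta> where "\<delta> = \<beta> / (\<sigma> + 1)"
  define \<eta> where "\<eta> = \<delta> / (n * CA + 1)"
  have pos: "0 < \<beta>" "0 < \<delta>" "0 < \<eta>" "\<delta> * \<sigma> \<le> \<beta>" "n * (CA * \<eta>) \<le> \<delta>"
  proof -
    show 1: "0 < \<beta>" by (auto simp: \<beta>_def)
    show 2: "0 < \<delta>" using 1 \<sigma>0 by (auto simp: \<delta>_def)
    have 3: "0 < n * CA + 1" using CA(1) by (simp add: add_nonneg_pos)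
    thus "0 < \<eta>" using 2 by (simp add: \<eta>_def)
    show "\<delta> * \<sigma> \<le> \<beta>" using 1 \<sigma>0 by (simp add: \<delta>_def field_simps)
    show "n * (CA * \<eta>) \<le> \<delta>" using 2 3 by (simp add: \<eta>_def field_simps)
  qed
  have "\<And>i j. i < n \<Longrightarrow> j < n \<Longrightarrow> A i j holomorphic_on annulus (1/r4) r4"
    using A sub[of r4 R] rs by (force intro: holomorphic_on_subset)
  then obtain a where a: "\<And>i j t. i < n \<Longrightarrow> j < n \<Longrightarrow> norm (a i j t) \<le> CA / r1 ^ nat \<bar>t\<bar>"
    "\<And>i j z. i < n \<Longrightarrow> j < n \<Longrightarrow> z \<in> annulus (1/r1) r1 \<Longrightarrow> ((\<lambda>t. a i j t * z powi t) has_sum A i j z) UNIV"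
    using laurent_expansion_annulus_family[of n A r4 r1 CA] CA(2) rs by (smt (verit))
  have N4: "\<And>i j. i < n \<Longrightarrow> j < n \<Longrightarrow> N i j holomorphic_on annulus (1/r4) r4"
    using N sub[of r4 R] rs by (force intro: holomorphic_on_subset)
  then obtain b where b: "\<And>i j t. i < n \<Longrightarrow> j < n \<Longrightarrow> norm (b i j t) \<le> CN / r3 ^ nat \<bar>t\<bar>"
    "\<And>i j z. i < n \<Longrightarrow> j < n \<Longrightarrow> z \<in> annulus (1/r3) r3 \<Longrightarrow> ((\<lambda>t. b i j t * z powi t) has_sum N i j z) UNIV"
    using laurent_expansion_annulus_family[of n N r4 r3 CN] CN(2) rs by (smt (verit))
  have "\<forall>\<^sub>F d in sequentially. \<forall>(k,i)\<in>{..<n} \<times> {..<n}. \<forall>z\<in>annulus (1/r2) r2.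
      dist (\<Sum>t\<in>{-int d..int d}. b k i t * z powi t) (N k i z) < \<eta>"
  proof (intro eventually_ball_finite ballI)
    fix x assume "x \<in> {..<n} \<times> {..<n}"
    then obtain k i where x: "x = (k, i)" "k < n" "i < n" by auto
    have "uniform_limit (annulus (1/r2) r2) (\<lambda>d z. \<Sum>t\<in>{-int d..int d}. b k i t * z powi t) (N k i) sequentially"
      using b[OF x(2,3)] sub[of r2 r3] rs
      by (intro laurent_partial_sums_uniform[of _ CN r3]) auto
    from uniform_limitD[OF this pos(3)] show "\<forall>\<^sub>F d in sequentially. case x of (k, i) \<Rightarrow> \<forall>z\<in>annulus (1/r2) r2.
      dist (\<Sum>t\<in>{-int d..int d}. b k i t * z powi t) (N k i z) < \<eta>" by (simp add: x)
  qed auto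
  then obtain d :: nat where d: "\<And>k i z. k < n \<Longrightarrow> i < n \<Longrightarrow> z \<in> annulus (1/r2) r2 \<Longrightarrow>
      dist (\<Sum>t\<in>{-int d..int d}. b k i t * z powi t) (N k i z) < \<eta>"
    using eventually_happens'[OF sequentially_bot] by fastforce
  \<comment> \<open>\<open>L\<close> is a truncated Laurent series of \<open>N\<close>, holomorphic
    away from 0 even where \<open>N\<close> need not be; \<open>D\<close> is the defect matrix 1 - A
    L.\<close>
  define L where "L = (\<lambda>k i z. \<Sum>t\<in>{-int d..int d}. b k i t * z powi t)"
  define D where "D = (\<lambda>k i z. (if k = i then 1 else 0) - (\<Sum>m<n. A k m z * L m i z))"
  have Lhol: "L k i holomorphic_on S" if "0 \<notin> S" for k i S
    unfolding L_def using that by (intro holomorphic_intros) auto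
  have z0: "0 \<notin> annulus (1/r2) r2" using rs by (auto simp: annulus_def)
  have Dhol: "D k i holomorphic_on annulus (1/r2) r2" if "k < n" "i < n" for k i
    unfolding D_def using that A sub[of r2 R] rs z0
    by (intro holomorphic_intros Lhol) (auto intro: holomorphic_on_subset)
  have Dbd: "norm (D k i z) \<le> \<delta>" if "k < n" "i < n" "z \<in> annulus (1/r2) r2" for k i z
  proof -
    have z: "z \<in> annulus (1/R) R" "z \<in> annulus (1/r4) r4" using that(3) sub[of r2 R] sub[of r2 r4] rs by auto
    \<comment> \<open>As A N = 1, the defect equals A (N - L).\<close>
    have "D k i z = (\<Sum>m<n. A k m z * (N m i z - L m i z))"
      using AN[OF that(1,2) z(1)] by (simp add: D_def right_diff_distrib sum_subtractf)
    also have "norm \<dots> \<le> (\<Sum>m<n. CA * \<eta>)"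
    proof (intro sum_norm_le)
      fix m assume "m \<in> {..<n}"
      thus "norm (A k m z * (N m i z - L m i z)) \<le> CA * \<eta>"
        using CA(2)[of k m z] d[of m i z] that z CA(1) unfolding norm_mult
        by (intro mult_mono) (auto simp: L_def dist_norm norm_minus_commute)
    qed
    also have "\<dots> \<le> \<delta>" using pos(5) by simp
    finally show ?thesis .
  qed
  obtain dd where dd: "\<And>i j t. i < n \<Longrightarrow> j < n \<Longrightarrow> norm (dd i j t) \<le> \<delta> / r1 ^ nat \<bar>t\<bar>"
    "\<And>i j z. i < n \<Longrightarrow> j < n \<Longrightarrow> z \<in> annulus (1/r1) r1 \<Longrightarrow> ((\<lambda>t. dd i j t * z powi t) has_sum D i j z) UNIV"
    using laurent_expansion_annulus_family[of n D r2 r1 \<delta>] Dhol Dbd rs by (smt (verit))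
  have b1: "norm (b i j t) \<le> CN / r1 ^ nat \<bar>t\<bar>" if "i < n" "j < n" for i j t
  proof -
    have "CN / r3 ^ nat \<bar>t\<bar> \<le> CN / r1 ^ nat \<bar>t\<bar>"
      using rs CN(1) by (intro divide_left_mono power_mono mult_pos_pos) auto
    thus ?thesis using b(1)[OF that, of t] by linarith
  qed
  have "(\<lambda>s. r ^ d * (CA + CN) * \<sigma> * (norm q * r\<^sup>2) ^ s) \<longlonglongrightarrow> r ^ d * (CA + CN) * \<sigma> * 0"
    using q by (intro tendsto_intros LIMSEQ_power_zero) (auto simp: abs_mult)
  hence "\<forall>\<^sub>F s in sequentially. r ^ d * (CA + CN) * \<sigma> * (norm q * r\<^sup>2) ^ s < \<beta>"
    using pos(1) by (intro order_tendstoD(2)) auto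
  then obtain s where s: "r ^ d * (CA + CN) * \<sigma> * (norm q * r\<^sup>2) ^ s < \<beta>"
    by (auto simp: eventually_sequentially)
  \<comment> \<open>For j >= -s every exponent t in (qz)^(l+j) L(qz) satisfies t >= l - s - d = s,
    so its factor q^t has norm at most |q|^s. Multiplication by z^l costs r^l = r^d r^(2s), whence
    the small quantity (|q| r^2)^s chosen above.\<close>
  define l where "l = 2 * s + d"
  have small: "norm q ^ s * r ^ l * K * \<sigma> \<le> \<beta>" if "K \<le> CA + CN" for K
  proof -
    have "norm q ^ s * r ^ l * K * \<sigma> \<le> norm q ^ s * r ^ l * (CA + CN) * \<sigma>"
      using that \<sigma>0 rs by (intro mult_right_mono mult_left_mono) auto
    also have "\<dots> = r ^ d * (CA + CN) * \<sigma> * (norm q * r\<^sup>2) ^ s"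
      by (simp add: l_def power_add power_mult_distrib mult_ac flip: power_mult)
    finally show ?thesis using s by simp
  qed
  \<comment> \<open>The pair (i, j) stands for the vector-valued monomial with z ^ j in component i, of weight
    r ^ |j|. The approximate solution of T v = monomial is read off from v(q z) when j is very
    negative and from A(z) v(z) / z ^ l otherwise; e collects the Laurent coefficients of the error.\<close>
  define X where "X = {..<n} \<times> (UNIV :: int set)"
  define w where "w = (\<lambda>x :: nat \<times> int. r ^ nat \<bar>snd x\<bar>)"
  have w0: "0 < w x" for x using r by (simp add: w_def)
  define e where "e = (\<lambda>(i, j) (k, t). if j < - int s then q powi (-j) * a k i (t + (int l - j))
     else dd k i (t + (-j)) + (if \<bar>t + (- int l - j)\<bar> \<le> int d then q powi t * b k i (t + (- int l - j)) else 0))"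
  define bas where "bas = (\<lambda>(i :: nat, j :: int) k z. if k = i then z powi j else (0::complex))"
  define V where "V = (\<lambda>(i :: nat, j :: int) k z. if j < - int s then (if k = i then (z / q) powi j else 0)
     else - (z powi (int l + j) * L k i z))"
  define E where "E = (\<lambda>(i :: nat, j :: int) k z. if j < - int s then (z / q) powi j / z ^ l * A k i z
     else z powi j * D k i z + (q * z) powi (int l + j) * L k i (q * z))"
  have Vfun: "V x k (q * z) - (\<Sum>m<n. A k m z * V x m z) / z ^ l = bas x k z - E x k z"
    if x: "x \<in> X" and k: "k < n" and z: "z \<noteq> 0" for x k z
  proof -
    obtain i j where ij: "x = (i, j)" "i < n" using x by (auto simp: X_def)
    show ?thesis
    proof (cases "j < - int s")
      case True
      have "(\<Sum>m<n. A k m z * V x m z) = A k i z * (z / q) powi j"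
      proof -
        have "V x m z = (if m = i then (z / q) powi j else 0)" for m using True by (simp add: V_def ij)
        hence "(\<Sum>m<n. A k m z * V x m z) = (\<Sum>m<n. if m = i then A k m z * (z / q) powi j else 0)"
          by (intro sum.cong) auto
        thus ?thesis using ij(2) by simp
      qed
      thus ?thesis using ij True q z by (auto simp: V_def bas_def E_def)
    next
      case False
      have "(\<Sum>m<n. A k m z * V x m z) = - (z powi (int l + j) * (\<Sum>m<n. A k m z * L m i z))"
        using ij False by (simp add: V_def sum_negf sum_distrib_left mult_ac)
      also have "(\<Sum>m<n. A k m z * L m i z) = (if k = i then 1 else 0) - D k i z"
        by (simp add: D_def)
      finally have "(\<Sum>m<n. A k m z * V x m z) / z ^ l = - (z powi j * ((if k = i then 1 else 0) - D k i z))"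
        using z by (simp add: power_int_add)
      thus ?thesis using ij False by (auto simp: V_def bas_def E_def algebra_simps)
    qed
  qed
  have Esum: "((\<lambda>t. e x (k, t) * z powi t) has_sum E x k z) UNIV"
    if x: "x \<in> X" and k: "k < n" and z: "z \<in> annulus (1/r) r" for x k z
  proof -
    obtain i j where ij: "x = (i, j)" "i < n" using x by (auto simp: X_def)
    have z1: "z \<in> annulus (1/r1) r1" using z sub[of r r1] rs by auto
    have z0: "z \<noteq> 0" using z r by (auto simp: annulus_def)
    show ?thesis
    proof (cases "j < - int s")
      case True
      have "((\<lambda>t. (z / q) powi j / z ^ l * (a k i (t + (int l - j)) * z powi (t + (int l - j)))) has_sum E x k z) UNIV"
        using has_sum_cmult_right[OF iffD2[OF has_sum_int_shift a(2)[OF k ij(2) z1]], of "(z / q) powi j / z ^ l" "int l - j"] True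
        by (simp add: E_def ij)
      also have "(\<lambda>t. (z / q) powi j / z ^ l * (a k i (t + (int l - j)) * z powi (t + (int l - j)))) = (\<lambda>t. e x (k, t) * z powi t)"
        using z0 q True by (auto simp: e_def ij power_int_add power_int_diff power_int_minus power_int_divide_distrib field_simps)
      finally show ?thesis .
    next
      case False
      have 1: "((\<lambda>t. z powi j * (dd k i (t + (-j)) * z powi (t + (-j)))) has_sum z powi j * D k i z) UNIV"
        by (intro has_sum_cmult_right iffD2[OF has_sum_int_shift dd(2)[OF k ij(2) z1]])
      have "((\<lambda>u. if \<bar>u\<bar> \<le> int d then b k i u * (q * z) powi u else 0) has_sum L k i (q * z)) UNIV"
        by (rule has_sum_finite_neutralI[of "{-int d..int d}"]) (auto simp: L_def intro!: sum.cong)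
      hence "((\<lambda>t. if \<bar>t + (- int l - j)\<bar> \<le> int d then b k i (t + (- int l - j)) * (q * z) powi (t + (- int l - j)) else 0) has_sum L k i (q * z)) UNIV"
        by (subst has_sum_int_shift[of "\<lambda>u. if \<bar>u\<bar> \<le> int d then b k i u * (q * z) powi u else 0"])
      hence 2: "((\<lambda>t. (q * z) powi (int l + j) * (if \<bar>t + (- int l - j)\<bar> \<le> int d then b k i (t + (- int l - j)) * (q * z) powi (t + (- int l - j)) else 0)) has_sum
          (q * z) powi (int l + j) * L k i (q * z)) UNIV"
        by (rule has_sum_cmult_right)
      have 3: "z powi j * (dd k i (t + (-j)) * z powi (t + (-j))) + (q * z) powi (int l + j) * (if \<bar>t + (- int l - j)\<bar> \<le> int d then b k i (t + (- int l - j)) * (q * z) powi (t + (- int l - j)) else 0)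
         = e x (k, t) * z powi t" for t
      proof -
        have "z powi j * z powi (t + (-j)) = z powi t" using z0 by (simp flip: power_int_add)
        moreover have "(q * z) powi (int l + j) * (q * z) powi (t + (- int l - j)) = q powi t * z powi t"
          using z0 q by (subst power_int_add[symmetric]) (auto simp: power_int_mult_distrib)
        ultimately have m: "z powi j * (X * z powi (t + (-j))) = X * z powi t"
          "(q * z) powi (int l + j) * (X * (q * z) powi (t + (- int l - j))) = X * (q powi t * z powi t)" for X
          by (metis mult.left_commute)+
        have he: "e x (k, t) = dd k i (t + (-j)) + (if \<bar>t + (- int l - j)\<bar> \<le> int d then q powi t * b k i (t + (- int l - j)) else 0)"
          using False by (simp add: e_def ij)
        show ?thesis unfolding he
          by (cases "\<bar>t + (- int l - j)\<bar> \<le> int d") (simp_all only: if_True if_False m distrib_right mult_zero_right mult_zero_left, simp_all only: mult_ac)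
      qed
      show ?thesis using has_sum_add[OF 1 2] False unfolding 3 by (simp add: E_def ij)
    qed
  qed
  have rshift: "r ^ nat \<bar>t\<bar> \<le> r ^ nat \<bar>t + h\<bar> * r ^ nat \<bar>h\<bar>" for t h
    unfolding power_add[symmetric] using r by (intro power_increasing) auto
  have ebd: "(\<lambda>y. norm (e x y) * w y) summable_on X" "(\<Sum>\<^sub>\<infinity>y\<in>X. norm (e x y) * w y) \<le> 1/2 * w x"
    if x: "x \<in> X" for x
  proof -
    obtain i j where ij: "x = (i, j)" "i < n" using x by (auto simp: X_def)
    have wx: "w x = r ^ nat \<bar>j\<bar>" by (simp add: w_def ij)
    have n\<beta>: "n * (2 * \<beta> * w x) \<le> 1/2 * w x"
      using w0[of x] by (simp add: \<beta>_def field_simps)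
    have "(\<lambda>y. norm (e x y) * w y) summable_on X \<and> (\<Sum>\<^sub>\<infinity>y\<in>X. norm (e x y) * w y) \<le> 1/2 * w x"
    proof (cases "j < - int s")
      case True
      \<comment> \<open>In this range -j > s, so the factor q^(-j) in the coefficients has norm at
        most |q|^s. The shift by l - j costs r^(l+|j|), and r^|j| is the weight of \<open>x\<close>
        itself.\<close>
      define K where "K = norm q ^ s * r ^ l * CA * w x"
      have bnd: "norm (e x (k, t)) * r ^ nat \<bar>t\<bar> \<le> K * (r / r1) ^ nat \<bar>t + (int l - j)\<bar>" if k: "k < n" for k t
      proof -
        define u where "u = t + (int l - j)"
        have 1: "r ^ nat \<bar>t\<bar> \<le> r ^ nat \<bar>u\<bar> * (r ^ l * r ^ nat \<bar>j\<bar>)"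
        proof -
          have "nat \<bar>int l - j\<bar> = l + nat \<bar>j\<bar>" using True by auto
          thus ?thesis using rshift[of t "int l - j"] by (simp add: u_def power_add)
        qed
        have 2: "norm (q powi (-j)) \<le> norm q ^ s"
        proof -
          have "norm (q powi (-j)) = norm q ^ nat (-j)" using True by (simp add: power_int_def norm_power)
          also have "\<dots> \<le> norm q ^ s" using True q1 by (intro power_decreasing) auto
          finally show ?thesis .
        qed
        have "norm (e x (k, t)) * r ^ nat \<bar>t\<bar> = norm (q powi (-j)) * norm (a k i u) * r ^ nat \<bar>t\<bar>"
          using True by (simp add: e_def ij u_def norm_mult)
        also have "\<dots> \<le> norm q ^ s * (CA / r1 ^ nat \<bar>u\<bar>) * (r ^ nat \<bar>u\<bar> * (r ^ l * r ^ nat \<bar>j\<bar>))"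
          by (intro mult_mono[OF mult_mono[OF 2 a(1)[OF k ij(2)]] 1]) (use CA(1) rs in auto)
        also have "\<dots> = K * (r / r1) ^ nat \<bar>u\<bar>"
          by (simp add: K_def wx power_divide mult_ac)
        finally show ?thesis by (simp add: u_def)
      qed
      have "(\<lambda>(k, t). norm (e x (k, t)) * r ^ nat \<bar>t\<bar>) summable_on X"
        "(\<Sum>\<^sub>\<infinity>(k, t)\<in>X. norm (e x (k, t)) * r ^ nat \<bar>t\<bar>) \<le> n * (K * \<sigma>)"
        unfolding X_def
        using summable_on_times_finite[where g = "\<lambda>k t. norm (e x (k, t)) * r ^ nat \<bar>t\<bar>", OF _ bnd geo] r
        by simp_all
      moreover have "K * \<sigma> \<le> 2 * \<beta> * w x"
      proof -
        have "K * \<sigma> = (norm q ^ s * r ^ l * CA * \<sigma>) * w x" by (simp add: K_def)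
        also have "\<dots> \<le> \<beta> * w x" using small[of CA] CN(1) w0[of x] by (intro mult_right_mono) auto
        also have "\<dots> \<le> 2 * \<beta> * w x" using pos w0[of x] by simp
        finally show ?thesis .
      qed
      hence "n * (K * \<sigma>) \<le> n * (2 * \<beta> * w x)" by (intro mult_left_mono) auto
      ultimately show ?thesis using n\<beta> by (simp add: w_def case_prod_unfold)
    next
      case False
      \<comment> \<open>\<open>K1\<close> belongs to the defect of the approximate inverse, small
        through \<delta>; \<open>K2\<close> belongs to the term v(qz), small through |q|^s.\<close>
      define K1 where "K1 = \<delta> * w x"
      define K2 where "K2 = norm q ^ s * r ^ l * CN * w x"
      have K2: "0 \<le> K2" using CN(1) r w0[of x] by (simp add: K2_def)
      have bnd: "norm (e x (k, t)) * r ^ nat \<bar>t\<bar> \<le> K1 * (r / r1) ^ nat \<bar>t + (-j)\<bar> + K2 * (r / r1) ^ nat \<bar>t + (- int l - j)\<bar>"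
        if k: "k < n" for k t
      proof -
        define u where "u = t + (- int l - j)"
        define B where "B = (if \<bar>u\<bar> \<le> int d then q powi t * b k i u else 0)"
        have "norm (dd k i (t + (-j))) * r ^ nat \<bar>t\<bar> \<le> \<delta> / r1 ^ nat \<bar>t + (-j)\<bar> * (r ^ nat \<bar>t + (-j)\<bar> * r ^ nat \<bar>-j\<bar>)"
          using rshift[of t "-j"] dd(1)[OF k ij(2), of "t + (-j)"] pos rs by (intro mult_mono) auto
        also have "\<dots> = K1 * (r / r1) ^ nat \<bar>t + (-j)\<bar>" by (simp add: K1_def wx power_divide)
        finally have 1: "norm (dd k i (t + (-j))) * r ^ nat \<bar>t\<bar> \<le> K1 * (r / r1) ^ nat \<bar>t + (-j)\<bar>" .
        have 2: "norm B * r ^ nat \<bar>t\<bar> \<le> K2 * (r / r1) ^ nat \<bar>u\<bar>"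
        proof (cases "\<bar>u\<bar> \<le> int d")
          case True
          have t: "t \<ge> int s" using True False by (auto simp: u_def l_def)
          have "norm (q powi t) = norm q ^ nat t" using t by (simp add: power_int_def norm_power)
          also have "\<dots> \<le> norm q ^ s" using t q1 by (intro power_decreasing) auto
          finally have qt: "norm (q powi t) \<le> norm q ^ s" .
          have "nat \<bar>- int l - j\<bar> \<le> l + nat \<bar>j\<bar>" by auto
          hence "r ^ nat \<bar>- int l - j\<bar> \<le> r ^ (l + nat \<bar>j\<bar>)" using r by (intro power_increasing) auto
          hence "r ^ nat \<bar>u\<bar> * r ^ nat \<bar>- int l - j\<bar> \<le> r ^ nat \<bar>u\<bar> * (r ^ l * r ^ nat \<bar>j\<bar>)"
            using r by (intro mult_left_mono) (auto simp: power_add)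
          hence rt: "r ^ nat \<bar>t\<bar> \<le> r ^ nat \<bar>u\<bar> * (r ^ l * r ^ nat \<bar>j\<bar>)"
            using rshift[of t "- int l - j"] by (simp add: u_def)
          have "norm B * r ^ nat \<bar>t\<bar> = norm (q powi t) * norm (b k i u) * r ^ nat \<bar>t\<bar>"
            using True by (simp add: B_def norm_mult)
          also have "\<dots> \<le> norm q ^ s * (CN / r1 ^ nat \<bar>u\<bar>) * (r ^ nat \<bar>u\<bar> * (r ^ l * r ^ nat \<bar>j\<bar>))"
            by (intro mult_mono[OF mult_mono[OF qt b1[OF k ij(2)]] rt]) (use CN(1) rs in auto)
          also have "\<dots> = K2 * (r / r1) ^ nat \<bar>u\<bar>"
            by (simp add: K2_def wx power_divide mult_ac)
          finally show ?thesis .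
        next
          case False
          thus ?thesis using K2 rs by (simp add: B_def)
        qed
        have "norm (e x (k, t)) * r ^ nat \<bar>t\<bar> \<le> (norm (dd k i (t + (-j))) + norm B) * r ^ nat \<bar>t\<bar>"
          using False r by (intro mult_right_mono) (auto simp: e_def ij B_def u_def intro: norm_triangle_ineq)
        thus ?thesis using 1 2 by (simp add: distrib_right u_def)
      qed
      have "(\<lambda>(k, t). norm (e x (k, t)) * r ^ nat \<bar>t\<bar>) summable_on X"
        "(\<Sum>\<^sub>\<infinity>(k, t)\<in>X. norm (e x (k, t)) * r ^ nat \<bar>t\<bar>) \<le> n * (K1 * \<sigma> + K2 * \<sigma>)"
        unfolding X_def
        using summable_on_times_finite[where g = "\<lambda>k t. norm (e x (k, t)) * r ^ nat \<bar>t\<bar>", OF _ bnd has_sum_add[OF geo geo]] r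
        by simp_all
      moreover have "K1 * \<sigma> + K2 * \<sigma> \<le> 2 * \<beta> * w x"
      proof -
        have "K1 * \<sigma> + K2 * \<sigma> = (\<delta> * \<sigma>) * w x + (norm q ^ s * r ^ l * CN * \<sigma>) * w x"
          by (simp add: K1_def K2_def)
        also have "\<dots> \<le> \<beta> * w x + \<beta> * w x"
          using small[of CN] CA(1) pos(4) w0[of x] by (intro add_mono mult_right_mono) auto
        finally show ?thesis by simp
      qed
      hence "n * (K1 * \<sigma> + K2 * \<sigma>) \<le> n * (2 * \<beta> * w x)" by (intro mult_left_mono) auto
      ultimately show ?thesis using n\<beta> by (simp add: w_def case_prod_unfold)
    qed
    thus "(\<lambda>y. norm (e x y) * w y) summable_on X" "(\<Sum>\<^sub>\<infinity>y\<in>X. norm (e x y) * w y) \<le> 1/2 * w x" by auto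
  qed
  define \<Omega> where "\<Omega> = annulus (norm q / r) r"
  have \<Omega>0: "0 \<notin> \<Omega>" using r by (auto simp: \<Omega>_def annulus_def not_less)
  have Lbd: "\<exists>K\<ge>0. \<forall>k<n. \<forall>i<n. \<forall>z\<in>\<Omega>. norm (L k i z) \<le> K"
  proof -
    \<comment> \<open>\<open>\<Omega>\<close> reaches inside the unit circle to places where
      \<open>N\<close> is not known to be holomorphic; its Laurent polynomial approximation is still
      bounded there.\<close>
    have "L k i holomorphic_on annulus 0 (r + 1)" for k i by (intro Lhol) (auto simp: annulus_def)
    moreover have "0 < norm q / r" "r < r + 1" using q r by auto
    ultimately show ?thesis using bounded_on_annulus_family[of n L 0 "r + 1"] unfolding \<Omega>_def by metis
  qed
  then obtain CL where CL: "0 \<le> CL" "\<And>k i z. k < n \<Longrightarrow> i < n \<Longrightarrow> z \<in> \<Omega> \<Longrightarrow> norm (L k i z) \<le> CL" by blast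
  define CV where "CV = 1 + r ^ l * CL"
  have Vbd: "norm (V x k z) \<le> CV * w x" if x: "x \<in> X" and k: "k < n" and z: "z \<in> \<Omega>" for x k z
  proof -
    obtain i j where ij: "x = (i, j)" "i < n" using x by (auto simp: X_def)
    have wx: "w x = r ^ nat \<bar>j\<bar>" by (simp add: w_def ij)
    have CV: "1 \<le> CV" using CL(1) r by (simp add: CV_def)
    show ?thesis
    proof (cases "j < - int s")
      case True
      \<comment> \<open>The inner radius |q|/r of \<open>\<Omega>\<close> is what gives |q|/|z| < r,
        so that the powers with negative exponent are bounded by the weight.\<close>
      have zp: "norm q / r < norm z" "norm z > 0" using z \<Omega>0 by (auto simp: \<Omega>_def annulus_def)
      have "norm (V x k z) \<le> norm ((z / q) powi j)" using True by (simp add: V_def ij)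
      also have "\<dots> = (norm q / norm z) ^ nat \<bar>j\<bar>"
        using True zp q by (simp add: power_int_def norm_power norm_divide norm_inverse power_divide power_inverse)
      also have "\<dots> \<le> r ^ nat \<bar>j\<bar>" using zp r by (intro power_mono) (auto simp: field_simps)
      also have "\<dots> \<le> CV * w x" using CV w0[of x] mult_right_mono[of 1 CV "w x"] by (simp add: wx)
      finally show ?thesis .
    next
      case False
      have "norm (z powi (int l + j)) = norm z ^ nat (int l + j)"
        using False by (simp add: l_def power_int_def norm_power)
      also have "\<dots> \<le> r ^ nat (int l + j)" using z by (intro power_mono) (auto simp: \<Omega>_def annulus_def)
      also have "\<dots> \<le> r ^ (l + nat \<bar>j\<bar>)" using r by (intro power_increasing) auto
      finally have "norm (z powi (int l + j)) \<le> r ^ l * w x" by (simp add: power_add wx)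
      hence "norm (V x k z) \<le> (r ^ l * w x) * CL"
        using False CL(2)[OF k ij(2) z] r w0[of x] unfolding V_def ij
        by (simp add: norm_mult) (intro mult_mono, auto simp: less_imp_le)
      also have "\<dots> \<le> CV * w x" using w0[of x] by (simp add: CV_def algebra_simps)
      finally show ?thesis .
    qed
  qed
  have Vhol: "V x k holomorphic_on \<Omega>" if "x \<in> X" "k < n" for x k
  proof -
    obtain i j where ij: "x = (i, j)" by (cases x)
    show ?thesis
    proof (cases "j < - int s")
      case True
      hence "V x k = (\<lambda>z. if k = i then (z / q) powi j else 0)" by (simp add: V_def ij)
      thus ?thesis using \<Omega>0 q by (cases "k = i") (auto intro!: holomorphic_intros)
    next
      case False
      hence "V x k = (\<lambda>z. - (z powi (int l + j) * L k i z))" by (simp add: V_def ij)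
      thus ?thesis using \<Omega>0 Lhol[of \<Omega>] by (auto intro!: holomorphic_intros)
    qed
  qed
  show ?thesis
  proof (rule that[of l])
    fix f :: "nat \<Rightarrow> complex \<Rightarrow> complex"
    assume f: "\<And>i. i < n \<Longrightarrow> f i holomorphic_on annulus (1/R) R"
    obtain CF where CF: "0 \<le> CF" "\<And>i j z. i < n \<Longrightarrow> j < n \<Longrightarrow> z \<in> annulus (1/r4) r4 \<Longrightarrow> norm (f i z) \<le> CF"
      using bounded_on_annulus_family[of n "\<lambda>i _. f i", OF f r4R r4(2)] by metis
    have "\<And>i j. i < n \<Longrightarrow> j < n \<Longrightarrow> f i holomorphic_on annulus (1/r4) r4"
      using f sub[of r4 R] rs by (force intro: holomorphic_on_subset)
    then obtain fc where fc: "\<And>i j t. i < n \<Longrightarrow> j < n \<Longrightarrow> norm (fc i j t) \<le> CF / r1 ^ nat \<bar>t\<bar>"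
      "\<And>i j z. i < n \<Longrightarrow> j < n \<Longrightarrow> z \<in> annulus (1/r1) r1 \<Longrightarrow> ((\<lambda>t. fc i j t * z powi t) has_sum f i z) UNIV"
      using laurent_expansion_annulus_family[of n "\<lambda>i _. f i" r4 r1 CF] CF(2) rs by (smt (verit))
    \<comment> \<open>The second index of \<open>fc\<close> is a dummy; taking it equal to
      \<open>i\<close> keeps it below \<open>n\<close>.\<close>
    define c where "c = (\<lambda>(i, t). fc i i t)"
    have "(\<lambda>(i, t). norm (c (i, t)) * r ^ nat \<bar>t\<bar>) summable_on X"
      unfolding X_def
    proof (rule summable_on_times_finite(1)[OF _ _ geo[of CF 0]])
      fix i t assume "i < n"
      hence "norm (c (i, t)) * r ^ nat \<bar>t\<bar> \<le> CF / r1 ^ nat \<bar>t\<bar> * r ^ nat \<bar>t\<bar>"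
        using fc(1) r by (intro mult_right_mono) (auto simp: c_def)
      thus "norm (c (i, t)) * r ^ nat \<bar>t\<bar> \<le> CF * (r / r1) ^ nat \<bar>t + 0\<bar>" by (simp add: power_divide)
    qed (use r in auto)
    hence csum: "(\<lambda>x. norm (c x) * w x) summable_on X" by (simp add: w_def case_prod_unfold)
    obtain C where C: "(\<lambda>x. norm (C x) * w x) summable_on X"
      "\<And>y. y \<in> X \<Longrightarrow> C y = c y + (\<Sum>\<^sub>\<infinity>x\<in>X. C x * e x y)"
      using l1_neumann[OF csum ebd _ _ w0] by auto
    \<comment> \<open>Applying T to this combination gives the series with coefficients C - C e, and
      \<open>C\<close> was chosen so that these are the coefficients \<open>c\<close> of the
      right-hand side.\<close>
    define W where "W = (\<lambda>k z. \<Sum>\<^sub>\<infinity>x\<in>X. C x * V x k z)"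
    have CVbd: "norm (C x * V x k z) \<le> CV * (norm (C x) * w x)" if "x \<in> X" "k < n" "z \<in> \<Omega>" for x k z
      using mult_left_mono[OF Vbd[OF that], of "norm (C x)"] by (simp add: norm_mult mult_ac)
    have CVsum: "(\<lambda>x. CV * (norm (C x) * w x)) summable_on X" using C(1) by (rule summable_on_cmult_right)
    have Whol: "W k holomorphic_on \<Omega>" if "k < n" for k
      unfolding W_def
      by (rule holomorphic_on_infsum[where M = "\<lambda>x. CV * (norm (C x) * w x)"])
         (use that CVbd CVsum Vhol in \<open>auto intro!: holomorphic_intros simp: \<Omega>_def\<close>)
    have Wsum: "((\<lambda>x. C x * V x k z) has_sum W k z) X" if "k < n" "z \<in> \<Omega>" for k z
      unfolding W_def
      by (intro has_sum_infsum abs_summable_summable[OF summable_on_comparison_test[OF CVsum CVbd]])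
         (use that in auto)
    have eq: "W k (q * z) - (\<Sum>m<n. A k m z * W m z) / z ^ l = f k z" if k: "k < n" and z: "z \<in> annulus (1/r) r" for k z
    proof -
      have z1: "z \<in> annulus (1/r1) r1" using z sub[of r r1] rs by auto
      have z0: "z \<noteq> 0" using z r by (auto simp: annulus_def)
      have zz: "1/r < norm z" "norm z < r" using z by (auto simp: annulus_def)
      have "norm q / r < 1 / r" using q1 r by (intro divide_strict_right_mono) auto
      hence z\<Omega>: "z \<in> \<Omega>" using zz by (simp add: \<Omega>_def annulus_def)
      have "norm q * norm z < 1 * r" using zz q1 by (intro mult_strict_mono) auto
      moreover have "norm q * (1 / r) < norm q * norm z" using zz q by (intro mult_strict_left_mono) auto
      ultimately have qz: "q * z \<in> \<Omega>" by (simp add: \<Omega>_def annulus_def norm_mult)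
      have "((\<lambda>x. C x * V x k (q * z) - (\<Sum>m<n. A k m z * (C x * V x m z)) * (1 / z ^ l)) has_sum
          (W k (q * z) - (\<Sum>m<n. A k m z * W m z) * (1 / z ^ l))) X"
        using k z\<Omega> qz by (intro has_sum_diff has_sum_cmult_left has_sum_sum has_sum_cmult_right Wsum) auto
      moreover have "C x * V x k (q * z) - (\<Sum>m<n. A k m z * (C x * V x m z)) * (1 / z ^ l) = C x * bas x k z - C x * E x k z"
        if "x \<in> X" for x
      proof -
        have "(\<Sum>m<n. A k m z * (C x * V x m z)) = C x * (\<Sum>m<n. A k m z * V x m z)"
          by (simp add: sum_distrib_left mult_ac)
        hence "C x * V x k (q * z) - (\<Sum>m<n. A k m z * (C x * V x m z)) * (1 / z ^ l) =
           C x * (V x k (q * z) - (\<Sum>m<n. A k m z * V x m z) / z ^ l)"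
          by (simp add: right_diff_distrib)
        thus ?thesis unfolding Vfun[OF that k z0] by (simp add: right_diff_distrib)
      qed
      ultimately have S1: "((\<lambda>x. C x * bas x k z - C x * E x k z) has_sum
          (W k (q * z) - (\<Sum>m<n. A k m z * W m z) * (1 / z ^ l))) X"
        by (simp cong: has_sum_cong)
      have zw: "norm (z powi t) \<le> w (k, t)" for t
        using norm_powi_annulus[OF z r(1)] by (simp add: w_def)
      have "(\<lambda>t. norm (C (k, t)) * w (k, t)) summable_on UNIV"
        using C(1) k unfolding X_def
        by (intro summable_on_SigmaD1[of "\<lambda>k t. norm (C (k, t)) * w (k, t)" "{..<n}" "\<lambda>_. UNIV"]) (auto simp: case_prod_unfold)
      hence "(\<lambda>t. norm (C (k, t) * z powi t)) summable_on UNIV"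
        by (rule summable_on_comparison_test) (auto simp: norm_mult intro!: mult_left_mono zw)
      hence "(\<lambda>t. C (k, t) * z powi t) summable_on UNIV" by (rule abs_summable_summable)
      then obtain S where S: "((\<lambda>t. C (k, t) * z powi t) has_sum S) UNIV" by (auto simp: summable_on_def)
      have S2: "((\<lambda>x. C x * bas x k z) has_sum S) X"
      proof -
        have "((\<lambda>x. C x * bas x k z) has_sum S) (range (Pair k))"
          using S by (subst has_sum_reindex) (auto simp: inj_on_def o_def bas_def)
        also have "?this \<longleftrightarrow> ((\<lambda>x. C x * bas x k z) has_sum S) X"
          using k by (intro has_sum_cong_neutral) (auto simp: X_def bas_def image_iff split: if_splits)
        finally show ?thesis .
      qed
      have S3: "((\<lambda>x. C x * E x k z) has_sum (S - (W k (q * z) - (\<Sum>m<n. A k m z * W m z) * (1 / z ^ l)))) X"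
        using has_sum_diff[OF S2 S1] by simp
      have kt: "(\<lambda>t. norm (e x (k, t)) * w (k, t)) summable_on UNIV"
        "(\<Sum>\<^sub>\<infinity>t. norm (e x (k, t)) * w (k, t)) \<le> 1/2 * w x" if x: "x \<in> X" for x
      proof -
        show 1: "(\<lambda>t. norm (e x (k, t)) * w (k, t)) summable_on UNIV"
          using ebd(1)[OF x] k unfolding X_def
          by (intro summable_on_SigmaD1[of "\<lambda>k t. norm (e x (k, t)) * w (k, t)" "{..<n}" "\<lambda>_. UNIV"]) (auto simp: case_prod_unfold)
        have "(\<Sum>\<^sub>\<infinity>t. norm (e x (k, t)) * w (k, t)) = (\<Sum>\<^sub>\<infinity>y\<in>range (Pair k). norm (e x y) * w y)"
          by (subst infsum_reindex) (auto simp: inj_on_def o_def)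
        also have "\<dots> \<le> (\<Sum>\<^sub>\<infinity>y\<in>X. norm (e x y) * w y)"
          using k ebd(1)[OF x] w0
          by (intro infsum_mono2 summable_on_subset_banach[OF ebd(1)[OF x]])
             (auto simp: X_def less_imp_le)
        also note ebd(2)[OF x]
        finally show "(\<Sum>\<^sub>\<infinity>t. norm (e x (k, t)) * w (k, t)) \<le> 1/2 * w x" .
      qed
      have "(\<lambda>(x, t). norm (C x * e x (k, t)) * w (k, t)) summable_on X \<times> UNIV"
        by (rule l1_kernel(1)[OF C(1) kt less_imp_le[OF w0]])
      hence "(\<lambda>z'. norm (case z' of (x, t) \<Rightarrow> C x * e x (k, t) * z powi t)) summable_on X \<times> UNIV"
        by (rule summable_on_comparison_test) (auto simp: norm_mult intro!: mult_left_mono zw)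
      hence dbl: "(\<lambda>(x, t). C x * e x (k, t) * z powi t) summable_on X \<times> UNIV"
        by (rule abs_summable_summable)
      \<comment> \<open>S - f is computed twice. By the fixed-point equation for \<open>C\<close> it
        is the series with coefficients C e, hence, after interchanging the sums, the sum of
        \<open>C x * E x k z\<close>; by \<open>S3\<close> that sum is S - T W. Cancelling S gives T
        W = f.\<close>
      have "((\<lambda>t. (C (k, t) - c (k, t)) * z powi t) has_sum (S - f k z)) UNIV"
        using has_sum_diff[OF S fc(2)[OF k k z1]] by (simp add: c_def left_diff_distrib)
      also have "(\<lambda>t. (C (k, t) - c (k, t)) * z powi t) = (\<lambda>t. \<Sum>\<^sub>\<infinity>x\<in>X. C x * e x (k, t) * z powi t)"
      proof
        fix t
        have kX: "(k, t) \<in> X" using k by (simp add: X_def)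
        have s: "(\<lambda>x. C x * e x (k, t)) summable_on X"
          by (rule abs_summable_summable[OF l1_kernel_image(1)[OF C(1) ebd w0 kX]])
        show "(C (k, t) - c (k, t)) * z powi t = (\<Sum>\<^sub>\<infinity>x\<in>X. C x * e x (k, t) * z powi t)"
          using C(2)[OF kX] infsum_cmult_left[OF s, of "z powi t"] by simp
      qed
      finally have "S - f k z = (\<Sum>\<^sub>\<infinity>t. \<Sum>\<^sub>\<infinity>x\<in>X. C x * e x (k, t) * z powi t)"
        by (simp add: infsumI)
      also have "\<dots> = (\<Sum>\<^sub>\<infinity>x\<in>X. \<Sum>\<^sub>\<infinity>t. C x * e x (k, t) * z powi t)"
        using infsum_swap_banach[OF dbl] by simp
      also have "\<dots> = (\<Sum>\<^sub>\<infinity>x\<in>X. C x * E x k z)"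
      proof (rule infsum_cong)
        fix x assume "x \<in> X"
        from has_sum_cmult_right[OF Esum[OF this k z], of "C x"]
        show "(\<Sum>\<^sub>\<infinity>t. C x * e x (k, t) * z powi t) = C x * E x k z"
          by (simp add: infsumI mult.assoc)
      qed
      also have "\<dots> = S - (W k (q * z) - (\<Sum>m<n. A k m z * W m z) * (1 / z ^ l))"
        using S3 by (rule infsumI)
      finally have "S - f k z = S - (W k (q * z) - (\<Sum>m<n. A k m z * W m z) * (1 / z ^ l))" .
      moreover have "x = y" if "S - x = S - y" for x y using that by simp
      ultimately have "f k z = W k (q * z) - (\<Sum>m<n. A k m z * W m z) * (1 / z ^ l)" by blast
      thus ?thesis by simp
    qed
    show "\<exists>w. (\<forall>i<n. w i holomorphic_on annulus (norm q / r) r) \<and>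
           (\<forall>i<n. \<forall>z\<in>annulus (1/r) r. w i (q * z) - (\<Sum>k<n. A i k z * w k z) / z ^ l = f i z)"
      using Whol eq by (intro exI[of _ W]) (auto simp: \<Omega>_def)
  qed
qed


section \<open>A theta function\<close>


text \<open>The determinant is a polynomial in the entries. This is used for the leading term at the
  pole in \<open>det_simple_pole_nonzero\<close>.\<close>

lemma tendsto_det_mat:
  fixes f :: "nat \<Rightarrow> nat \<Rightarrow> 'a \<Rightarrow> 'b :: {real_normed_algebra_1, comm_ring_1}"
  assumes "\<And>i j. i < n \<Longrightarrow> j < n \<Longrightarrow> (f i j \<longlongrightarrow> c i j) F"
  shows "((\<lambda>z. Determinant.det (mat n n (\<lambda>(i, j). f i j z))) \<longlongrightarrow> Determinant.det (mat n n (\<lambda>(i, j). c i j))) F"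
proof -
  have det: "Determinant.det (mat n n (\<lambda>(i, j). g i j)) =
      (\<Sum>p | p permutes {0..<n}. signof p * (\<Prod>i = 0..<n. g i (p i)))" for g :: "nat \<Rightarrow> nat \<Rightarrow> 'b"
    by (subst det_def'[of _ n]) (auto intro!: sum.cong prod.cong simp: permutes_in_image)
  show ?thesis unfolding det
    by (intro tendsto_intros assms) (auto simp: permutes_in_image)
qed

text \<open>Up to a constant factor this is the product form of Jacobi's theta function. For
  \<phi>(z), the product of all 1 + q^n z, one has \<phi>(z) = (1 + z) \<phi>(qz), and \<theta>(z) =
  \<phi>(z) \<phi>(q/z). Zeros are sparse because \<phi>(0) = 1. The (-l)-th power of \<theta>
  acquires the factor z^l under z -> qz.\<close>

lemma q_theta_function:
  fixes q :: complex
  assumes q: "q \<noteq> 0" "norm q < 1"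
  obtains \<theta> where "\<theta> holomorphic_on - {0}" "\<And>z. z \<noteq> 0 \<Longrightarrow> \<theta> (q * z) = \<theta> z / z"
    "\<forall>\<^sub>\<approx>z\<in>- {0}. \<theta> z \<noteq> 0"
proof -
  define P where "P = (\<lambda>N z. \<Prod>n<N. 1 + q ^ n * z)"
  have conv: "uniformly_convergent_on (cball 0 r) P" for r :: real
    unfolding P_def
  proof (rule uniformly_convergent_on_prod)
    show "uniformly_convergent_on (cball 0 r) (\<lambda>N x. \<Sum>n<N. norm (q ^ n * x))"
    proof (rule Weierstrass_m_test')
      show "summable (\<lambda>n. norm q ^ n * r)" using q by (intro summable_mult2 summable_geometric) auto
      show "norm (norm (q ^ n * x)) \<le> norm q ^ n * r" if "x \<in> cball 0 r" for n x
        using that by (simp add: norm_mult norm_power mult_left_mono)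
    qed
  qed (auto intro!: continuous_intros)
  define \<phi> where "\<phi> = (\<lambda>z. lim (\<lambda>N. P N z))"
  have ul: "uniform_limit (cball 0 r) P \<phi> sequentially" for r
    using conv[of r] unfolding \<phi>_def by (simp add: uniformly_convergent_uniform_limit_iff)
  have lim: "(\<lambda>N. P N z) \<longlonglongrightarrow> \<phi> z" for z
    by (rule tendsto_uniform_limitI[OF ul[of "norm z"]]) auto
  have hol: "\<phi> holomorphic_on UNIV"
  proof (rule holomorphic_uniform_sequence[where f = P])
    show "P N holomorphic_on UNIV" for N unfolding P_def by (intro holomorphic_intros)
    fix x :: complex
    have "cball x 1 \<subseteq> cball 0 (norm x + 1)" by (auto simp: dist_norm) (smt (verit) norm_triangle_ineq2 norm_minus_commute)
    thus "\<exists>d>0. cball x d \<subseteq> UNIV \<and> uniform_limit (cball x d) P \<phi> sequentially"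
      using uniform_limit_on_subset[OF ul] by (intro exI[of _ 1]) auto
  qed auto
  have rec: "\<phi> z = (1 + z) * \<phi> (q * z)" for z
  proof (rule LIMSEQ_unique)
    show "(\<lambda>N. P (Suc N) z) \<longlonglongrightarrow> \<phi> z" using lim[of z] by (rule LIMSEQ_Suc)
    have "P (Suc N) z = (1 + z) * P N (q * z)" for N
      unfolding P_def prod.lessThan_Suc_shift by (simp add: mult_ac)
    thus "(\<lambda>N. P (Suc N) z) \<longlonglongrightarrow> (1 + z) * \<phi> (q * z)" using lim[of "q * z"] by (simp add: tendsto_mult_left)
  qed
  have \<phi>0: "\<phi> 0 = 1" using lim[of 0] LIMSEQ_unique[of "\<lambda>N. P N 0"] by (simp add: P_def)
  have nz: "\<forall>\<^sub>\<approx>z\<in>UNIV. \<phi> z \<noteq> 0"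
  proof -
    have "\<phi> meromorphic_on UNIV"
      using hol by (intro analytic_on_imp_meromorphic_on) (simp add: analytic_on_open)
    from meromorphic_imp_constant_or_avoid[OF this open_UNIV connected_UNIV, of 0]
    have "(\<forall>\<^sub>\<approx>z\<in>UNIV. \<phi> z = 0) \<or> (\<forall>\<^sub>\<approx>z\<in>UNIV. \<phi> z \<noteq> 0)" .
    moreover have "\<not> (\<forall>\<^sub>\<approx>z\<in>UNIV. \<phi> z = 0)"
    proof
      assume "\<forall>\<^sub>\<approx>z\<in>UNIV. \<phi> z = 0"
      hence "\<forall>\<^sub>F z in at 0. \<phi> z = 0" by (simp add: eventually_cosparse_open_eq)
      moreover have "\<phi> \<midarrow>0\<rightarrow> \<phi> 0"
        using hol holomorphic_on_imp_continuous_on continuous_on_eq_continuous_at[of UNIV \<phi>] isContD by blast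
      ultimately have "\<phi> 0 = 0" by (intro tendsto_unique[OF _ _ tendsto_eventually]) auto
      thus False using \<phi>0 by simp
    qed
    ultimately show ?thesis by blast
  qed
  have nz_at: "\<forall>\<^sub>F z in at x. \<phi> z \<noteq> 0" for x
    using nz by (simp add: eventually_cosparse_open_eq)
  define \<theta> where "\<theta> = (\<lambda>z. \<phi> z * \<phi> (q / z))"
  show ?thesis
  proof (rule that[of \<theta>])
    have "\<phi> \<circ> (\<lambda>z. q / z) holomorphic_on - {0}"
      by (rule holomorphic_on_compose_gen[OF _ hol]) (auto intro!: holomorphic_intros)
    thus "\<theta> holomorphic_on - {0}"
      unfolding \<theta>_def using hol by (intro holomorphic_intros) (auto simp: o_def intro: holomorphic_on_subset)
    fix z :: complex assume z: "z \<noteq> 0"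
    have e: "\<phi> (q / (q * z)) = (1 + 1 / z) * \<phi> (q / z)" using rec[of "1 / z"] q by simp
    have "\<theta> (q * z) = \<phi> (q * z) * ((1 + 1 / z) * \<phi> (q / z))" unfolding \<theta>_def e ..
    also have "\<dots> = ((1 + z) * \<phi> (q * z)) * \<phi> (q / z) / z" using z by (simp add: field_simps)
    finally show "\<theta> (q * z) = \<theta> z / z" unfolding rec[of z, symmetric] by (simp add: \<theta>_def)
  next
    have "\<forall>\<^sub>F z in at x. \<theta> z \<noteq> 0" if x: "x \<noteq> 0" for x
    proof -
      have "filterlim (\<lambda>z. q / z) (at (q / x)) (at x)"
        using x q by (intro filterlim_atI tendsto_intros) (auto simp: eventually_at_filter field_simps intro!: always_eventually)
      hence "\<forall>\<^sub>F z in at x. \<phi> (q / z) \<noteq> 0" using nz_at[of "q / x"] by (auto simp: filterlim_iff)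
      with nz_at[of x] show ?thesis by eventually_elim (simp add: \<theta>_def)
    qed
    thus "\<forall>\<^sub>\<approx>z\<in>- {0}. \<theta> z \<noteq> 0" by (simp add: cosparse_punctured)
  qed
qed


section \<open>Extension by the functional equation\<close>


lemma mult_mat_meromorphic_on:
  assumes "\<And>z. M z \<in> carrier_mat n n" "\<And>z. N z \<in> carrier_mat n n"
    and "\<And>i j. i < n \<Longrightarrow> j < n \<Longrightarrow> (\<lambda>z. M z $$ (i, j)) meromorphic_on S"
    and "\<And>i j. i < n \<Longrightarrow> j < n \<Longrightarrow> (\<lambda>z. N z $$ (i, j)) meromorphic_on S"
    and ij: "i < n" "j < n"
  shows "(\<lambda>z. (M z * N z) $$ (i, j)) meromorphic_on S"
proof -
  have "(\<lambda>z. (M z * N z) $$ (i, j)) = (\<lambda>z. \<Sum>k = 0..<n. M z $$ (i, k) * N z $$ (k, j))"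
    using ij assms(1,2)[THEN carrier_matD(1)] assms(1,2)[THEN carrier_matD(2)]
    by (simp add: scalar_prod_def)
  thus ?thesis using ij assms(3,4) by (auto intro!: meromorphic_intros)
qed

lemma eventually_at_scale:
  fixes a x :: complex
  assumes "a \<noteq> 0" "\<forall>\<^sub>F z in at (a * x). P z"
  shows "\<forall>\<^sub>F z in at x. P (a * z)"
proof -
  have "filterlim (\<lambda>z. a * z) (at (a * x)) (at x)"
    using assms(1) by (intro filterlim_atI tendsto_intros) (auto simp: eventually_at_filter)
  thus ?thesis using assms(2) by (simp add: filterlim_iff)
qed

lemma meromorphic_on_scale:
  fixes a :: complex
  assumes "f meromorphic_on S" "\<And>z. z \<in> T \<Longrightarrow> a * z \<in> S"
  shows "(\<lambda>z. f (a * z)) meromorphic_on T"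
  by (rule meromorphic_on_compose[OF assms(1)]) (use assms(2) in \<open>auto intro!: analytic_intros\<close>)

text \<open>The set |q| < |z| <= 1 meets every orbit of multiplication by q off 0 exactly once, so
  the equation dictates the continuation. The only places to check are the circles on which some
  |q^k z| = 1, where neighbouring pieces meet; there \<open>M0e\<close> makes them agree. Literal
  equality with \<open>M0\<close> on the open annulus is exported in order to read off the
  determinant near a point.\<close>

lemma extend_q_difference_solution:
  fixes A N M0 :: "complex \<Rightarrow> complex mat" and q :: complex
  assumes A: "meromorphic_matrix n A" and N: "meromorphic_matrix n N"
    and AN: "\<forall>\<^sub>\<approx>z\<in>- {0}. N z * A z = 1\<^sub>m n \<and> A z * N z = 1\<^sub>m n"
    and q: "q \<noteq> 0" "norm q < 1" and r: "1 < r"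
    and M0c: "\<And>z. M0 z \<in> carrier_mat n n"
    and M0m: "\<And>i j. i < n \<Longrightarrow> j < n \<Longrightarrow> (\<lambda>z. M0 z $$ (i, j)) meromorphic_on annulus (norm q / r) r"
    and M0e: "\<And>x. x \<in> annulus (1/r) r \<Longrightarrow> \<forall>\<^sub>F z in at x. M0 (q * z) = A z * M0 z"
  obtains M where "meromorphic_matrix n M" "\<forall>\<^sub>\<approx>z\<in>- {0}. M (q * z) = A z * M z"
    "\<And>z. z \<in> annulus (norm q) 1 \<Longrightarrow> M z = M0 z"
proof -
  note cA = meromorphic_matrix_dims(3)[OF A] and cN = meromorphic_matrix_dims(3)[OF N]
  note as = assoc_mult_mat[where ?n\<^sub>1.0 = n and ?n\<^sub>2.0 = n and ?n\<^sub>3.0 = n and ?n\<^sub>4.0 = n]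
  have mA: "(\<lambda>z. A z $$ (i, j)) meromorphic_on - {0}" and mN: "(\<lambda>z. N z $$ (i, j)) meromorphic_on - {0}"
    if "i < n" "j < n" for i j using A N that by (auto simp: meromorphic_matrix_def)
  \<comment> \<open>\<open>Gp k\<close> transports \<open>M0\<close> back from q^k z through k
    factors \<open>N\<close>, and \<open>Gn k\<close> transports it forward from q^(-k) z through k
    factors \<open>A\<close>. Their union \<open>G k\<close> is the piece read off from q^k z for k
    of either sign.\<close>
  define Gp where "Gp = rec_nat M0 (\<lambda>_ g z. N z * g (q * z))"
  define Gn where "Gn = rec_nat M0 (\<lambda>_ g z. A (inverse q * z) * g (inverse q * z))"
  have Gp: "Gp 0 = M0" "\<And>k z. Gp (Suc k) z = N z * Gp k (q * z)" by (auto simp: Gp_def)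
  have Gn: "Gn 0 = M0" "\<And>k z. Gn (Suc k) z = A (inverse q * z) * Gn k (inverse q * z)" by (auto simp: Gn_def)
  have cGp: "Gp k z \<in> carrier_mat n n" for k z
    by (induction k arbitrary: z) (auto simp: Gp intro!: mult_carrier_mat M0c cN)
  have cGn: "Gn k z \<in> carrier_mat n n" for k z
    by (induction k arbitrary: z) (auto simp: Gn intro!: mult_carrier_mat M0c cA)
  define G where "G = (\<lambda>k::int. if k \<ge> 0 then Gp (nat k) else Gn (nat (-k)))"
  have cG: "G k z \<in> carrier_mat n n" for k z by (simp add: G_def cGp cGn)
  define \<Omega> where "\<Omega> = annulus (norm q / r) r"
  have \<Omega>0: "0 \<notin> \<Omega>" using r by (auto simp: \<Omega>_def annulus_def not_less)
  have mGp: "(\<lambda>z. Gp k z $$ (i, j)) meromorphic_on {z. q ^ k * z \<in> \<Omega>}" if "i < n" "j < n" for k i j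
    using that
  proof (induction k arbitrary: i j)
    case 0 thus ?case using M0m by (simp add: Gp \<Omega>_def)
  next
    case (Suc k)
    have sub: "{z. q ^ Suc k * z \<in> \<Omega>} \<subseteq> - {0}" using \<Omega>0 by auto
    show ?case unfolding Gp
    proof (rule mult_mat_meromorphic_on[OF cN cGp])
      fix i j assume ij: "i < n" "j < n"
      show "(\<lambda>z. N z $$ (i, j)) meromorphic_on {z. q ^ Suc k * z \<in> \<Omega>}"
        using mN[OF ij] sub by (rule meromorphic_on_subset)
      show "(\<lambda>z. Gp k (q * z) $$ (i, j)) meromorphic_on {z. q ^ Suc k * z \<in> \<Omega>}"
        by (rule meromorphic_on_scale[OF Suc.IH[OF ij]]) (auto simp: mult_ac)
    qed (use Suc.prems in auto)
  qed
  have mGn: "(\<lambda>z. Gn k z $$ (i, j)) meromorphic_on {z. inverse q ^ k * z \<in> \<Omega>}" if "i < n" "j < n" for k i j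
    using that
  proof (induction k arbitrary: i j)
    case 0 thus ?case using M0m by (simp add: Gn \<Omega>_def)
  next
    case (Suc k)
    have sub: "z \<in> {z. inverse q ^ Suc k * z \<in> \<Omega>} \<Longrightarrow> inverse q * z \<in> - {0}" for z using \<Omega>0 q by auto
    show ?case unfolding Gn
    proof (rule mult_mat_meromorphic_on[OF cA cGn])
      fix i j assume ij: "i < n" "j < n"
      show "(\<lambda>z. A (inverse q * z) $$ (i, j)) meromorphic_on {z. inverse q ^ Suc k * z \<in> \<Omega>}"
        by (rule meromorphic_on_scale[OF mA[OF ij] sub])
      show "(\<lambda>z. Gn k (inverse q * z) $$ (i, j)) meromorphic_on {z. inverse q ^ Suc k * z \<in> \<Omega>}"
        by (rule meromorphic_on_scale[OF Suc.IH[OF ij]]) (auto simp: mult_ac)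
    qed (use Suc.prems in auto)
  qed
  have mG: "(\<lambda>z. G k z $$ (i, j)) meromorphic_on {z. q powi k * z \<in> \<Omega>}" if "i < n" "j < n" for k i j
    using mGp[OF that, of "nat k"] mGn[OF that, of "nat (-k)"] by (auto simp: G_def power_int_def)
  have GS: "\<forall>\<^sub>\<approx>z\<in>- {0}. G k (q * z) = A z * G (k + 1) z" for k
  proof (cases "k \<ge> 0")
    case True
    hence "G (k + 1) z = N z * G k (q * z)" for z by (simp add: G_def nat_add_distrib Gp)
    moreover have "\<forall>\<^sub>\<approx>z\<in>- {0}. G k (q * z) = A z * (N z * G k (q * z))"
      using AN by eventually_elim (metis as cA cG cN left_mult_one_mat)
    ultimately show ?thesis by simp
  next
    case False
    hence k: "nat (-k) = Suc (nat (-(k+1)))" by simp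
    have "G k (q * z) = A z * G (k + 1) z" for z
    proof -
      have "inverse q * (q * z) = z" using q by (simp add: field_simps)
      hence "G k (q * z) = A z * Gn (nat (-(k+1))) z" using False by (simp only: G_def k Gn if_False)
      thus ?thesis using False by (auto simp: G_def Gp Gn)
    qed
    thus ?thesis by simp
  qed
  have at1: "\<forall>\<^sub>F z in at x. P z" if "\<forall>\<^sub>\<approx>z\<in>- {0}. P z" "x \<noteq> 0" for P and x :: complex
    using that by (simp add: cosparse_punctured)
  have ann0: "x \<noteq> 0" if "c * x \<in> annulus (1/r) r" for c x :: complex
    using that r by (auto simp: annulus_def)
  have Gp_glue: "\<forall>\<^sub>F z in at x. Gp (Suc k) z = Gp k z" if "q ^ k * x \<in> annulus (1/r) r" for k x
    using that
  proof (induction k arbitrary: x)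
    case 0
    have "x \<noteq> 0" using ann0[of 1 x] 0 by simp
    from at1[OF AN this] M0e[of x] 0 have "\<forall>\<^sub>F z in at x. (N z * A z = 1\<^sub>m n \<and> A z * N z = 1\<^sub>m n) \<and> M0 (q * z) = A z * M0 z"
      by (simp add: eventually_conj_iff)
    thus ?case
    proof eventually_elim
      case (elim z)
      have "N z * (A z * M0 z) = (N z * A z) * M0 z" by (simp add: as[OF cN cA M0c])
      thus ?case using elim left_mult_one_mat[OF M0c] by (simp add: Gp)
    qed
  next
    case (Suc k)
    have "\<forall>\<^sub>F z in at (q * x). Gp (Suc k) z = Gp k z"
      using Suc.prems by (intro Suc.IH) (simp add: mult_ac)
    from eventually_at_scale[OF q(1) this] show ?case
      by eventually_elim (simp add: Gp(2)[of "Suc k"] Gp(2)[of k])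
  qed
  have Gn_glue: "\<forall>\<^sub>F z in at x. Gn (Suc k) z = Gn k z" if "inverse q ^ Suc k * x \<in> annulus (1/r) r" for k x
    using that
  proof (induction k arbitrary: x)
    case 0
    have E: "\<forall>\<^sub>F z in at (inverse q * x). M0 (q * z) = A z * M0 z" using 0 by (intro M0e) simp
    have c: "q * (inverse q * z) = z" for z using q by (simp add: field_simps)
    have "inverse q \<noteq> 0" using q by simp
    from eventually_at_scale[OF this E] show ?case
      unfolding c by (rule eventually_mono) (simp only: Gn)
  next
    case (Suc k)
    have "\<forall>\<^sub>F z in at (inverse q * x). Gn (Suc k) z = Gn k z"
      using Suc.prems by (intro Suc.IH) (simp add: mult_ac)
    from eventually_at_scale[OF _ this] show ?case using q
      by (auto simp: Gn(2)[of "Suc k"] Gn(2)[of k] elim!: eventually_mono)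
  qed
  have glue: "\<forall>\<^sub>F z in at x. G (k + 1) z = G k z" if "q powi k * x \<in> annulus (1/r) r" for k x
  proof (cases "k \<ge> 0")
    case True
    thus ?thesis using Gp_glue[of "nat k" x] that
      by (simp add: G_def nat_add_distrib power_int_def)
  next
    case False
    hence k: "nat (-k) = Suc (nat (-(k+1)))" by simp
    have "\<forall>\<^sub>F z in at x. Gn (nat (-k)) z = Gn (nat (-(k+1))) z"
      unfolding k using that False by (intro Gn_glue) (simp add: power_int_def k)
    thus ?thesis using False by (auto simp: G_def Gp Gn elim!: eventually_mono)
  qed
  \<comment> \<open>\<open>h\<close> is the logarithm of |z| to the base 1/|q|, so that
    \<open>kk z\<close> is the integer k with |q| < |q^k z| <= 1 and \<open>G (kk z)\<close> uses
    \<open>M0\<close> inside its domain.\<close>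
  define h where "h = (\<lambda>z :: complex. ln (norm z) / (- ln (norm q)))"
  define kk where "kk = (\<lambda>z. \<lceil>h z\<rceil>)"
  have lnq: "ln (norm q) < 0" using q by simp
  have norm_powi: "norm (q powi k * z) = exp ((of_int k - h z) * ln (norm q))" if z: "z \<noteq> 0" for k z
  proof -
    have "norm (q powi k) = norm q powr of_int k" using q by (simp add: norm_power_int powr_real_of_int')
    hence "norm (q powi k * z) = exp (of_int k * ln (norm q)) * exp (ln (norm z))"
      using q z by (simp add: norm_mult powr_def)
    also have "\<dots> = exp ((of_int k - h z) * ln (norm q))"
      using lnq by (simp add: h_def exp_add[symmetric] distrib_right left_diff_distrib)
    finally show ?thesis .
  qed
  have hq: "h (q * z) = h z - 1" if "z \<noteq> 0" for z
    using q that lnq by (simp add: h_def norm_mult ln_mult field_simps)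
  have kkq: "kk (q * z) = kk z - 1" if "z \<noteq> 0" for z using hq[OF that] by (simp add: kk_def)
  define M where "M = (\<lambda>z. G (kk z) z)"
  \<comment> \<open>Near \<open>x\<close> the ceiling takes only the values \<open>kk x\<close> and
    \<open>kk x + 1\<close>, and the second only if \<open>h x\<close> is an integer. In that case
    |q^k x| = 1 for k = \<open>kk x\<close>, and \<open>glue\<close> identifies the two
    pieces.\<close>
  have loc: "\<forall>\<^sub>F z in at x. M z = G (kk x) z" if x: "x \<noteq> 0" for x
  proof -
    have cont: "(h \<longlongrightarrow> h x) (at x)" unfolding h_def using x lnq by (intro tendsto_intros) auto
    have b: "of_int (kk x) - 1 < h x" "h x \<le> of_int (kk x)" unfolding kk_def by linarith+
    have "\<forall>\<^sub>F z in at x. of_int (kk x) - 1 < h z" "\<forall>\<^sub>F z in at x. h z < of_int (kk x) + 1"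
      using order_tendstoD[OF cont] b by auto
    hence two: "\<forall>\<^sub>F z in at x. kk z = kk x \<or> kk z = kk x + 1"
    proof eventually_elim
      case (elim z)
      thus ?case unfolding kk_def[of] by (simp add: ceiling_eq_iff) linarith
    qed
    show ?thesis
    proof (cases "h x = of_int (kk x)")
      case True
      have "q powi kk x * x \<in> annulus (1/r) r"
        using norm_powi[OF x, of "kk x"] True r by (simp add: annulus_def)
      from glue[OF this] two show ?thesis by eventually_elim (auto simp: M_def)
    next
      case False
      hence "\<forall>\<^sub>F z in at x. h z < of_int (kk x)" using order_tendstoD[OF cont] b by auto
      with two show ?thesis
      proof eventually_elim
        case (elim z)
        have "kk z \<le> kk x" using elim(2) unfolding kk_def[of] by (simp add: ceiling_le_iff)
        thus ?case using elim by (auto simp: M_def)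
      qed
    qed
  qed
  show ?thesis
  proof (rule that[of M])
    show "meromorphic_matrix n M" unfolding meromorphic_matrix_def
    proof (intro conjI allI impI)
      show "M z \<in> carrier_mat n n" for z by (simp add: M_def cG)
      fix i j assume ij: "i < n" "j < n"
      have "(\<lambda>z. M z $$ (i, j)) meromorphic_on {x}" if x: "x \<in> - {0}" for x
      proof -
        have x0: "x \<noteq> 0" using x by simp
        have "h x \<le> of_int (kk x)" "of_int (kk x) < h x + 1" unfolding kk_def by linarith+
        hence "(of_int (kk x) - h x) * ln (norm q) \<le> 0" "ln (norm q) < (of_int (kk x) - h x) * ln (norm q)"
          using lnq mult_strict_right_mono_neg[of "of_int (kk x) - h x" 1 "ln (norm q)"]
          by (auto simp: mult_nonneg_nonpos)
        hence "norm (q powi kk x * x) \<le> 1" "norm q < norm (q powi kk x * x)"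
          unfolding norm_powi[OF x0] using q by (simp_all only: exp_le_one_iff) (metis exp_less_cancel_iff exp_ln zero_less_norm_iff)
        moreover have "norm q / r < norm q" using q r by (simp add: field_simps)
        ultimately have "q powi kk x * x \<in> \<Omega>"
          using r by (simp add: \<Omega>_def annulus_def)
        hence "(\<lambda>z. G (kk x) z $$ (i, j)) meromorphic_on {x}"
          by (intro meromorphic_on_subset[OF mG[OF ij]]) auto
        moreover have "\<forall>\<^sub>F z in at x. M z $$ (i, j) = G (kk x) z $$ (i, j)"
          using loc[OF x0] by eventually_elim simp
        ultimately show ?thesis
          using meromorphic_on_cong[of "{x}" "\<lambda>z. M z $$ (i, j)" "\<lambda>z. G (kk x) z $$ (i, j)" "{x}"] by simp
      qed
      thus "(\<lambda>z. M z $$ (i, j)) meromorphic_on - {0}"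
        using meromorphic_on_def by (metis insertI1 singletonD)
    qed
    have "\<forall>\<^sub>F z in at x. M (q * z) = A z * M z" if x: "x \<noteq> 0" for x
    proof -
      have qx: "q * x \<noteq> 0" using q x by simp
      from eventually_at_scale[OF q(1) loc[OF qx]] loc[OF x] at1[OF GS[of "kk x - 1"] x]
      show ?thesis by eventually_elim (simp add: kkq[OF x])
    qed
    thus "\<forall>\<^sub>\<approx>z\<in>- {0}. M (q * z) = A z * M z" by (simp add: cosparse_punctured)
    fix z assume z: "z \<in> annulus (norm q) 1"
    have z0: "norm z > 0" using z q by (auto simp: annulus_def) 
    have "ln (norm q) < ln (norm z)" "ln (norm z) < 0" using z z0 q by (auto simp: annulus_def)
    hence "- 1 < h z" "h z < 0" using lnq by (auto simp: h_def field_simps)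
    hence "kk z = 0" unfolding kk_def by (simp add: ceiling_eq_iff)
    thus "M z = M0 z" by (simp add: M_def G_def Gp)
  qed
qed


section \<open>Existence of fundamental matrices\<close>


text \<open>Column j is the j-th basis vector divided by z - a, plus a holomorphic correction. All
  columns share the pole and the twist, so together they form one matrix solution.\<close>

lemma annulus_solution:
  fixes A N :: "nat \<Rightarrow> nat \<Rightarrow> complex \<Rightarrow> complex" and q :: complex
  assumes A: "\<And>i j. i < n \<Longrightarrow> j < n \<Longrightarrow> A i j holomorphic_on annulus (1/R) R"
    and N: "\<And>i j. i < n \<Longrightarrow> j < n \<Longrightarrow> N i j holomorphic_on annulus (1/R) R"
    and AN: "\<And>i j z. i < n \<Longrightarrow> j < n \<Longrightarrow> z \<in> annulus (1/R) R \<Longrightarrow>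
               (\<Sum>k<n. A i k z * N k j z) = (if i = j then 1 else 0)"
    and R: "1 < R" and q: "q \<noteq> 0" "norm q < 1"
  obtains r l a W where "1 < r" "r \<le> R" "a \<in> annulus (norm q) 1"
    "\<And>i j. i < n \<Longrightarrow> j < n \<Longrightarrow> W i j holomorphic_on annulus (norm q / r) r"
    "\<And>i j z. i < n \<Longrightarrow> j < n \<Longrightarrow> z \<in> annulus (1/r) r \<Longrightarrow>
       (if i = j then 1 / (q * z - a) else 0) + W i j (q * z) =
       (\<Sum>k<n. A i k z * ((if k = j then 1 / (z - a) else 0) + W k j z)) / z ^ l"
proof -
  \<comment> \<open>The pole is put at the geometric mean of the radii |q| and 1. As R0 <
    1/\<alpha>, the annulus around the unit circle contains neither a nor a/q, so T applied to the
    polar part is holomorphic on it; the same inequality yields |q| r^2 < 1.\<close>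
  define \<alpha> where "\<alpha> = sqrt (norm q)"
  have \<alpha>: "0 < \<alpha>" "\<alpha> < 1" "norm q = \<alpha>\<^sup>2" using q by (auto simp: \<alpha>_def)
  have "1 < min R (1 / \<alpha>)" using R \<alpha> by simp
  then obtain R0 where R0: "1 < R0" "R0 < min R (1 / \<alpha>)" using dense by blast
  then obtain r where r: "1 < r" "r < R0" using dense by blast
  have aR0: "\<alpha> * R0 < 1" using R0(2) \<alpha> by (simp add: field_simps)
  define a where "a = complex_of_real \<alpha>"
  have na: "norm a = \<alpha>" using \<alpha> by (simp add: a_def)
  have qr: "norm q * r\<^sup>2 < 1"
  proof -
    have "\<alpha> * r < 1" using aR0 r \<alpha> mult_strict_left_mono[of r R0 \<alpha>] by linarith
    hence "(\<alpha> * r)\<^sup>2 < 1" using \<alpha> r by (intro power_less_one_iff[THEN iffD2]) (auto simp: less_imp_le)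
    thus ?thesis by (simp add: \<alpha>(3) power_mult_distrib)
  qed
  have sub: "annulus (1/R0) R0 \<subseteq> annulus (1/R) R"
    using R0 by (intro annulus_mono divide_left_mono) auto
  have away: "z \<noteq> a" "q * z \<noteq> a" "z \<noteq> 0" if "z \<in> annulus (1/R0) R0" for z
  proof -
    have z: "1/R0 < norm z" "norm z < R0" using that by (auto simp: annulus_def)
    have "\<alpha> < 1/R0" using aR0 R0 by (simp add: field_simps)
    thus "z \<noteq> a" using z na by auto
    have "norm (q * z) = \<alpha> * (\<alpha> * norm z)" using \<alpha>(3) by (simp add: norm_mult power2_eq_square)
    also have "\<dots> < \<alpha> * 1"
    proof (rule mult_strict_left_mono)
      show "\<alpha> * norm z < 1" using mult_strict_left_mono[OF z(2) \<alpha>(1)] aR0 by linarith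
    qed fact
    finally show "q * z \<noteq> a" using na by auto
    have "0 < 1/R0" using R0 by simp
    thus "z \<noteq> 0" using z(1) by auto
  qed
  have A0: "A i j holomorphic_on annulus (1/R0) R0" and N0: "N i j holomorphic_on annulus (1/R0) R0"
    if "i < n" "j < n" for i j
    using A[OF that] N[OF that] sub holomorphic_on_subset by blast+
  have AN0: "(\<Sum>k<n. A i k z * N k j z) = (if i = j then 1 else 0)"
    if "i < n" "j < n" "z \<in> annulus (1/R0) R0" for i j z
    using AN[OF that(1,2)] sub that(3) by blast
  let ?Q = "\<lambda>l f. \<exists>w. (\<forall>i<n. w i holomorphic_on annulus (norm q / r) r) \<and>
           (\<forall>i<n. \<forall>z\<in>annulus (1/r) r. w i (q * z) - (\<Sum>k<n. A i k z * w k z) / z ^ l = f i z)"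
  have "\<exists>l::nat. \<forall>f. (\<forall>i<n. f i holomorphic_on annulus (1/R0) R0) \<longrightarrow> ?Q l f"
  proof (rule twisted_solvable[OF A0 N0 AN0 r q(1) qr])
    fix l :: nat
    assume *: "\<And>f. (\<And>i. i < n \<Longrightarrow> f i holomorphic_on annulus (1/R0) R0) \<Longrightarrow> ?Q l f"
    show ?thesis by (intro exI[of _ l] allI impI *) auto
  qed
  then obtain l where l: "\<And>f. (\<And>i. i < n \<Longrightarrow> f i holomorphic_on annulus (1/R0) R0) \<Longrightarrow> ?Q l f" by blast
  \<comment> \<open>Minus T applied to the polar part of a column. Here the column comes first:
    \<open>F j i\<close> and, below, \<open>w j i\<close> are the i-th components for column
    j.\<close>
  define F where "F = (\<lambda>j i z. A i j z * (1 / (z - a)) / z ^ l - (if i = j then 1 / (q * z - a) else 0))"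
  have "F j i holomorphic_on annulus (1/R0) R0" if "i < n" "j < n" for i j
    unfolding F_def using away A[OF that] sub
    by (cases "i = j") (auto intro!: holomorphic_intros intro: holomorphic_on_subset)
  hence "\<forall>j\<in>{..<n}. ?Q l (F j)"
    by (intro ballI l) auto
  from bchoice[OF this] obtain w where w': "\<forall>j\<in>{..<n}. (\<forall>i<n. w j i holomorphic_on annulus (norm q / r) r) \<and>
           (\<forall>i<n. \<forall>z\<in>annulus (1/r) r. w j i (q * z) - (\<Sum>k<n. A i k z * w j k z) / z ^ l = F j i z)"
    by blast
  have w: "\<And>i j. j < n \<Longrightarrow> i < n \<Longrightarrow> w j i holomorphic_on annulus (norm q / r) r"
    "\<And>i j z. j < n \<Longrightarrow> i < n \<Longrightarrow> z \<in> annulus (1/r) r \<Longrightarrow>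
       w j i (q * z) - (\<Sum>k<n. A i k z * w j k z) / z ^ l = F j i z"
    using w' by auto
  show ?thesis
  proof (rule that[of r a "\<lambda>i j. w j i" l])
    have "\<alpha>\<^sup>2 < \<alpha>" using \<alpha> by (simp add: power2_eq_square)
    thus "a \<in> annulus (norm q) 1" using \<alpha> na by (simp add: annulus_def)
    fix i j z assume ij: "i < n" "j < n" and z: "z \<in> annulus (1/r) r"
    have "(\<Sum>k<n. A i k z * ((if k = j then 1 / (z - a) else 0) + w j k z)) =
      (\<Sum>k<n. if k = j then A i j z * (1 / (z - a)) else 0) + (\<Sum>k<n. A i k z * w j k z)"
      unfolding sum.distrib[symmetric] by (intro sum.cong) (auto simp: distrib_left)
    also have "(\<Sum>k<n. if k = j then A i j z * (1 / (z - a)) else 0) = A i j z * (1 / (z - a))"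
      using ij by simp
    finally show "(if i = j then 1 / (q * z - a) else 0) + w j i (q * z) =
       (\<Sum>k<n. A i k z * ((if k = j then 1 / (z - a) else 0) + w j k z)) / z ^ l"
      using w(2)[OF ij(2,1) z, unfolded diff_eq_eq] by (simp add: F_def add_divide_distrib)
  qed (use r R0 w(1) in auto)
qed

text \<open>Multiplied by z - a the matrix tends to the identity at a, so its determinant cannot
  vanish near a.\<close>

lemma det_simple_pole_nonzero:
  fixes W :: "nat \<Rightarrow> nat \<Rightarrow> complex \<Rightarrow> complex"
  assumes W: "\<And>i j. i < n \<Longrightarrow> j < n \<Longrightarrow> W i j \<midarrow>a\<rightarrow> W i j a"
  shows "\<forall>\<^sub>F z in at a. Determinant.det (mat n n (\<lambda>(i, j). (if i = j then 1 / (z - a) else 0) + W i j z)) \<noteq> 0"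
proof -
  define g where "g = (\<lambda>z. Determinant.det (mat n n (\<lambda>(i, j). (if i = j then 1 else 0) + (z - a) * W i j z)))"
  have "(g \<longlongrightarrow> Determinant.det (mat n n (\<lambda>(i, j). (if i = j then 1 else 0) + (a - a) * W i j a))) (at a)"
    unfolding g_def by (intro tendsto_det_mat tendsto_intros W) auto
  also have "mat n n (\<lambda>(i, j). (if i = j then 1 else 0) + (a - a) * W i j a) = 1\<^sub>m n"
    by (intro eq_matI) auto
  finally have "(g \<longlongrightarrow> 1) (at a)" by simp
  hence "\<forall>\<^sub>F z in at a. g z \<noteq> 0" by (rule tendsto_imp_eventually_ne) simp
  moreover have "\<forall>\<^sub>F z in at a. z \<noteq> a" by (simp add: eventually_at_filter)
  ultimately show ?thesis
  proof eventually_elim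
    case (elim z)
    have "mat n n (\<lambda>(i, j). (if i = j then 1 / (z - a) else 0) + W i j z) =
       (1 / (z - a)) \<cdot>\<^sub>m mat n n (\<lambda>(i, j). (if i = j then 1 else 0) + (z - a) * W i j z)"
      using elim(2) by (intro eq_matI) (auto simp: field_simps)
    thus ?case using elim by (simp add: det_smult g_def)
  qed
qed

text \<open>The exceptional set is sparse, hence finite in the compact annulus 1 <= |z| <= 2. All
  but finitely many radii between 1 and 2 avoid it, and so do their neighbours.\<close>

lemma exists_good_circle:
  assumes "\<forall>\<^sub>\<approx>z\<in>- {0::complex}. P z"
  obtains \<rho> R :: real where "0 < \<rho>" "1 < R" "\<And>z. z \<in> annulus (1/R) R \<Longrightarrow> P (of_real \<rho> * z)"
proof -
  define K where "K = cball 0 2 - ball (0::complex) 1"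
  have "compact K" unfolding K_def by (intro compact_diff compact_cball open_ball)
  moreover have "{z. \<not> P z} sparse_in K"
  proof (rule sparse_in_subset)
    show "{z. \<not> P z} sparse_in - {0}" using assms by (simp add: eventually_cosparse)
    show "K \<subseteq> - {0}" by (auto simp: K_def)
  qed
  ultimately have fin: "finite (K \<inter> {z. \<not> P z})"
    by (rule sparse_in_compact_finite[rotated])
  define S where "S = {1<..<2} - norm ` (K \<inter> {z. \<not> P z})"
  have oS: "open S" unfolding S_def using fin by (intro open_Diff finite_imp_closed finite_imageI) auto
  have infS: "infinite S" unfolding S_def using fin infinite_Ioo[of 1 "2::real"] by (intro Diff_infinite_finite) auto
  obtain \<rho> where \<rho>: "\<rho> \<in> S" using infinite_imp_nonempty[OF infS] by blast
  obtain \<epsilon> where \<epsilon>: "\<epsilon> > 0" "ball \<rho> \<epsilon> \<subseteq> S" using oS \<rho> by (auto simp: open_contains_ball)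
  have \<rho>1: "1 < \<rho>" "\<rho> < 2" using \<rho> by (auto simp: S_def)
  \<comment> \<open>The scaled annulus has outer radius \<rho> + \<epsilon>, and its inner radius
    \<rho>^2 / (\<rho> + \<epsilon>) exceeds \<rho> - \<epsilon>, so all radii in it belong to the
    ball around \<rho>.\<close>
  define R where "R = (\<rho> + \<epsilon>) / \<rho>"
  show ?thesis
  proof (rule that[of \<rho> R])
    show "0 < \<rho>" "1 < R" using \<rho>1 \<epsilon> by (auto simp: R_def)
    fix z assume z: "z \<in> annulus (1/R) R"
    have "norm z < R" "1 / R < norm z" using z by (auto simp: annulus_def)
    hence 1: "\<rho> * norm z < \<rho> * R" "\<rho> * (1 / R) < \<rho> * norm z"
      using \<rho>1 by (intro mult_strict_left_mono; simp)+
    have 2: "\<rho> * R = \<rho> + \<epsilon>" using \<rho>1 by (simp add: R_def)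
    have "\<rho> - \<epsilon> < \<rho> * (1 / R)"
      using \<rho>1 \<epsilon>(1) by (simp add: R_def field_simps)
    hence "\<rho> * norm z \<in> ball \<rho> \<epsilon>" using 1 2 by (auto simp: dist_real_def)
    hence S: "\<rho> * norm z \<in> S" using \<epsilon> by blast
    have n: "norm (of_real \<rho> * z) = \<rho> * norm z" using \<rho>1 by (simp add: norm_mult)
    have "of_real \<rho> * z \<in> K" using S n by (auto simp: K_def S_def)
    thus "P (of_real \<rho> * z)" using S n unfolding S_def by (metis (mono_tags, lifting) DiffD2 IntI imageI mem_Collect_eq)
  qed
qed

lemma meromorphic_matrix_scale:
  assumes "meromorphic_matrix n M" "a \<noteq> 0"
  shows "meromorphic_matrix n (\<lambda>z. M (a * z))"
  using assms unfolding meromorphic_matrix_def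
  by (auto intro!: meromorphic_on_scale[of "\<lambda>z. M z $$ (_, _)" "- {0}"])

text \<open>Dilations commute with z -> qz. The equation is therefore solved for
  \<open>A (\<rho> * z)\<close>, with the good circle moved to the unit circle, and the solution is
  scaled back.\<close>

theorem exists_fundamental_solution:
  fixes A :: "complex \<Rightarrow> complex mat" and q :: complex
  assumes A: "meromorphic_matrix n A" and dA: "\<forall>\<^sub>\<approx>z\<in>- {0}. Determinant.det (A z) \<noteq> 0"
    and q: "q \<noteq> 0" "norm q < 1"
  obtains M where "meromorphic_matrix n M" "\<not> (\<forall>\<^sub>\<approx>z\<in>- {0}. Determinant.det (M z) = 0)"
    "\<forall>\<^sub>\<approx>z\<in>- {0}. M (q * z) = A z * M z"
proof -
  obtain N where N: "meromorphic_matrix n N"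
    and AN: "\<forall>\<^sub>\<approx>z\<in>- {0}. N z * A z = 1\<^sub>m n \<and> A z * N z = 1\<^sub>m n"
    by (rule meromorphic_matrix_inverse[OF A dA])
  \<comment> \<open>Identities between meromorphic matrices hold only off a sparse set. The points
    collected here are those where the entries are analytic as they stand and A N = 1 holds
    literally.\<close>
  define good where "good = (\<lambda>z. (\<forall>ij\<in>{..<n} \<times> {..<n}. (\<lambda>z. A z $$ ij) analytic_on {z}) \<and>
     (\<forall>ij\<in>{..<n} \<times> {..<n}. (\<lambda>z. N z $$ ij) analytic_on {z}) \<and> A z * N z = 1\<^sub>m n)"
  have "\<forall>\<^sub>\<approx>z\<in>- {0}. good z"
    unfolding good_def
  proof (intro eventually_conj eventually_ball_finite ballI)
    show "\<forall>\<^sub>\<approx>z\<in>- {0}. A z * N z = 1\<^sub>m n" using AN by eventually_elim simp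
  qed (use A N in \<open>auto simp: meromorphic_matrix_def intro!: meromorphic_on_imp_analytic_cosparse\<close>)
  from exists_good_circle[OF this] obtain \<rho>' R where
    \<rho>': "0 < \<rho>'" and R: "1 < R" and good': "\<And>z. z \<in> annulus (1/R) R \<Longrightarrow> good (of_real \<rho>' * z)" by metis
  define \<rho> where "\<rho> = complex_of_real \<rho>'"
  have \<rho>: "\<rho> \<noteq> 0" using \<rho>' by (simp add: \<rho>_def)
  have good: "good (\<rho> * z)" if "z \<in> annulus (1/R) R" for z using good'[OF that] by (simp add: \<rho>_def)
  note cA = meromorphic_matrix_dims[OF A] and cN = meromorphic_matrix_dims[OF N]
  have hol: "(\<lambda>z. F (\<rho> * z) $$ (i, j)) holomorphic_on annulus (1/R) R"
    if F: "\<And>z. z \<in> annulus (1/R) R \<Longrightarrow> (\<lambda>z. F z $$ (i, j)) analytic_on {\<rho> * z}" for F :: "complex \<Rightarrow> complex mat" and i j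
  proof (rule analytic_imp_holomorphic, subst analytic_on_analytic_at, rule ballI)
    fix z assume "z \<in> annulus (1/R) R"
    from analytic_on_compose[of "\<lambda>z. \<rho> * z" "{z}" "\<lambda>z. F z $$ (i, j)"] F[OF this]
    show "(\<lambda>z. F (\<rho> * z) $$ (i, j)) analytic_on {z}" by (auto simp: o_def intro!: analytic_intros)
  qed
  have AN': "(\<Sum>k<n. A (\<rho> * z) $$ (i, k) * N (\<rho> * z) $$ (k, j)) = (if i = j then 1 else 0)"
    if "i < n" "j < n" "z \<in> annulus (1/R) R" for i j z
  proof -
    have "(A (\<rho> * z) * N (\<rho> * z)) $$ (i, j) = 1\<^sub>m n $$ (i, j)"
      using good[OF that(3)] by (simp add: good_def)
    thus ?thesis using that cA cN by (simp add: scalar_prod_def lessThan_atLeast0)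
  qed
  obtain r l a W where r: "1 < r" "r \<le> R" and a: "a \<in> annulus (norm q) 1"
    and W: "\<And>i j. i < n \<Longrightarrow> j < n \<Longrightarrow> W i j holomorphic_on annulus (norm q / r) r"
    and eq: "\<And>i j z. i < n \<Longrightarrow> j < n \<Longrightarrow> z \<in> annulus (1/r) r \<Longrightarrow>
       (if i = j then 1 / (q * z - a) else 0) + W i j (q * z) =
       (\<Sum>k<n. A (\<rho> * z) $$ (i, k) * ((if k = j then 1 / (z - a) else 0) + W k j z)) / z ^ l"
  proof (rule annulus_solution[of n "\<lambda>i j z. A (\<rho> * z) $$ (i, j)" R "\<lambda>i j z. N (\<rho> * z) $$ (i, j)" q])
    show "(\<lambda>z. A (\<rho> * z) $$ (i, j)) holomorphic_on annulus (1/R) R" if "i < n" "j < n" for i j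
      using good that by (intro hol) (auto simp: good_def)
    show "(\<lambda>z. N (\<rho> * z) $$ (i, j)) holomorphic_on annulus (1/R) R" if "i < n" "j < n" for i j
      using good that by (intro hol) (auto simp: good_def)
  qed (use AN' R q in auto)
  obtain \<theta> where \<theta>: "\<theta> holomorphic_on - {0}" "\<And>z. z \<noteq> 0 \<Longrightarrow> \<theta> (q * z) = \<theta> z / z"
    "\<forall>\<^sub>\<approx>z\<in>- {0}. \<theta> z \<noteq> 0" using q_theta_function[OF q] by blast
  define U where "U = (\<lambda>z. mat n n (\<lambda>(i, j). (if i = j then 1 / (z - a) else 0) + W i j z))"
  \<comment> \<open>By the functional equation \<theta>(qz)^(-l) = z^l \<theta>(z)^(-l), which
    cancels the factor z^(-l) in the twisted equation satisfied by \<open>U\<close>.\<close>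
  define M0 where "M0 = (\<lambda>z. inverse (\<theta> z ^ l) \<cdot>\<^sub>m U z)"
  define \<Omega> where "\<Omega> = annulus (norm q / r) r"
  have \<Omega>0: "\<Omega> \<subseteq> - {0}" using r by (auto simp: \<Omega>_def annulus_def not_less)
  obtain M1 where M1: "meromorphic_matrix n M1" "\<forall>\<^sub>\<approx>z\<in>- {0}. M1 (q * z) = A (\<rho> * z) * M1 z"
    "\<And>z. z \<in> annulus (norm q) 1 \<Longrightarrow> M1 z = M0 z"
  proof (rule extend_q_difference_solution)
    show "meromorphic_matrix n (\<lambda>z. A (\<rho> * z))" "meromorphic_matrix n (\<lambda>z. N (\<rho> * z))"
      using A N \<rho> by (auto intro: meromorphic_matrix_scale)
    show "\<forall>\<^sub>\<approx>z\<in>- {0}. N (\<rho> * z) * A (\<rho> * z) = 1\<^sub>m n \<and> A (\<rho> * z) * N (\<rho> * z) = 1\<^sub>m n"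
      by (rule eventually_cosparse_scale[OF \<rho> AN])
    show "M0 z \<in> carrier_mat n n" for z by (simp add: M0_def U_def)
    show "(\<lambda>z. M0 z $$ (i, j)) meromorphic_on annulus (norm q / r) r" if ij: "i < n" "j < n" for i j
    proof -
      have "(\<lambda>z. M0 z $$ (i, j)) = (\<lambda>z. inverse (\<theta> z ^ l) * ((if i = j then 1 / (z - a) else 0) + W i j z))"
        using ij by (auto simp: M0_def U_def)
      moreover have "\<theta> meromorphic_on \<Omega>"
        using \<theta>(1) \<Omega>0 by (intro analytic_on_imp_meromorphic_on)
          (auto simp: analytic_on_open \<Omega>_def intro: holomorphic_on_subset)
      moreover have "W i j meromorphic_on \<Omega>"
        using W[OF ij] by (intro analytic_on_imp_meromorphic_on) (auto simp: analytic_on_open \<Omega>_def)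
      ultimately show ?thesis unfolding \<Omega>_def by (cases "i = j") (auto intro!: meromorphic_intros)
    qed
    fix x assume x: "x \<in> annulus (1/r) r"
    have "\<forall>\<^sub>F z in at x. z \<in> annulus (1/r) r"
      using x by (intro eventually_at_in_open') auto
    thus "\<forall>\<^sub>F z in at x. M0 (q * z) = A (\<rho> * z) * M0 z"
    proof eventually_elim
      case (elim z)
      have z0: "z \<noteq> 0" using elim r by (auto simp: annulus_def)
      show ?case
      proof (rule eq_matI)
        fix i j assume "i < dim_row (A (\<rho> * z) * M0 z)" "j < dim_col (A (\<rho> * z) * M0 z)"
        hence ij: "i < n" "j < n" using cA by (auto simp: M0_def U_def)
        have "M0 (q * z) $$ (i, j) = inverse (\<theta> (q * z) ^ l) * ((if i = j then 1 / (q * z - a) else 0) + W i j (q * z))"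
          using ij by (auto simp: M0_def U_def)
        also have "\<dots> = inverse (\<theta> z ^ l) * (\<Sum>k<n. A (\<rho> * z) $$ (i, k) * ((if k = j then 1 / (z - a) else 0) + W k j z))"
          unfolding eq[OF ij elim] \<theta>(2)[OF z0] using z0 by (simp add: power_divide inverse_eq_divide)
        also have "\<dots> = (\<Sum>k<n. A (\<rho> * z) $$ (i, k) * M0 z $$ (k, j))"
          unfolding sum_distrib_left using ij by (intro sum.cong) (auto simp: M0_def U_def)
        also have "\<dots> = (A (\<rho> * z) * M0 z) $$ (i, j)"
          using ij cA by (simp add: M0_def U_def scalar_prod_def lessThan_atLeast0)
        finally show "M0 (q * z) $$ (i, j) = (A (\<rho> * z) * M0 z) $$ (i, j)" .
      qed (use cA in \<open>auto simp: M0_def U_def\<close>)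
    qed
  qed (use q r in auto)
  \<comment> \<open>The conclusion only denies that the determinant vanishes identically, so its
    behaviour near the pole suffices; there \<open>M1\<close> is literally
    \<open>M0\<close>.\<close>
  have nz: "\<forall>\<^sub>F z in at a. Determinant.det (M1 z) \<noteq> 0"
  proof -
    have a0: "a \<noteq> 0" using a q by (auto simp: annulus_def)
    have "norm q / r < norm q" using q r by (simp add: field_simps)
    hence a\<Omega>: "a \<in> \<Omega>" using a r by (auto simp: annulus_def \<Omega>_def)
    have "W i j \<midarrow>a\<rightarrow> W i j a" if "i < n" "j < n" for i j
      using holomorphic_on_imp_continuous_on[OF W[OF that]] a\<Omega> open_annulus
      by (auto simp: \<Omega>_def continuous_on_eq_continuous_at isCont_def)
    from det_simple_pole_nonzero[of n W a, OF this]
    have "\<forall>\<^sub>F z in at a. Determinant.det (U z) \<noteq> 0" by (simp add: U_def)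
    moreover have "\<forall>\<^sub>F z in at a. \<theta> z \<noteq> 0" using \<theta>(3) a0 by (simp add: cosparse_punctured)
    moreover have "\<forall>\<^sub>F z in at a. z \<in> annulus (norm q) 1"
      using a by (intro eventually_at_in_open') auto
    ultimately show ?thesis
    proof eventually_elim
      case (elim z)
      show ?case unfolding M1(3)[OF elim(3)] using elim by (simp add: M0_def det_smult)
    qed
  qed
  have \<rho>z: "inverse \<rho> * (\<rho> * z) = z" "\<rho> * (inverse \<rho> * z) = z" for z using \<rho> by (auto simp: field_simps)
  have \<rho>i: "inverse \<rho> \<noteq> 0" using \<rho> by simp
  show ?thesis
  proof (rule that[of "\<lambda>z. M1 (inverse \<rho> * z)"])
    show "meromorphic_matrix n (\<lambda>z. M1 (inverse \<rho> * z))" by (rule meromorphic_matrix_scale[OF M1(1) \<rho>i])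
    show "\<not> (\<forall>\<^sub>\<approx>z\<in>- {0}. Determinant.det (M1 (inverse \<rho> * z)) = 0)"
    proof
      assume "\<forall>\<^sub>\<approx>z\<in>- {0}. Determinant.det (M1 (inverse \<rho> * z)) = 0"
      from eventually_cosparse_scale[OF \<rho> this]
      have "\<forall>\<^sub>\<approx>z\<in>- {0}. Determinant.det (M1 z) = 0" unfolding \<rho>z .
      moreover have "a \<noteq> 0" using a q by (auto simp: annulus_def)
      ultimately have "\<forall>\<^sub>F z in at a. Determinant.det (M1 z) = 0" by (simp add: cosparse_punctured)
      with nz have "\<forall>\<^sub>F z in at a. False" by eventually_elim simp
      thus False by simp
    qed
    from eventually_cosparse_scale[OF \<rho>i M1(2)]
    show "\<forall>\<^sub>\<approx>z\<in>- {0}. M1 (inverse \<rho> * (q * z)) = A z * M1 (inverse \<rho> * z)"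
      unfolding \<rho>z by (simp add: mult.left_commute)
  qed
qed


section \<open>Isomonodromy\<close>


text \<open>The shift is the transpose of M(z)^(-1) M(pz). Under z -> qz this product acquires
  A(z)^(-1) A(pz) in the middle, which is a scalar by the multiplier rule for \<open>A\<close>;
  hence C(qz) is the same multiple of C(z).\<close>

lemma associated_shift_exists:
  assumes pq: "p \<noteq> 0" "q \<noteq> 0" "norm q < 1" and A: "theta_shift p A"
  obtains C where "associated p q A C"
proof -
  obtain \<alpha> k where \<alpha>: "\<alpha> \<noteq> 0" and nsA: "nonsingular_meromorphic A"
    and mult: "\<forall>\<^sub>\<approx>z\<in>- {0}. A (p * z) = (\<alpha> * z powi k) \<cdot>\<^sub>m A z"
    using A by (auto simp: theta_shift_def theta_multiplier_def)
  obtain n where n: "n > 0" and A: "meromorphic_matrix n A" and dA: "\<forall>\<^sub>\<approx>z\<in>- {0}. Determinant.det (A z) \<noteq> 0"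
    using nsA by (auto simp: nonsingular_meromorphic_iff)
  obtain M where M: "meromorphic_matrix n M" and dM0: "\<not> (\<forall>\<^sub>\<approx>z\<in>- {0}. Determinant.det (M z) = 0)"
    and eqM: "\<forall>\<^sub>\<approx>z\<in>- {0}. M (q * z) = A z * M z"
    by (rule exists_fundamental_solution[OF A dA pq(2,3)])
  have nsM: "nonsingular_meromorphic M" using n M dM0 by (auto simp: nonsingular_meromorphic_def)
  hence dM: "\<forall>\<^sub>\<approx>z\<in>- {0}. Determinant.det (M z) \<noteq> 0" by (auto simp: nonsingular_meromorphic_iff)
  obtain N where N: "meromorphic_matrix n N" and dN: "\<forall>\<^sub>\<approx>z\<in>- {0}. Determinant.det (N z) \<noteq> 0"
    and NM: "\<forall>\<^sub>\<approx>z\<in>- {0}. N z * M z = 1\<^sub>m n \<and> M z * N z = 1\<^sub>m n"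
    by (rule meromorphic_matrix_inverse[OF M dM])
  obtain B where B: "meromorphic_matrix n B"
    and BA: "\<forall>\<^sub>\<approx>z\<in>- {0}. B z * A z = 1\<^sub>m n \<and> A z * B z = 1\<^sub>m n"
    by (rule meromorphic_matrix_inverse[OF A dA])
  note cA = meromorphic_matrix_dims(3)[OF A] and cM = meromorphic_matrix_dims(3)[OF M]
    and cN = meromorphic_matrix_dims(3)[OF N] and cB = meromorphic_matrix_dims(3)[OF B]
  note as = assoc_mult_mat[where ?n\<^sub>1.0 = n and ?n\<^sub>2.0 = n and ?n\<^sub>3.0 = n and ?n\<^sub>4.0 = n]
  have nsN: "nonsingular_meromorphic N" using n N dN by (auto simp: nonsingular_meromorphic_iff)
  have Mp: "meromorphic_matrix n (\<lambda>z. M (p * z))" by (rule meromorphic_matrix_scale[OF M pq(1)])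
  have nsMp: "nonsingular_meromorphic (\<lambda>z. M (p * z))"
    using n Mp eventually_cosparse_scale[OF pq(1) dM] by (auto simp: nonsingular_meromorphic_iff)
  define C0 where "C0 = (\<lambda>z. N z * M (p * z))"
  have C0: "meromorphic_matrix n C0" "nonsingular_meromorphic C0"
    unfolding C0_def by (rule meromorphic_matrix_mult[OF N Mp], rule nonsingular_meromorphic_mult[OF nsN nsMp N Mp])
  define C where "C = (\<lambda>z. transpose_mat (C0 z))"
  have nsC: "nonsingular_meromorphic C" unfolding C_def by (rule nonsingular_meromorphic_transpose[OF C0(2)])
  have "\<forall>\<^sub>\<approx>z\<in>- {0}. C (q * z) = (\<alpha> * z powi k) \<cdot>\<^sub>m C z"
    using eqM eventually_cosparse_scale[OF pq(1) eqM] NM eventually_cosparse_scale[OF pq(2) NM] BA mult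
  proof eventually_elim
    case (elim z)
    let ?c = "\<alpha> * z powi k"
    have iA: "N (q * z) = N z * B z"
    proof -
      have "N (q * z) = N (q * z) * (M (q * z) * (N z * B z))"
      proof -
        have "M (q * z) * (N z * B z) = A z * ((M z * N z) * B z)"
          using elim(1) by (simp add: as cA cM cN cB mult_carrier_mat[where n = n])
        also have "\<dots> = 1\<^sub>m n" using elim left_mult_one_mat[OF cB] by simp
        finally show ?thesis using right_mult_one_mat[OF cN] by simp
      qed
      also have "\<dots> = (N (q * z) * M (q * z)) * (N z * B z)"
        by (simp add: as cM cN cB mult_carrier_mat[where n = n])
      also have "\<dots> = N z * B z"
        using elim left_mult_one_mat[OF mult_carrier_mat[OF cN cB]] by simp
      finally show ?thesis .
    qed
    have "M (p * (q * z)) = A (p * z) * M (p * z)" using elim(2) by (metis mult.left_commute)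
    hence "C0 (q * z) = (N z * B z) * (A (p * z) * M (p * z))"
      by (simp only: C0_def iA)
    also have "\<dots> = (N z * B z) * (?c \<cdot>\<^sub>m (A z * M (p * z)))"
      using elim by (simp add: mult_smult_assoc_mat[OF cA cM])
    also have "\<dots> = ?c \<cdot>\<^sub>m ((N z * B z) * (A z * M (p * z)))"
      by (rule mult_smult_distrib[OF mult_carrier_mat[OF cN cB] mult_carrier_mat[OF cA cM]])
    also have "(N z * B z) * (A z * M (p * z)) = N z * ((B z * A z) * M (p * z))"
      by (simp add: as cA cM cN cB mult_carrier_mat[where n = n])
    also have "\<dots> = C0 z" using elim left_mult_one_mat[OF cM] by (simp add: C0_def)
    finally show ?case by (auto simp: C_def intro!: eq_matI)
  qed
  hence thC: "theta_shift q C" using \<alpha> nsC by (auto simp: theta_shift_def theta_multiplier_def)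
  have "\<forall>\<^sub>\<approx>z\<in>- {0}. transpose_mat (M (p * z)) = C z * transpose_mat (M z)"
    using NM
  proof eventually_elim
    case (elim z)
    have "M (p * z) = (M z * N z) * M (p * z)" using elim left_mult_one_mat[OF cM] by simp
    also have "\<dots> = M z * C0 z" by (simp add: C0_def as cM cN mult_carrier_mat[where n = n])
    finally have "transpose_mat (M (p * z)) = transpose_mat (M z * C0 z)" by simp
    also have "\<dots> = C z * transpose_mat (M z)"
      unfolding C_def by (rule transpose_mult[OF cM meromorphic_matrix_dims(3)[OF C0(1)]])
    finally show ?case .
  qed
  hence "fundamental_matrix p C (\<lambda>z. transpose_mat (M z))"
    using nonsingular_meromorphic_transpose[OF nsM] by (auto simp: fundamental_matrix_def)
  moreover have "fundamental_matrix q A M" using nsM eqM by (auto simp: fundamental_matrix_def)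
  ultimately have "associated p q A C" using thC by (auto simp: associated_def)
  thus ?thesis by (rule that)
qed

text \<open>Under z -> pz both fundamental matrices are multiplied on the right by the same
  transpose of \<open>C\<close>. This factor cancels in M' M^(-1), which is therefore p-elliptic,
  while the left factors \<open>A\<close> and \<open>A'\<close> under z -> qz give the gauge
  relation.\<close>

lemma common_associated_imp_gauge_equivalent:
  assumes p: "p \<noteq> 0" "q \<noteq> 0" and A: "theta_shift p A" and A': "theta_shift p A'"
    and C: "associated p q A C" "associated p q A' C"
  obtains B where "nonsingular_elliptic p B" "\<forall>\<^sub>\<approx>z\<in>- {0}. A' z * B z = B (q * z) * A z"
proof -
  obtain n where n: "n > 0" and mC: "meromorphic_matrix n C"
    using C by (auto simp: associated_def theta_shift_def theta_multiplier_def nonsingular_meromorphic_iff)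
  \<comment> \<open>\<open>A\<close> and \<open>A'\<close> might a priori have different sizes; each
    is matched with the size of the common \<open>C\<close>.\<close>
  have sol: "\<exists>M. meromorphic_matrix n X \<and> meromorphic_matrix n M \<and> nonsingular_meromorphic M \<and>
      (\<forall>\<^sub>\<approx>z\<in>- {0}. M (q * z) = X z * M z) \<and> (\<forall>\<^sub>\<approx>z\<in>- {0}. M (p * z) = M z * transpose_mat (C z))"
    if X: "theta_shift p X" and XC: "associated p q X C" for X
  proof -
    obtain M where M: "fundamental_matrix q X M" "fundamental_matrix p C (\<lambda>z. transpose_mat (M z))"
      using XC by (auto simp: associated_def)
    obtain m where m: "meromorphic_matrix m M" using M(1) by (auto simp: fundamental_matrix_def nonsingular_meromorphic_iff)
    have "m = n" by (rule fundamental_dims[OF M(2) mC meromorphic_matrix_transpose[OF m]])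
    hence m: "meromorphic_matrix n M" using m by simp
    obtain k where k: "meromorphic_matrix k X"
      using X by (auto simp: theta_shift_def theta_multiplier_def nonsingular_meromorphic_iff)
    have "n = k" by (rule fundamental_dims[OF M(1) k m])
    hence k: "meromorphic_matrix n X" using k by simp
    have "\<forall>\<^sub>\<approx>z\<in>- {0}. transpose_mat (M (p * z)) = C z * transpose_mat (M z)"
      using M(2) by (auto simp: fundamental_matrix_def)
    hence "\<forall>\<^sub>\<approx>z\<in>- {0}. M (p * z) = M z * transpose_mat (C z)"
    proof eventually_elim
      case (elim z)
      have "M (p * z) = transpose_mat (C z * transpose_mat (M z))" using elim transpose_transpose by metis
      also have "\<dots> = transpose_mat (transpose_mat (M z)) * transpose_mat (C z)"
        by (rule transpose_mult[OF meromorphic_matrix_dims(3)[OF mC] meromorphic_matrix_dims(3)[OF meromorphic_matrix_transpose[OF m]]])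
      finally show ?case by simp
    qed
    thus ?thesis using k m M(1) by (auto simp: fundamental_matrix_def)
  qed
  obtain M where mA: "meromorphic_matrix n A" and M: "meromorphic_matrix n M" "nonsingular_meromorphic M"
    and eM: "\<forall>\<^sub>\<approx>z\<in>- {0}. M (q * z) = A z * M z" "\<forall>\<^sub>\<approx>z\<in>- {0}. M (p * z) = M z * transpose_mat (C z)"
    using sol[OF A C(1)] by blast
  obtain M' where mA': "meromorphic_matrix n A'" and M': "meromorphic_matrix n M'" "nonsingular_meromorphic M'"
    and eM': "\<forall>\<^sub>\<approx>z\<in>- {0}. M' (q * z) = A' z * M' z" "\<forall>\<^sub>\<approx>z\<in>- {0}. M' (p * z) = M' z * transpose_mat (C z)"
    using sol[OF A' C(2)] by blast
  have dM: "\<forall>\<^sub>\<approx>z\<in>- {0}. Determinant.det (M z) \<noteq> 0" using M(2) by (auto simp: nonsingular_meromorphic_iff)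
  obtain N where N: "meromorphic_matrix n N" and dN: "\<forall>\<^sub>\<approx>z\<in>- {0}. Determinant.det (N z) \<noteq> 0"
    and NM: "\<forall>\<^sub>\<approx>z\<in>- {0}. N z * M z = 1\<^sub>m n \<and> M z * N z = 1\<^sub>m n"
    by (rule meromorphic_matrix_inverse[OF M(1) dM])
  have nsN: "nonsingular_meromorphic N" using n N dN by (auto simp: nonsingular_meromorphic_iff)
  have cC: "transpose_mat (C z) \<in> carrier_mat n n" for z
    using meromorphic_matrix_dims(3)[OF mC] by simp
  note cc = meromorphic_matrix_dims(3)[OF mA] meromorphic_matrix_dims(3)[OF mA'] meromorphic_matrix_dims(3)[OF M(1)]
    meromorphic_matrix_dims(3)[OF M'(1)] meromorphic_matrix_dims(3)[OF N] cC
  note as = assoc_mult_mat[where ?n\<^sub>1.0 = n and ?n\<^sub>2.0 = n and ?n\<^sub>3.0 = n and ?n\<^sub>4.0 = n]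
  define B where "B = (\<lambda>z. M' z * N z)"
  have cB: "B z \<in> carrier_mat n n" for z unfolding B_def using cc(4,5) by (rule mult_carrier_mat)
  have BM: "\<forall>\<^sub>\<approx>z\<in>- {0}. B z * M z = M' z"
    using NM
  proof eventually_elim
    case (elim z)
    have "B z * M z = M' z * (N z * M z)" by (simp add: B_def as cc)
    thus ?case using elim right_mult_one_mat[OF cc(4)] by simp
  qed
  have right_cancel: "X = Y" if "X * M z = Y * M z" "M z * N z = 1\<^sub>m n" "X \<in> carrier_mat n n" "Y \<in> carrier_mat n n" for X Y z
  proof -
    have "X = (X * M z) * N z"
      using as[OF that(3) cc(3) cc(5)] that(2) right_mult_one_mat[OF that(3)] by simp
    moreover have "Y = (Y * M z) * N z"
      using as[OF that(4) cc(3) cc(5)] that(2) right_mult_one_mat[OF that(4)] by simp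
    ultimately show ?thesis using that(1) by simp
  qed
  have "nonsingular_meromorphic B"
    unfolding B_def by (rule nonsingular_meromorphic_mult[OF M'(2) nsN M'(1) N])
  moreover have "\<forall>\<^sub>\<approx>z\<in>- {0}. B (p * z) = B z"
    using BM eventually_cosparse_scale[OF p(1) BM] NM eventually_cosparse_scale[OF p(1) NM] eM(2) eM'(2)
  proof eventually_elim
    case (elim z)
    have "B (p * z) * M (p * z) = M' z * transpose_mat (C z)" using elim(2,6) by simp
    also have "\<dots> = (B z * M z) * transpose_mat (C z)" using elim(1) by simp
    also have "\<dots> = B z * (M z * transpose_mat (C z))" by (rule as[OF cB cc(3) cC])
    also have "\<dots> = B z * M (p * z)" using elim(5) by simp
    finally have "B (p * z) * M (p * z) = B z * M (p * z)" .
    thus ?case by (rule right_cancel[OF _ conjunct2[OF elim(4)] cB cB])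
  qed
  moreover have "\<forall>\<^sub>\<approx>z\<in>- {0}. A' z * B z = B (q * z) * A z"
    using BM eventually_cosparse_scale[OF p(2) BM] NM eM(1) eM'(1)
  proof eventually_elim
    case (elim z)
    have "(A' z * B z) * M z = A' z * M' z" using elim(1) by (simp add: as cc cB)
    also have "\<dots> = B (q * z) * (A z * M z)" using elim by simp
    also have "\<dots> = (B (q * z) * A z) * M z" by (simp add: as cc cB)
    finally have "(A' z * B z) * M z = (B (q * z) * A z) * M z" .
    thus ?case
      by (rule right_cancel[OF _ conjunct2[OF elim(3)] mult_carrier_mat[OF cc(2) cB] mult_carrier_mat[OF cB cc(1)]])
  qed
  ultimately show ?thesis by (intro that) (auto simp: nonsingular_elliptic_def)
qed

text \<open>For p-elliptic \<open>B\<close> the matrices M and B M have the same right factor under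
  z -> pz, hence the same \<open>C\<close>. The opposite inclusion comes from the inverse gauge
  transformation.\<close>

lemma gauge_equivalent_weak_monodromy_mono:
  assumes p: "p \<noteq> 0" "q \<noteq> 0" and A: "theta_shift p A" and A': "theta_shift p A'"
    and B: "nonsingular_elliptic p B" "\<forall>\<^sub>\<approx>z\<in>- {0}. A' z * B z = B (q * z) * A z"
  shows "weak_monodromy p q A \<subseteq> weak_monodromy p q A'"
proof
  fix C assume C: "C \<in> weak_monodromy p q A"
  obtain M where M: "fundamental_matrix q A M" "fundamental_matrix p C (\<lambda>z. transpose_mat (M z))"
    and thC: "theta_shift q C" using C by (auto simp: weak_monodromy_def associated_def)
  obtain n where mA: "meromorphic_matrix n A"
    using A by (auto simp: theta_shift_def theta_multiplier_def nonsingular_meromorphic_iff)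
  obtain m where m: "meromorphic_matrix m B"
    using B(1) by (auto simp: nonsingular_elliptic_def nonsingular_meromorphic_iff)
  obtain k where k: "meromorphic_matrix k A'"
    using A' by (auto simp: theta_shift_def theta_multiplier_def nonsingular_meromorphic_iff)
  \<comment> \<open>The sizes of \<open>B\<close> and \<open>A'\<close> are not given in advance;
    one point at which the relation holds determines them.\<close>
  obtain z where z: "A' z * B z = B (q * z) * A z" using cosparse_ex[OF B(2)] by auto
  have "m = n" using arg_cong[OF z, of dim_col] meromorphic_matrix_dims[OF m] meromorphic_matrix_dims[OF mA] by simp
  moreover have "k = m" using arg_cong[OF z, of dim_row] meromorphic_matrix_dims[OF m] meromorphic_matrix_dims[OF k] by simp
  ultimately have mB: "meromorphic_matrix n B" and mA': "meromorphic_matrix n A'" using m k by auto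
  obtain l where l: "meromorphic_matrix l M" using M(1) by (auto simp: fundamental_matrix_def nonsingular_meromorphic_iff)
  have "l = n" by (rule fundamental_dims[OF M(1) mA l])
  hence mM: "meromorphic_matrix n M" using l by simp
  obtain j where j: "meromorphic_matrix j C"
    using thC by (auto simp: theta_shift_def theta_multiplier_def nonsingular_meromorphic_iff)
  have "n = j" by (rule fundamental_dims[OF M(2) j meromorphic_matrix_transpose[OF mM]])
  hence mC: "meromorphic_matrix n C" using j by simp
  note cc = meromorphic_matrix_dims(3)[OF mA] meromorphic_matrix_dims(3)[OF mA'] meromorphic_matrix_dims(3)[OF mM]
    meromorphic_matrix_dims(3)[OF mB] meromorphic_matrix_dims(3)[OF mC]
  note as = assoc_mult_mat[where ?n\<^sub>1.0 = n and ?n\<^sub>2.0 = n and ?n\<^sub>3.0 = n and ?n\<^sub>4.0 = n]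
  define M' where "M' = (\<lambda>z. B z * M z)"
  have nsM': "nonsingular_meromorphic M'"
    unfolding M'_def using B(1) M(1) mB mM
    by (intro nonsingular_meromorphic_mult[of _ _ n]) (auto simp: fundamental_matrix_def nonsingular_elliptic_def)
  have "\<forall>\<^sub>\<approx>z\<in>- {0}. M (q * z) = A z * M z" using M(1) by (auto simp: fundamental_matrix_def)
  with B(2) have "\<forall>\<^sub>\<approx>z\<in>- {0}. M' (q * z) = A' z * M' z"
  proof eventually_elim
    case (elim z)
    have "M' (q * z) = (B (q * z) * A z) * M z" using elim by (simp add: M'_def as cc)
    also have "\<dots> = (A' z * B z) * M z" using elim by simp
    also have "\<dots> = A' z * M' z" by (simp add: M'_def as cc)
    finally show ?case .
  qed
  hence "fundamental_matrix q A' M'" using nsM' by (auto simp: fundamental_matrix_def)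
  moreover have "\<forall>\<^sub>\<approx>z\<in>- {0}. B (p * z) = B z" "\<forall>\<^sub>\<approx>z\<in>- {0}. transpose_mat (M (p * z)) = C z * transpose_mat (M z)"
    using B(1) M(2) by (auto simp: fundamental_matrix_def nonsingular_elliptic_def)
  hence "\<forall>\<^sub>\<approx>z\<in>- {0}. transpose_mat (M' (p * z)) = C z * transpose_mat (M' z)"
  proof eventually_elim
    case (elim z)
    have T: "transpose_mat (M' w) = transpose_mat (M w) * transpose_mat (B w)" for w
      unfolding M'_def by (rule transpose_mult[OF cc(4) cc(3)])
    show ?case using elim by (simp add: T as cc)
  qed
  hence "fundamental_matrix p C (\<lambda>z. transpose_mat (M' z))"
    using nonsingular_meromorphic_transpose[OF nsM'] by (auto simp: fundamental_matrix_def)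
  ultimately show "C \<in> weak_monodromy p q A'" using thC
    by (auto simp: weak_monodromy_def associated_def)
qed

text \<open>The inverse matrix of \<open>B\<close> is again p-elliptic, and the relation is
  multiplied by it at \<open>q * z\<close> on the left and at \<open>z\<close> on the right.\<close>

lemma gauge_equivalent_sym:
  assumes p: "p \<noteq> 0" "q \<noteq> 0" and A: "theta_shift p A" and A': "theta_shift p A'"
    and B: "nonsingular_elliptic p B" "\<forall>\<^sub>\<approx>z\<in>- {0}. A' z * B z = B (q * z) * A z"
  obtains B' where "nonsingular_elliptic p B'" "\<forall>\<^sub>\<approx>z\<in>- {0}. A z * B' z = B' (q * z) * A' z"
proof -
  obtain n where mA: "meromorphic_matrix n A"
    using A by (auto simp: theta_shift_def theta_multiplier_def nonsingular_meromorphic_iff)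
  obtain m where m: "meromorphic_matrix m B" "m > 0" "\<forall>\<^sub>\<approx>z\<in>- {0}. Determinant.det (B z) \<noteq> 0"
    using B(1) by (auto simp: nonsingular_elliptic_def nonsingular_meromorphic_iff)
  obtain k where k: "meromorphic_matrix k A'"
    using A' by (auto simp: theta_shift_def theta_multiplier_def nonsingular_meromorphic_iff)
  obtain z where z: "A' z * B z = B (q * z) * A z" using cosparse_ex[OF B(2)] by auto
  have "m = n" using arg_cong[OF z, of dim_col] meromorphic_matrix_dims[OF m(1)] meromorphic_matrix_dims[OF mA] by simp
  moreover have "k = m" using arg_cong[OF z, of dim_row] meromorphic_matrix_dims[OF m(1)] meromorphic_matrix_dims[OF k] by simp
  ultimately have mB: "meromorphic_matrix n B" and mA': "meromorphic_matrix n A'" and n: "n > 0" using m k by auto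
  obtain N where N: "meromorphic_matrix n N" and dN: "\<forall>\<^sub>\<approx>z\<in>- {0}. Determinant.det (N z) \<noteq> 0"
    and NB: "\<forall>\<^sub>\<approx>z\<in>- {0}. N z * B z = 1\<^sub>m n \<and> B z * N z = 1\<^sub>m n"
    by (rule meromorphic_matrix_inverse[OF mB m(3)])
  note cc = meromorphic_matrix_dims(3)[OF mA] meromorphic_matrix_dims(3)[OF mA']
    meromorphic_matrix_dims(3)[OF mB] meromorphic_matrix_dims(3)[OF N]
  note as = assoc_mult_mat[where ?n\<^sub>1.0 = n and ?n\<^sub>2.0 = n and ?n\<^sub>3.0 = n and ?n\<^sub>4.0 = n]
  have "nonsingular_meromorphic N" using n N dN by (auto simp: nonsingular_meromorphic_iff)
  moreover have "\<forall>\<^sub>\<approx>z\<in>- {0}. B (p * z) = B z" using B(1) by (auto simp: nonsingular_elliptic_def)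
  hence "\<forall>\<^sub>\<approx>z\<in>- {0}. N (p * z) = N z"
    using NB eventually_cosparse_scale[OF p(1) NB]
  proof eventually_elim
    case (elim z)
    have "N (p * z) = N (p * z) * (B z * N z)" using elim right_mult_one_mat[OF cc(4)] by simp
    also have "\<dots> = (N (p * z) * B z) * N z" by (rule as[OF cc(4) cc(3) cc(4), symmetric])
    also have "\<dots> = N z" using elim left_mult_one_mat[OF cc(4)] by simp
    finally show ?case .
  qed
  moreover have "\<forall>\<^sub>\<approx>z\<in>- {0}. A z * N z = N (q * z) * A' z"
    using NB eventually_cosparse_scale[OF p(2) NB] B(2)
  proof eventually_elim
    case (elim z)
    have "A z * N z = (N (q * z) * B (q * z)) * (A z * N z)"
      using elim left_mult_one_mat[OF mult_carrier_mat[OF cc(1) cc(4)]] by simp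
    also have "\<dots> = N (q * z) * ((B (q * z) * A z) * N z)" by (simp add: as cc mult_carrier_mat[where n = n])
    also have "\<dots> = N (q * z) * ((A' z * B z) * N z)" using elim by simp
    also have "\<dots> = N (q * z) * (A' z * (B z * N z))" by (simp add: as cc)
    also have "\<dots> = N (q * z) * A' z" using elim right_mult_one_mat[OF cc(2)] by simp
    finally show ?case .
  qed
  ultimately show ?thesis by (intro that) (auto simp: nonsingular_elliptic_def)
qed

theorem theorem2p11:
  fixes p q :: complex and A A' :: "complex \<Rightarrow> complex mat"
  assumes "p \<noteq> 0" "q \<noteq> 0" "norm p < 1" "norm q < 1"
    and "range (\<lambda>i::int. p powi i) \<inter> range (\<lambda>j::int. q powi j) = {1}"
    and "theta_shift p A" "theta_shift p A'"
  shows "isomonodromic p q A A' \<longleftrightarrow>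
         (\<exists>B. nonsingular_elliptic p B \<and>
              (\<forall>\<^sub>\<approx>z\<in>- {0}. A' z * B z = B (q * z) * A z))"
proof
  assume iso: "isomonodromic p q A A'"
  obtain C where C: "associated p q A C"
    by (rule associated_shift_exists[OF assms(1,2,4,6)])
  hence C': "associated p q A' C" using iso by (auto simp: isomonodromic_def weak_monodromy_def)
  show "\<exists>B. nonsingular_elliptic p B \<and> (\<forall>\<^sub>\<approx>z\<in>- {0}. A' z * B z = B (q * z) * A z)"
    by (rule common_associated_imp_gauge_equivalent[OF assms(1,2,6,7) C C']) blast
next
  assume "\<exists>B. nonsingular_elliptic p B \<and> (\<forall>\<^sub>\<approx>z\<in>- {0}. A' z * B z = B (q * z) * A z)"
  then obtain B where B: "nonsingular_elliptic p B" "\<forall>\<^sub>\<approx>z\<in>- {0}. A' z * B z = B (q * z) * A z" by blast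
  obtain B' where B': "nonsingular_elliptic p B'" "\<forall>\<^sub>\<approx>z\<in>- {0}. A z * B' z = B' (q * z) * A' z"
    by (rule gauge_equivalent_sym[OF assms(1,2,6,7) B])
  show "isomonodromic p q A A'"
    unfolding isomonodromic_def
    using gauge_equivalent_weak_monodromy_mono[OF assms(1,2,6,7) B]
      gauge_equivalent_weak_monodromy_mono[OF assms(1,2,7,6) B'] by blast
qed

end
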